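(* Let $f\colon\mathbb{N}\to\mathbb{N}$ be nondecreasing, and suppose that there is $n_1\in\mathbb{N}$ such that $1\le f(n)\le n/2$ for all $n\ge n_1$. Let $G=\{0^a1^b \mid a,b\ge f(a+b)\}$, and let $X$ be the coded shift generated by $G$ (over the alphabet $\{0,1\}$). Let $\varphi=-\mathbf{1}_{[1]}$. Then $P(t\varphi)\ge 0$ for all $t\in\mathbb{R}$, and $t\mapsto P(t\varphi)$ is non-increasing. Writing $$t_0=\inf\{t\in\mathbb{R} \mid P(t\varphi)=0\}=\sup\{t\in\mathbb{R}\mid P(t\varphi)>0\}$$ (possibly $t_0=+\infty$), the following are true. (i) For the function $g(n)=2n_1+2\max(f(n),n_1)$, the language $\mathcal{L}=\mathcal{L}(X)$ is $g$-Hamming approachable by $\mathcal{G}=G^*$. (ii) Given $t\ge0$, the potential $t\varphi$ is hyperbolic if and only if $t<t_0$. (iii) If $0\le t<t_0$, then there is a unique equilibrium state for $t\varphi$, and it has positive entropy. (iv) If $t>t_0$, then $\delta_0$ is the unique equilibrium state for $t\varphi$. (v) $t_0<\infty$ if and only if there exists $\gamma>0$ such that $\sum_{n\in\mathbb{N}}\gamma^{f(n)}<\infty$.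
   Context: $\mathbb{N}=\{1,2,3,\dots\}$. For a finite alphabet $A$ and $G\subset A^*$ (finite words over $A$), $G^*$ is the set of all finite concatenations of words in $G$; the coded shift generated by $G$ is the shift space $X\subset A^{\mathbb{N}}$ (closed and invariant under the left shift $\sigma$) whose language consists of all subwords of elements of $G^*$. The language $\mathcal{L}(X)$ is the set of finite words appearing in elements of $X$; a subscript $n$ denotes the subset of words of length $n$. $0^a1^b$ is the word of $a$ zeros followed by $b$ ones. $[1]=\{x\in X : x_1=1\}$, and $\mathbf{1}_{[1]}$ is its indicator function. $\delta_0$ is the Dirac measure at the fixed point $000\cdots\in X$. $P(\psi)=\sup_\mu\big(h_\mu(\sigma)+\int\psi\,d\mu\big)$ over all $\sigma$-invariant Borel probability measures $\mu$ on $X$; an equilibrium state for $\psi$ is a $\mu$ attaining the supremum. A continuous potential $\psi$ is hyperbolic if $P(\psi)>\sup_\mu\int\psi\,d\mu$. For words $v,w$ of equal length, $d_{\mathrm{Ham}}(v,w)=\#\{i: v_i\neq w_i\}$. $\mathcal{L}$ is $g$-Hamming approachable by $\mathcal{G}\subset\mathcal{L}$ if there is $n_0\in\mathbb{N}$ such that for every $n\ge n_0$ and $w\in\mathcal{L}_n$ there is $v\in\mathcal{G}_n$ with $d_{\mathrm{Ham}}(v,w)\le g(n)$. *)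

theory Defs
  imports "HOL-Probability.Probability" "HOL-Library.Sublist"
begin

section \<open>Shift spaces and their languages\<close>

text \<open>
  A point of \<open>A\<^sup>\<nat>\<close> is a function on \<open>nat\<close>, so the mathematical coordinate \<open>x\<^sub>k\<close>, \<open>k \<ge> 1\<close>,
  is \<open>x (k - 1)\<close>.  The symbols carry the discrete topology, and \<open>nat \<Rightarrow> 'a\<close> carries the
  product topology of the library together with its Borel sigma algebra.
\<close>

definition shift_map :: "(nat \<Rightarrow> 'a) \<Rightarrow> (nat \<Rightarrow> 'a)" where
  "shift_map x = (\<lambda>n. x (Suc n))"

definition shift_space :: "'a set \<Rightarrow> (nat \<Rightarrow> 'a::discrete_topology) set \<Rightarrow> bool" where
  "shift_space A X \<longleftrightarrow> finite A \<and> X \<subseteq> UNIV \<rightarrow> A \<and> closed X \<and> shift_map ` X \<subseteq> X"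

definition language :: "(nat \<Rightarrow> 'a) set \<Rightarrow> 'a list set" where
  "language X = {map x [i..<i + n] | x i n. x \<in> X}"

definition words_of_length :: "'a list set \<Rightarrow> nat \<Rightarrow> 'a list set" where
  "words_of_length L n = {w \<in> L. length w = n}"

definition concatenations :: "'a list set \<Rightarrow> 'a list set" where
  "concatenations G = concat ` lists G"

text \<open>
  \<^term>\<open>sublist w v\<close> says that \<open>w\<close> is a contiguous block of \<open>v\<close>.  A shift space is determined by
  its language; existence and uniqueness of the coded shift are proved below.
\<close>

definition coded_shift :: "'a set \<Rightarrow> 'a list set \<Rightarrow> (nat \<Rightarrow> 'a::discrete_topology) set \<Rightarrow> bool" where
  "coded_shift A G X \<longleftrightarrow>
     shift_space A X \<and> language X = {w. \<exists>v\<in>concatenations G. sublist w v}"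

definition hamming_dist :: "'a list \<Rightarrow> 'a list \<Rightarrow> nat" where
  "hamming_dist v w = card {i. i < length v \<and> v ! i \<noteq> w ! i}"

definition hamming_approachable :: "(nat \<Rightarrow> nat) \<Rightarrow> 'a list set \<Rightarrow> 'a list set \<Rightarrow> bool" where
  "hamming_approachable g L K \<longleftrightarrow> K \<subseteq> L \<and>
     (\<exists>n\<^sub>0\<ge>1. \<forall>n\<ge>n\<^sub>0. \<forall>w\<in>words_of_length L n. \<exists>v\<in>words_of_length K n. hamming_dist v w \<le> g n)"

section \<open>Measure-theoretic entropy\<close>

text \<open>The convention \<open>0 ln 0 = 0\<close> holds automatically.\<close>

definition partition_entropy :: "'a measure \<Rightarrow> 'a set set \<Rightarrow> real" where
  "partition_entropy M P = (\<Sum>A\<in>P. - (measure M A * ln (measure M A)))"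

definition finite_measurable_partition :: "'a measure \<Rightarrow> 'a set set \<Rightarrow> bool" where
  "finite_measurable_partition M P \<longleftrightarrow> finite P \<and> P \<subseteq> sets M \<and> partition_on (space M) P"

text \<open>The join of \<open>P\<close>, \<open>T\<^sup>-\<^sup>1P\<close>, \<dots>, \<open>T\<^sup>-\<^sup>(\<^sup>n\<^sup>-\<^sup>1\<^sup>)P\<close>.\<close>

definition iterated_join :: "'a measure \<Rightarrow> ('a \<Rightarrow> 'a) \<Rightarrow> 'a set set \<Rightarrow> nat \<Rightarrow> 'a set set" where
  "iterated_join M T P n =
     {{x \<in> space M. \<forall>i<n. (T ^^ i) x \<in> B i} | B. \<forall>i<n. B i \<in> P} - {{}}"

text \<open>
  The limit exists for every measure-preserving \<open>T\<close> by subadditivity.  The supremum is taken in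
  the extended reals.
\<close>

definition ks_entropy :: "'a measure \<Rightarrow> ('a \<Rightarrow> 'a) \<Rightarrow> ereal" where
  "ks_entropy M T =
     (SUP P\<in>{P. finite_measurable_partition M P}.
        ereal (lim (\<lambda>n. partition_entropy M (iterated_join M T P n) / real n)))"

section \<open>Pressure and equilibrium states\<close>

definition invariant_measures :: "(nat \<Rightarrow> 'a::discrete_topology) set \<Rightarrow> (nat \<Rightarrow> 'a) measure set" where
  "invariant_measures X =
     {M. prob_space M \<and> sets M = sets (restrict_space borel X) \<and>
         shift_map \<in> M \<rightarrow>\<^sub>M M \<and> distr M M shift_map = M}"

definition pressure :: "(nat \<Rightarrow> 'a::discrete_topology) set \<Rightarrow> ((nat \<Rightarrow> 'a) \<Rightarrow> real) \<Rightarrow> ereal" where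
  "pressure X \<psi> = (SUP M\<in>invariant_measures X. ks_entropy M shift_map + ereal (\<integral>x. \<psi> x \<partial>M))"

definition equilibrium_state ::
    "(nat \<Rightarrow> 'a::discrete_topology) set \<Rightarrow> ((nat \<Rightarrow> 'a) \<Rightarrow> real) \<Rightarrow> (nat \<Rightarrow> 'a) measure \<Rightarrow> bool" where
  "equilibrium_state X \<psi> M \<longleftrightarrow>
     M \<in> invariant_measures X \<and> ks_entropy M shift_map + ereal (\<integral>x. \<psi> x \<partial>M) = pressure X \<psi>"

definition hyperbolic_potential ::
    "(nat \<Rightarrow> 'a::discrete_topology) set \<Rightarrow> ((nat \<Rightarrow> 'a) \<Rightarrow> real) \<Rightarrow> bool" where
  "hyperbolic_potential X \<psi> \<longleftrightarrow>
     continuous_on X \<psi> \<and> pressure X \<psi> > (SUP M\<in>invariant_measures X. ereal (\<integral>x. \<psi> x \<partial>M))"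

section \<open>Existence and uniqueness of the coded shift\<close>

lemma shift_space_eq_language:
  assumes "shift_space A X"
  shows "X = {x. \<forall>i n. map x [i..<i + n] \<in> language X}"
proof (intro set_eqI iffI)
  fix x assume "x \<in> X"
  then show "x \<in> {x. \<forall>i n. map x [i..<i + n] \<in> language X}"
    by (auto simp: language_def)
next
  fix x assume x: "x \<in> {x. \<forall>i n. map x [i..<i + n] \<in> language X}"
  have iter: "(\<lambda>k. y (i + k)) \<in> X" if "y \<in> X" for y i
  proof (induction i)
    case 0
    then show ?case using that by simp
  next
    case (Suc i)
    then have "shift_map (\<lambda>k. y (i + k)) \<in> X" using assms by (auto simp: shift_space_def)
    then show ?case by (simp add: shift_map_def)
  qed
  have "\<exists>z\<in>X. \<forall>k<n. z k = x k" for n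
  proof -
    obtain y i m where y: "y \<in> X" "map x [0..<0 + n] = map y [i..<i + m]"
      using x unfolding language_def by blast
    have "length (map x [0..<0 + n]) = length (map y [i..<i + m])" by (simp only: y(2))
    then have "m = n" by simp
    have "y (i + k) = x k" if "k < n" for k
      using arg_cong[OF y(2), of "\<lambda>l. l ! k"] that \<open>m = n\<close> by (simp del: map_eq_conv)
    then show ?thesis by (intro bexI[OF _ iter[OF y(1), of i]]) simp
  qed
  then obtain z where z: "\<And>n. z n \<in> X" "\<And>n k. k < n \<Longrightarrow> z n k = x k" by metis
  have "(\<lambda>n. z n k) \<longlonglongrightarrow> x k" for k
  proof (rule tendsto_eventually)
    show "\<forall>\<^sub>F n in sequentially. z n k = x k"
      using z(2) by (auto simp: eventually_sequentially intro!: exI[of _ "Suc k"])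
  qed
  then have "limitin (product_topology (\<lambda>_. euclidean) UNIV) z x sequentially"
    by (subst limitin_componentwise) (auto simp: limitin_canonical_iff)
  then have "z \<longlonglongrightarrow> x"
    by (simp add: euclidean_product_topology limitin_canonical_iff)
  moreover have "closed X" using assms by (simp add: shift_space_def)
  ultimately show "x \<in> X"
    using z(1) by (blast intro: closed_sequentially)
qed

lemma coded_shift_unique:
  assumes "coded_shift A G X" "coded_shift A G Y"
  shows "X = Y"
proof -
  have "X = {x. \<forall>i n. map x [i..<i + n] \<in> language X}"
    using assms(1) by (intro shift_space_eq_language[of A]) (simp add: coded_shift_def)
  also have "language X = language Y"
    using assms by (simp add: coded_shift_def)
  also have "{x. \<forall>i n. map x [i..<i + n] \<in> language Y} = Y"
    using assms(2) by (intro shift_space_eq_language[of A, symmetric]) (simp add: coded_shift_def)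
  finally show ?thesis .
qed

lemma coded_shift_exists:
  fixes A :: "'a::discrete_topology set"
  assumes "finite A" and GA: "G \<subseteq> lists A" and u: "u \<in> G" "u \<noteq> []"
  shows "\<exists>X. coded_shift A G X"
proof -
  define L where "L = {w. \<exists>v\<in>concatenations G. sublist w v}"
  define X where "X = {x. \<forall>i n. map x [i..<i + n] \<in> L}"
  have LA: "set w \<subseteq> A" if wL: "w \<in> L" for w
  proof -
    obtain ws where "ws \<in> lists G" "sublist w (concat ws)"
      using wL by (auto simp: L_def concatenations_def)
    then have "set w \<subseteq> (\<Union>v\<in>G. set v)"
      by (fastforce dest!: set_mono_sublist simp: lists_eq_set)
    also have "\<dots> \<subseteq> A"
      using GA by (auto simp: lists_eq_set)
    finally show ?thesis .
  qed
  have "language X = L"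
  proof (intro set_eqI iffI)
    fix w assume "w \<in> language X"
    then show "w \<in> L" by (auto simp: language_def X_def)
  next
    fix w assume "w \<in> L"
    then obtain ws p s where ws: "ws \<in> lists G" "concat ws = p @ w @ s"
      by (auto simp: L_def concatenations_def sublist_def)
    define v where "v = p @ w @ s"
    define x where "x = (\<lambda>k. if k < length v then v ! k else u ! ((k - length v) mod length u))"
    have nth_rep: "concat (replicate m u) ! k = u ! (k mod length u)" if "k < m * length u" for k m
      using that
    proof (induction m arbitrary: k)
      case (Suc m)
      then show ?case by (cases "k < length u") (auto simp: nth_append le_mod_geq)
    qed simp
    have len: "length (concat (replicate m u)) = m * length u" for m
      by (induction m) auto
    have pre: "map x [0..<length v + m * length u] = v @ concat (replicate m u)" for m
      by (rule nth_equalityI) (auto simp: x_def len nth_append nth_rep)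
    have "x \<in> X"
      unfolding X_def
    proof (intro CollectI allI)
      fix i n
      have le: "i + n \<le> length v + (i + n) * length u"
        using u(2) by (cases u) auto
      have "v @ concat (replicate (i + n) u) = concat (ws @ replicate (i + n) u)"
        using ws(2) by (simp add: v_def)
      moreover have "ws @ replicate (i + n) u \<in> lists G"
        using ws(1) u(1) by (auto simp: lists_eq_set)
      ultimately have "map x [0..<length v + (i + n) * length u] \<in> concatenations G"
        unfolding pre concatenations_def by (metis image_eqI)
      moreover have "sublist (map x [i..<i + n]) (map x [0..<length v + (i + n) * length u])"
      proof -
        obtain k where k: "length v + (i + n) * length u = i + n + k"
          using le le_iff_add by blast
        have "[0..<i + n + k] = [0..<i] @ [i..<i + n] @ [i + n..<i + n + k]"
          by (simp only: upt_add_eq_append[OF le0] append_assoc)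
        then show ?thesis unfolding k by (auto simp: sublist_def)
      qed
      ultimately show "map x [i..<i + n] \<in> L" by (auto simp: L_def)
    qed
    moreover have "w = map x [length p..<length p + length w]"
      by (rule nth_equalityI) (auto simp: x_def v_def nth_append)
    ultimately show "w \<in> language X" unfolding language_def by blast
  qed
  moreover have "shift_space A X"
    unfolding shift_space_def
  proof (intro conjI)
    show "finite A" by fact
    show "X \<subseteq> UNIV \<rightarrow> A"
    proof safe
      fix x :: "nat \<Rightarrow> 'a" and k assume "x \<in> X"
      then have "map x [k..<k + 1] \<in> L" unfolding X_def by blast
      from LA[OF this] show "x k \<in> A" by simp
    qed
    have "map (shift_map x) [i..<i + n] = map x [Suc i..<Suc i + n]" for x :: "nat \<Rightarrow> 'a" and i n
      by (rule nth_equalityI) (auto simp: shift_map_def simp del: upt_Suc)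
    then show "shift_map ` X \<subseteq> X"
      unfolding X_def by (simp only: image_subset_iff mem_Collect_eq) blast
    have opn: "open {x :: nat \<Rightarrow> 'a. map x is = l}" for "is" :: "nat list" and l
    proof (induction "is" arbitrary: l)
      case Nil
      then show ?case by (cases l) auto
    next
      case (Cons a "is")
      show ?case
      proof (cases l)
        case Nil
        then show ?thesis by simp
      next
        case (Cons b l')
        have "open ((\<lambda>x :: nat \<Rightarrow> 'a. x a) -` {b})"
          by (rule open_vimage) (auto intro: discrete_topology_class.open_discrete continuous_on_product_coordinates)
        then have "open ((\<lambda>x :: nat \<Rightarrow> 'a. x a) -` {b} \<inter> {x. map x is = l'})"
          using Cons.IH by (intro open_Int)
        also have "(\<lambda>x :: nat \<Rightarrow> 'a. x a) -` {b} \<inter> {x. map x is = l'} = {x. map x (a # is) = l}"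
          using Cons by auto
        finally show ?thesis .
      qed
    qed
    have "- X = (\<Union>i n. \<Union>l\<in>-L. {x. map x [i..<i + n] = l})"
      unfolding X_def by auto
    also have "open \<dots>" by (intro open_UN ballI opn)
    finally show "closed X" by (simp add: closed_def)
  qed
  ultimately show ?thesis unfolding coded_shift_def L_def by blast
qed

end

theory Submission
  imports Defs "HOL-Real_Asymp.Real_Asymp"
begin

text \<open>
  Give a word the weight \<open>exp (- p * length - t * number of ones)\<close> and let \<open>Z p t\<close> be the sum of
  the weights of the words in \<open>G\<close>.  A word of the language is a concatenation of words of \<open>G\<close> up to
  an initial and a final piece of the form \<open>0\<^sup>a1\<^sup>b\<close>, so \<open>Z p t \<le> 1\<close> makes the total weight of the
  words of length \<open>n\<close> grow polynomially, and the Gibbs inequality yields \<open>P (t \<phi>) \<le> p\<close>.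
  If \<open>Z p t = 1\<close> with \<open>p > 0\<close>, then the weights are the law of a random word of \<open>G\<close>; the
  stationary process made of independent words with this law gives a cylinder \<open>v\<close> at most a constant
  times the weight of \<open>v\<close>, hence it is an equilibrium state and \<open>P (t \<phi>) = p\<close>.  It is the only one:
  perturbing the weights by the number of occurrences of a word \<open>v\<close> in \<open>N\<close> consecutive words of \<open>G\<close>
  shows that every equilibrium state gives \<open>v\<close> the frequency it has in independent words, up to an
  error \<open>length v / N\<close>.  Thus \<open>P (t \<phi>) > 0\<close> iff \<open>Z q t > 1\<close> for some \<open>q > 0\<close>, and since \<open>f n \<le> n / 2\<close>
  the words of length \<open>n\<close> in \<open>G\<close> contribute about \<open>exp (- t) ^ f n\<close> to \<open>Z 0 t\<close>, which gives the
  criterion for the finiteness of \<open>t\<^sub>0\<close>.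
\<close>

section \<open>Entropy of finite-valued random variables\<close>

text \<open>The role of \<open>p > 0\<close>: block weights stay summable slightly below
  \<open>p\<close>, so the length of a random block has exponential moments. The weights can then be
  tilted by any quantity that grows at most linearly with the length, and the derivative of the
  tilted sum at zero is an expectation. At pressure zero this slack is gone, so uniqueness by
  tilting stops at \<open>t0\<close>; above \<open>t0\<close>, comparing two parameters with zero
  pressure leaves only \<open>\<delta>0\<close>.

  The obstacle in the tilting is that occurrences of \<open>v\<close> can cross from one group of
  blocks to the next. Each junction costs up to \<open>length v\<close>, an error that would not
  vanish for single blocks; groups of \<open>N\<close> blocks spread it over a length of at least
  \<open>N\<close>.

  Both exponents of a block are positive, so complete blocks meet exactly where a 1 is followed by a
  0; this makes the parsing unique and the cylinder estimate possible.\<close>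

definition eta :: "real \<Rightarrow> real" where
  "eta x = - (x * ln x)"

lemma eta_0 [simp]: "eta 0 = 0" and eta_1 [simp]: "eta 1 = 0"
  by (simp_all add: eta_def)

lemma eta_nonneg: "0 \<le> x \<Longrightarrow> x \<le> 1 \<Longrightarrow> eta x \<ge> 0"
  by (cases "x = 0") (auto simp: eta_def mult_le_0_iff)

text \<open>The tangent bound \<open>ln y \<le> y - 1\<close> at \<open>y = q / x\<close>. Keeping
  the correction \<open>q - x\<close> lets later sums compare families without normalizing either
  one.\<close>

lemma eta_le_gibbs:
  assumes "x \<ge> 0" "q > 0"
  shows "eta x \<le> - (x * ln q) + (q - x)"
proof (cases "x = 0")
  case True
  then show ?thesis using assms by simp
next
  case False
  then have x: "x > 0" using assms by simp
  have "ln (q / x) \<le> q / x - 1" using x assms by (intro ln_le_minus_one) simp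
  then have "x * (ln q - ln x) \<le> x * (q / x - 1)"
    using x assms by (intro mult_left_mono) (auto simp: ln_div)
  also have "\<dots> = q - x" using x by (simp add: field_simps)
  finally show ?thesis by (simp add: eta_def algebra_simps)
qed

lemma sum_eta_le:
  assumes "finite S" "\<And>y. y \<in> S \<Longrightarrow> a y \<ge> 0" "\<And>y. y \<in> S \<Longrightarrow> q y > 0"
    and "(\<Sum>y\<in>S. q y) \<le> (\<Sum>y\<in>S. a y)"
  shows "(\<Sum>y\<in>S. eta (a y)) \<le> (\<Sum>y\<in>S. a y * - ln (q y))"
proof -
  have "(\<Sum>y\<in>S. eta (a y)) \<le> (\<Sum>y\<in>S. - (a y * ln (q y)) + (q y - a y))"
    using assms by (intro sum_mono eta_le_gibbs) auto
  also have "\<dots> \<le> (\<Sum>y\<in>S. a y * - ln (q y))"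
    using assms(4) by (simp add: sum.distrib sum_subtractf sum_negf)
  finally show ?thesis .
qed

text \<open>Every \<open>a y\<close> is at most the total and \<open>ln\<close> is increasing, so
  splitting a mass never lowers its entropy.\<close>

lemma eta_sum_le:
  assumes "finite S" "\<And>y. y \<in> S \<Longrightarrow> a y \<ge> 0"
  shows "eta (\<Sum>y\<in>S. a y) \<le> (\<Sum>y\<in>S. eta (a y))"
proof -
  have "a y * ln (a y) \<le> a y * ln (\<Sum>y\<in>S. a y)" if y: "y \<in> S" for y
  proof (cases "a y = 0")
    case False
    then have "a y > 0" using assms(2)[OF y] by simp
    moreover have "a y \<le> (\<Sum>y\<in>S. a y)" using assms y by (intro member_le_sum) auto
    ultimately show ?thesis by (intro mult_left_mono) auto
  qed simp
  then have "(\<Sum>y\<in>S. a y * ln (a y)) \<le> (\<Sum>y\<in>S. a y) * ln (\<Sum>y\<in>S. a y)"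
    unfolding sum_distrib_right by (rule sum_mono)
  then show ?thesis by (simp add: eta_def sum_negf)
qed

text \<open>\<open>S\<close> may be larger than the range of \<open>Y\<close>: empty fibres
  contribute \<open>eta 0 = 0\<close>. Itineraries can therefore range over all words of a given
  length.\<close>

definition ent :: "'a measure \<Rightarrow> 'b set \<Rightarrow> ('a \<Rightarrow> 'b) \<Rightarrow> real" where
  "ent M S Y = (\<Sum>y\<in>S. eta (measure M {x \<in> space M. Y x = y}))"

definition finite_valued :: "'a measure \<Rightarrow> 'b set \<Rightarrow> ('a \<Rightarrow> 'b) \<Rightarrow> bool" where
  "finite_valued M S Y \<longleftrightarrow>
     finite S \<and> (\<forall>x\<in>space M. Y x \<in> S) \<and> (\<forall>y\<in>S. {x \<in> space M. Y x = y} \<in> sets M)"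

lemma finite_valuedD:
  assumes "finite_valued M S Y"
  shows "finite S" "\<And>x. x \<in> space M \<Longrightarrow> Y x \<in> S" "{x \<in> space M. Y x = y} \<in> sets M"
proof -
  show "finite S" "\<And>x. x \<in> space M \<Longrightarrow> Y x \<in> S" using assms by (auto simp: finite_valued_def)
  show "{x \<in> space M. Y x = y} \<in> sets M"
  proof (cases "y \<in> S")
    case False
    then have "{x \<in> space M. Y x = y} = {}" using assms by (auto simp: finite_valued_def)
    then show ?thesis by (simp only: sets.empty_sets)
  qed (use assms in \<open>auto simp: finite_valued_def\<close>)
qed

lemma finite_valued_Pair:
  assumes Y: "finite_valued M S Y" and Z: "finite_valued M T Z"
  shows "finite_valued M (S \<times> T) (\<lambda>x. (Y x, Z x))"
  unfolding finite_valued_def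
proof safe
  fix a b
  have "{x \<in> space M. (Y x, Z x) = (a, b)} = {x \<in> space M. Y x = a} \<inter> {x \<in> space M. Z x = b}"
    by auto
  then show "{x \<in> space M. (Y x, Z x) = (a, b)} \<in> sets M"
    using finite_valuedD[OF Y] finite_valuedD[OF Z] by auto
qed (use finite_valuedD[OF Y] finite_valuedD[OF Z] in auto)

lemma finite_valued_compose:
  assumes Y: "finite_valued M S Y" and T: "finite T" "\<And>y. y \<in> S \<Longrightarrow> g y \<in> T"
  shows "finite_valued M T (\<lambda>x. g (Y x))"
  unfolding finite_valued_def
proof (intro conjI ballI)
  fix z
  have "{x \<in> space M. g (Y x) = z} = (\<Union>y\<in>{y \<in> S. g y = z}. {x \<in> space M. Y x = y})"
    using finite_valuedD[OF Y] by auto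
  also have "\<dots> \<in> sets M" using finite_valuedD[OF Y] by (intro sets.finite_UN) auto
  finally show "{x \<in> space M. g (Y x) = z} \<in> sets M" .
qed (use finite_valuedD[OF Y] T in auto)

context prob_space
begin

lemma finite_valued_expectation:
  fixes g :: "'b \<Rightarrow> real"
  assumes Y: "finite_valued M S Y"
  shows "integrable M (\<lambda>x. g (Y x))"
    and "expectation (\<lambda>x. g (Y x)) = (\<Sum>y\<in>S. prob {x \<in> space M. Y x = y} * g y)"
proof -
  note Yd = finite_valuedD[OF Y]
  note [measurable] = Yd(3)
  have eq: "g (Y x) = (\<Sum>y\<in>S. indicator {x \<in> space M. Y x = y} x * g y)" if x: "x \<in> space M" for x
  proof -
    have "(\<Sum>y\<in>S. indicator {x \<in> space M. Y x = y} x * g y) = (\<Sum>y\<in>S. if y = Y x then g y else 0)"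
      by (intro sum.cong) (auto simp: x)
    then show ?thesis using Yd x by simp
  qed
  have "integrable M (\<lambda>x. \<Sum>y\<in>S. indicator {x \<in> space M. Y x = y} x * g y)"
    by (intro Bochner_Integration.integrable_sum integrable_mult_left integrable_real_indicator) (auto simp: emeasure_eq_measure)
  then show "integrable M (\<lambda>x. g (Y x))"
    by (subst Bochner_Integration.integrable_cong[OF refl eq])
  have "expectation (\<lambda>x. g (Y x)) = (\<integral>x. (\<Sum>y\<in>S. indicator {x \<in> space M. Y x = y} x * g y) \<partial>M)"
    by (intro Bochner_Integration.integral_cong refl eq)
  also have "\<dots> = (\<Sum>y\<in>S. prob {x \<in> space M. Y x = y} * g y)"
    by (subst Bochner_Integration.integral_sum)
      (auto intro!: integrable_mult_left integrable_real_indicator simp: emeasure_eq_measure)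
  finally show "expectation (\<lambda>x. g (Y x)) = (\<Sum>y\<in>S. prob {x \<in> space M. Y x = y} * g y)" .
qed

lemma sum_prob_finite_valued:
  assumes Y: "finite_valued M S Y"
  shows "(\<Sum>y\<in>S. prob {x \<in> space M. Y x = y}) = 1"
  using finite_valued_expectation(2)[OF assms, of "\<lambda>_. 1"] by (simp add: prob_space)

lemma ent_le_gibbs:
  assumes Y: "finite_valued M S Y"
    and q: "\<And>y. y \<in> S \<Longrightarrow> q y > 0" "(\<Sum>y\<in>S. q y) \<le> 1"
  shows "ent M S Y \<le> expectation (\<lambda>x. - ln (q (Y x)))"
proof -
  have "ent M S Y \<le> (\<Sum>y\<in>S. prob {x \<in> space M. Y x = y} * - ln (q y))"
    unfolding ent_def using q sum_prob_finite_valued[OF Y] finite_valuedD(1)[OF Y]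
    by (intro sum_eta_le) auto
  also have "\<dots> = expectation (\<lambda>x. - ln (q (Y x)))"
    using finite_valued_expectation(2)[OF Y, of "\<lambda>y. - ln (q y)"] by simp
  finally show ?thesis .
qed

lemma ent_le_ent_Pair:
  assumes Y: "finite_valued M S Y" and Z: "finite_valued M T Z"
  shows "ent M S Y \<le> ent M (S \<times> T) (\<lambda>x. (Y x, Z x))"
proof -
  note Yd = finite_valuedD[OF Y] and Zd = finite_valuedD[OF Z]
  have m: "{x \<in> space M. Y x = y \<and> Z x = z} \<in> events" for y z
    using finite_valuedD(3)[OF finite_valued_Pair[OF Y Z], of "(y, z)"] by simp
  have "prob {x \<in> space M. Y x = y} = (\<Sum>z\<in>T. prob {x \<in> space M. Y x = y \<and> Z x = z})" for y
  proof -
    have "{x \<in> space M. Y x = y} = (\<Union>z\<in>T. {x \<in> space M. Y x = y \<and> Z x = z})" using Zd by auto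
    then show ?thesis
      using Zd m by (auto intro!: finite_measure_finite_Union simp: disjoint_family_on_def)
  qed
  then have "ent M S Y \<le> (\<Sum>y\<in>S. \<Sum>z\<in>T. eta (prob {x \<in> space M. Y x = y \<and> Z x = z}))"
    unfolding ent_def using Zd by (auto intro!: sum_mono eta_sum_le)
  also have "\<dots> = ent M (S \<times> T) (\<lambda>x. (Y x, Z x))"
    unfolding ent_def by (subst sum.cartesian_product) (simp add: case_prod_unfold prod_eq_iff)
  finally show ?thesis .
qed

lemma ent_nonneg: "ent M S Y \<ge> 0"
  unfolding ent_def by (intro sum_nonneg eta_nonneg) auto

end

text \<open>A partition has no empty members, whereas \<open>S\<close> may contain values that are
  never taken; these are dropped on one side and weigh zero on the other.\<close>

lemma partition_entropy_fibres:
  assumes S: "finite S"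
  shows "partition_entropy M ((\<lambda>y. {x \<in> space M. Y x = y}) ` S - {{}}) = ent M S Y"
proof -
  let ?A = "\<lambda>y. {x \<in> space M. Y x = y}"
  let ?S = "{y \<in> S. ?A y \<noteq> {}}"
  have img: "?A ` S - {{}} = ?A ` ?S" by auto
  have "inj_on ?A ?S" by (auto simp: inj_on_def)
  then have "partition_entropy M (?A ` S - {{}}) = (\<Sum>y\<in>?S. eta (measure M (?A y)))"
    unfolding partition_entropy_def img by (subst sum.reindex) (auto simp: eta_def)
  also have "\<dots> = ent M S Y"
    unfolding ent_def
  proof (intro sum.mono_neutral_left S ballI)
    fix y assume "y \<in> S - ?S"
    then have "?A y = {}" by blast
    then show "eta (measure M (?A y)) = 0" by (simp only: measure_empty eta_0)
  qed auto
  finally show ?thesis .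
qed

section \<open>Entropy along the iterates of a measure-preserving map\<close>

text \<open>Fekete's argument: with \<open>m\<close> fixed so that \<open>u m / m\<close> is near
  the infimum \<open>L\<close>, divide \<open>n\<close> by \<open>m\<close> with remainder. The
  quotient part has average at most \<open>u m / m\<close>, and the remainder part is at most the
  constant \<open>C\<close>, negligible against \<open>n\<close>.\<close>

lemma subadditive_convergent:
  fixes u :: "nat \<Rightarrow> real"
  assumes sub: "\<And>m n. u (m + n) \<le> u m + u n" and nonneg: "\<And>n. u n \<ge> 0"
  shows "convergent (\<lambda>n. u n / real n)"
proof -
  define L where "L = (INF n\<in>{1..}. u n / real n)"
  have bdd: "bdd_below ((\<lambda>n. u n / real n) ` {1..})"
    using nonneg by (intro bdd_belowI[of _ 0]) auto
  have mult: "u (k * m) \<le> real k * u m" if "k \<ge> 1" for k m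
    using that
  proof (induction k rule: dec_induct)
    case (step k)
    have "u (Suc k * m) \<le> u m + u (k * m)" using sub[of m "k * m"] by simp
    then show ?case using step by (simp add: algebra_simps)
  qed simp
  have "(\<lambda>n. u n / real n) \<longlonglongrightarrow> L"
  proof (rule LIMSEQ_I)
    fix e :: real assume e: "e > 0"
    have "L < L + e / 2" using e by simp
    then obtain m where m: "m \<ge> 1" "u m / real m < L + e / 2"
      unfolding L_def using cINF_less_iff[OF _ bdd, of "L + e / 2"] by (auto simp: L_def)
    define C where "C = (\<Sum>r<m. u r)"
    have C: "u r \<le> C" if "r < m" for r
      unfolding C_def using that nonneg by (intro member_le_sum) auto
    have C0: "C \<ge> 0" unfolding C_def using nonneg by (intro sum_nonneg) auto
    obtain N where N: "real N > 2 * C / e" using reals_Archimedean2 by blast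
    have "norm (u n / real n - L) < e" if n: "n \<ge> max 1 (max m N)" for n
    proof -
      have n0: "real n > 0" using n by simp
      have dm: "n div m \<ge> 1" using n m by (simp add: div_greater_zero_iff Suc_le_eq)
      have "u n \<le> u (n div m * m) + u (n mod m)" using sub[of "n div m * m" "n mod m"] by simp
      also have "\<dots> \<le> real (n div m) * u m + C"
        using mult[OF dm, of m] C[of "n mod m"] m by (intro add_mono) auto
      also have "real (n div m) * u m = real (n div m) * real m * (u m / real m)" using m by simp
      also have "\<dots> \<le> real n * (u m / real m)"
      proof (intro mult_right_mono)
        show "real (n div m) * real m \<le> real n"
          by (metis of_nat_le_iff of_nat_mult div_times_less_eq_dividend)
      qed (use nonneg in auto)
      finally have "u n / real n \<le> u m / real m + C / real n" using n0 by (simp add: field_simps)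
      moreover have "C / real n < e / 2"
      proof -
        have "2 * C / e < real n" using N n by linarith
        then show ?thesis using e n0 by (simp add: field_simps)
      qed
      ultimately have "u n / real n < L + e" using m by linarith
      moreover have "L \<le> u n / real n"
        unfolding L_def using n by (intro cINF_lower bdd) auto
      ultimately show ?thesis using e by auto
    qed
    then show "\<exists>no. \<forall>n\<ge>no. norm (u n / real n - L) < e" by blast
  qed
  then show ?thesis by (auto simp: convergent_def)
qed

text \<open>Reads a partition as a random variable, so that its iterated joins become the fibres of
  itineraries and the estimates for \<open>ent\<close> apply.\<close>

definition atom_of :: "'a set set \<Rightarrow> 'a \<Rightarrow> 'a set" where
  "atom_of P x = (THE A. A \<in> P \<and> x \<in> A)"

lemma atom_of:
  assumes "partition_on S P" "x \<in> S"
  shows "atom_of P x \<in> P" "x \<in> atom_of P x"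
    and "A \<in> P \<Longrightarrow> x \<in> A \<Longrightarrow> atom_of P x = A"
proof -
  have "\<exists>!A. A \<in> P \<and> x \<in> A"
    using assms partition_onD1[OF assms(1)] partition_onD2[OF assms(1)]
    by (auto simp: disjoint_def)
  from theI'[OF this] the1_equality[OF this, of A]
  show "atom_of P x \<in> P" "x \<in> atom_of P x" "A \<in> P \<Longrightarrow> x \<in> A \<Longrightarrow> atom_of P x = A"
    by (auto simp: atom_of_def)
qed

locale measure_preserving_map = prob_space M for M :: "'a measure" +
  fixes T :: "'a \<Rightarrow> 'a"
  assumes T [measurable]: "T \<in> M \<rightarrow>\<^sub>M M" and inv: "distr M M T = M"
begin

lemma T_iter [measurable]: "(T ^^ n) \<in> M \<rightarrow>\<^sub>M M"
  by (induction n) (auto intro: measurable_comp[OF _ T])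

lemma T_iter_space: "x \<in> space M \<Longrightarrow> (T ^^ n) x \<in> space M"
  using measurable_space[OF T_iter] .

lemma distr_iter: "distr M M (T ^^ n) = M"
proof (induction n)
  case 0
  then show ?case by (simp add: distr_id2)
next
  case (Suc n)
  have "distr M M (T ^^ Suc n) = distr (distr M M (T ^^ n)) M T"
    by (subst distr_distr) (auto simp del: funpow.simps simp: funpow.simps(2))
  then show ?case by (simp only: Suc.IH inv)
qed

lemma prob_iter:
  assumes "A \<in> events"
  shows "prob {x \<in> space M. (T ^^ n) x \<in> A} = prob A"
proof -
  have "prob A = measure (distr M M (T ^^ n)) A" by (simp add: distr_iter)
  also have "\<dots> = prob {x \<in> space M. (T ^^ n) x \<in> A}"
    using assms by (subst measure_distr) (auto simp: vimage_def Int_def conj_commute)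
  finally show ?thesis ..
qed

lemma expectation_iter:
  fixes g :: "'a \<Rightarrow> real"
  assumes "g \<in> borel_measurable M"
  shows "expectation (\<lambda>x. g ((T ^^ n) x)) = expectation g"
proof -
  have "expectation g = integral\<^sup>L (distr M M (T ^^ n)) g" by (simp add: distr_iter)
  also have "\<dots> = expectation (\<lambda>x. g ((T ^^ n) x))"
    using assms by (subst integral_distr) auto
  finally show ?thesis ..
qed

definition itin :: "('a \<Rightarrow> 'b) \<Rightarrow> nat \<Rightarrow> 'a \<Rightarrow> 'b list" where
  "itin Y n x = map (\<lambda>i. Y ((T ^^ i) x)) [0..<n]"

lemma length_itin [simp]: "length (itin Y n x) = n"
  by (simp add: itin_def)

lemma itin_add: "itin Y (m + n) x = itin Y m x @ itin Y n ((T ^^ m) x)"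
proof -
  have "map (\<lambda>i. Y ((T ^^ i) x)) [m..<m + n] = map (\<lambda>i. Y ((T ^^ i) ((T ^^ m) x))) [0..<n]"
    by (rule nth_equalityI) (simp_all add: funpow_add add.commute[of m])
  then show ?thesis by (simp add: itin_def upt_add_eq_append[of 0 m n, simplified])
qed

lemma finite_valued_iter:
  assumes Y: "finite_valued M S Y"
  shows "finite_valued M S (\<lambda>x. Y ((T ^^ n) x))"
  unfolding finite_valued_def
proof (intro conjI ballI)
  fix y
  have "{x \<in> space M. Y ((T ^^ n) x) = y} = (T ^^ n) -` {x \<in> space M. Y x = y} \<inter> space M"
    using T_iter_space by auto
  also have "\<dots> \<in> events" by (intro measurable_sets[OF T_iter] finite_valuedD[OF Y])
  finally show "{x \<in> space M. Y ((T ^^ n) x) = y} \<in> events" .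
qed (use finite_valuedD[OF Y] T_iter_space in auto)

abbreviation words_over :: "'b set \<Rightarrow> nat \<Rightarrow> 'b list set" where
  "words_over S n \<equiv> {w. set w \<subseteq> S \<and> length w = n}"

lemma finite_valued_itin:
  assumes Y: "finite_valued M S Y"
  shows "finite_valued M (words_over S n) (itin Y n)"
proof (induction n)
  case 0
  have "{x \<in> space M. [] = y} = (if y = [] then space M else {})" for y :: "'b list" by auto
  then show ?case by (auto simp: finite_valued_def itin_def)
next
  case (Suc n)
  have "finite_valued M (words_over S (Suc n)) (\<lambda>x. (\<lambda>(w, y). w @ [y]) (itin Y n x, Y ((T ^^ n) x)))"
    using finite_valuedD[OF Y]
    by (intro finite_valued_compose[OF finite_valued_Pair[OF Suc finite_valued_iter[OF Y, of n]]])
      (auto simp: finite_lists_length_eq)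
  then show ?case by (simp add: itin_def)
qed

abbreviation block_ent :: "'b set \<Rightarrow> ('a \<Rightarrow> 'b) \<Rightarrow> nat \<Rightarrow> real" where
  "block_ent S Y n \<equiv> ent M (words_over S n) (itin Y n)"

lemma prob_iter_eq:
  assumes Y: "finite_valued M S Y"
  shows "prob {x \<in> space M. Y ((T ^^ n) x) = y} = prob {x \<in> space M. Y x = y}"
proof -
  have "prob {x \<in> space M. Y ((T ^^ n) x) = y} = prob {x \<in> space M. (T ^^ n) x \<in> {x \<in> space M. Y x = y}}"
    using T_iter_space by (intro arg_cong[where f = prob]) auto
  then show ?thesis using prob_iter[OF finite_valuedD(3)[OF Y]] by simp
qed

text \<open>The Gibbs inequality compares the joint law \<open>b\<close> of the two halves with the
  product of its marginals; by invariance the second marginal is the law of an itinerary of length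
  \<open>n\<close> from time zero.\<close>

lemma block_ent_subadditive:
  assumes Y: "finite_valued M S Y"
  shows "block_ent S Y (m + n) \<le> block_ent S Y m + block_ent S Y n"
proof -
  note fv = finite_valued_itin[OF Y]
  let ?W = "\<lambda>n. words_over S n"
  define a where "a k w = prob {x \<in> space M. itin Y k x = w}" for k w
  have sum_a: "(\<Sum>w\<in>?W k. a k w) = 1" for k
    unfolding a_def by (rule sum_prob_finite_valued[OF fv])
  have bij: "bij_betw (\<lambda>(u, v). u @ v) (?W m \<times> ?W n) (?W (m + n))"
    by (rule bij_betwI[where g = "\<lambda>w. (take m w, drop m w)"])
      (auto dest: in_set_takeD in_set_dropD)
  define b where "b u v = prob {x \<in> space M. itin Y m x = u \<and> itin Y n ((T ^^ m) x) = v}" for u v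
  have ab: "a (m + n) (u @ v) = b u v" if "u \<in> ?W m" for u v
    using that by (auto simp: a_def b_def itin_add intro!: arg_cong[where f = prob])
  have fvb: "finite_valued M (?W m \<times> ?W n) (\<lambda>x. (itin Y m x, itin Y n ((T ^^ m) x)))"
    by (intro finite_valued_Pair fv finite_valued_iter)
  have L: "block_ent S Y (m + n) = (\<Sum>(u, v)\<in>?W m \<times> ?W n. eta (b u v))"
  proof -
    have "(\<Sum>w\<in>?W (m + n). eta (a (m + n) w)) =
        (\<Sum>z\<in>?W m \<times> ?W n. eta (a (m + n) ((\<lambda>(u, v). u @ v) z)))"
      by (rule sum.reindex_bij_betw[OF bij, symmetric])
    also have "\<dots> = (\<Sum>(u, v)\<in>?W m \<times> ?W n. eta (b u v))"
      using ab by (intro sum.cong refl) (simp add: case_prod_unfold mem_Times_iff)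
    finally show ?thesis by (simp only: ent_def a_def[symmetric])
  qed
  have marg1: "(\<Sum>v\<in>?W n. b u v) = a m u" for u
  proof -
    have "{x \<in> space M. itin Y m x = u} =
        (\<Union>v\<in>?W n. {x \<in> space M. itin Y m x = u \<and> itin Y n ((T ^^ m) x) = v})"
      using finite_valuedD(2)[OF finite_valued_iter[OF fv]] by auto
    then show ?thesis unfolding a_def b_def
      using finite_valuedD(3)[OF fvb, of "(u, _)"] finite_valuedD(1)[OF fv]
      by (auto intro!: finite_measure_finite_Union[symmetric] simp: disjoint_family_on_def)
  qed
  have marg2: "(\<Sum>u\<in>?W m. b u v) = a n v" for v
  proof -
    have "{x \<in> space M. itin Y n ((T ^^ m) x) = v} =
        (\<Union>u\<in>?W m. {x \<in> space M. itin Y m x = u \<and> itin Y n ((T ^^ m) x) = v})"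
      using finite_valuedD(2)[OF fv] by auto
    then have "prob {x \<in> space M. itin Y n ((T ^^ m) x) = v} = (\<Sum>u\<in>?W m. b u v)" unfolding a_def b_def
      using finite_valuedD(3)[OF fvb, of "(_, v)"] finite_valuedD(1)[OF fv]
      by (auto intro!: finite_measure_finite_Union simp: disjoint_family_on_def)
    then show ?thesis unfolding a_def by (simp add: prob_iter_eq[OF fv])
  qed
  \<comment> \<open>The comparison law must be positive, so null pairs are removed; outside
    \<open>?Q\<close> a marginal vanishes and hence so does \<open>b\<close>.\<close>
  let ?Q = "{(u, v). u \<in> ?W m \<and> v \<in> ?W n \<and> a m u > 0 \<and> a n v > 0}"
  have finW: "finite (?W k)" for k using finite_valuedD(1)[OF fv] .
  have b0: "b u v \<ge> 0" and a0: "a k w \<ge> 0" for u v k w by (auto simp: a_def b_def)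
  have b_le: "b u v \<le> a m u" "b u v \<le> a n v" if uv: "u \<in> ?W m" "v \<in> ?W n" for u v
    using member_le_sum[OF uv(2), of "b u"] member_le_sum[OF uv(1), of "\<lambda>u. b u v"] finW b0
    by (simp_all add: marg1 marg2)
  have sub: "?Q \<subseteq> ?W m \<times> ?W n" by auto
  have finQ: "finite ?Q" using finW by (intro finite_subset[OF sub]) auto
  have zero: "b (fst z) (snd z) = 0" if "z \<in> ?W m \<times> ?W n - ?Q" for z
    using that b_le[of "fst z" "snd z"] b0[of "fst z" "snd z"] a0[of m "fst z"] a0[of n "snd z"] by force
  have neutral: "(\<Sum>z\<in>?Q. g z) = (\<Sum>z\<in>?W m \<times> ?W n. g z)"
    if "\<And>z. b (fst z) (snd z) = 0 \<Longrightarrow> g z = 0" for g :: "_ \<Rightarrow> real"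
    using that[OF zero] finW by (intro sum.mono_neutral_left sub ballI) auto
  have "(\<Sum>(u, v)\<in>?W m \<times> ?W n. eta (b u v)) = (\<Sum>(u, v)\<in>?Q. eta (b u v))"
    by (rule neutral[symmetric]) (simp add: case_prod_unfold)
  also have "\<dots> \<le> (\<Sum>z\<in>?Q. (case z of (u, v) \<Rightarrow> b u v) * - ln (case z of (u, v) \<Rightarrow> a m u * a n v))"
  proof -
    have "(\<Sum>(u, v)\<in>?Q. a m u * a n v) \<le> (\<Sum>(u, v)\<in>?W m \<times> ?W n. a m u * a n v)"
      using finW a0 by (intro sum_mono2 sub) auto
    also have "\<dots> = 1"
      by (simp add: sum.cartesian_product[symmetric] sum_distrib_left[symmetric] sum_a)
    also have "1 = (\<Sum>(u, v)\<in>?W m \<times> ?W n. b u v)"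
      by (simp add: sum.cartesian_product[symmetric] marg1 sum_a)
    also have "\<dots> = (\<Sum>(u, v)\<in>?Q. b u v)"
      by (rule neutral[symmetric]) (simp add: case_prod_unfold)
    finally show ?thesis
      using sum_eta_le[OF finQ, of "\<lambda>z. case z of (u, v) \<Rightarrow> b u v" "\<lambda>z. case z of (u, v) \<Rightarrow> a m u * a n v"] b0
      by (auto simp: case_prod_unfold)
  qed
  also have "\<dots> = (\<Sum>(u, v)\<in>?Q. b u v * - ln (a m u) + b u v * - ln (a n v))"
    by (intro sum.cong refl) (auto simp: ln_mult algebra_simps)
  also have "\<dots> = (\<Sum>(u, v)\<in>?W m \<times> ?W n. b u v * - ln (a m u) + b u v * - ln (a n v))"
    by (rule neutral) (simp add: case_prod_unfold)
  also have "\<dots> = (\<Sum>u\<in>?W m. \<Sum>v\<in>?W n. b u v * - ln (a m u)) + (\<Sum>u\<in>?W m. \<Sum>v\<in>?W n. b u v * - ln (a n v))"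
    by (simp only: sum.cartesian_product[symmetric] sum.distrib)
  also have "(\<Sum>u\<in>?W m. \<Sum>v\<in>?W n. b u v * - ln (a m u)) = (\<Sum>u\<in>?W m. a m u * - ln (a m u))"
    by (simp only: sum_distrib_right[symmetric] marg1)
  also have "(\<Sum>u\<in>?W m. \<Sum>v\<in>?W n. b u v * - ln (a n v)) = (\<Sum>v\<in>?W n. a n v * - ln (a n v))"
    by (subst sum.swap) (simp only: sum_distrib_right[symmetric] marg2)
  finally show ?thesis unfolding L unfolding ent_def a_def[symmetric] by (simp add: eta_def)
qed

lemma block_ent_convergent:
  assumes Y: "finite_valued M S Y"
  shows "convergent (\<lambda>n. block_ent S Y n / real n)"
  using block_ent_subadditive[OF Y] ent_nonneg by (intro subadditive_convergent)

lemma finite_valued_atom_of: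
  assumes "finite_measurable_partition M P"
  shows "finite_valued M P (atom_of P)"
proof -
  have P: "finite P" "P \<subseteq> events" "partition_on (space M) P"
    using assms by (auto simp: finite_measurable_partition_def)
  have "{x \<in> space M. atom_of P x = A} = A" if "A \<in> P" for A
  proof -
    have "A \<subseteq> space M" using P(2) that by (intro sets.sets_into_space) auto
    then show ?thesis using atom_of[OF P(3)] that by blast
  qed
  then show ?thesis using P atom_of[OF P(3)] by (auto simp: finite_valued_def)
qed

lemma partition_entropy_iterated_join:
  assumes fmp: "finite_measurable_partition M P"
  shows "partition_entropy M (iterated_join M T P n) = block_ent P (atom_of P) n"
proof -
  have P: "finite P" "P \<subseteq> events" "partition_on (space M) P"
    using fmp by (auto simp: finite_measurable_partition_def)
  have mem: "(T ^^ i) x \<in> A \<longleftrightarrow> atom_of P ((T ^^ i) x) = A" if "x \<in> space M" "A \<in> P" for x i A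
    using atom_of(2,3)[OF P(3) T_iter_space[OF that(1), of i]] that(2) by metis
  have fib: "{x \<in> space M. \<forall>i<n. (T ^^ i) x \<in> w ! i} = {x \<in> space M. itin (atom_of P) n x = w}"
    if "w \<in> words_over P n" for w
  proof -
    have "w ! i \<in> P" if "i < n" for i using that \<open>w \<in> words_over P n\<close> by (auto dest: nth_mem)
    then show ?thesis using that mem by (auto simp: itin_def list_eq_iff_nth_eq)
  qed
  have "{{x \<in> space M. \<forall>i<n. (T ^^ i) x \<in> B i} | B. \<forall>i<n. B i \<in> P} =
      (\<lambda>w. {x \<in> space M. \<forall>i<n. (T ^^ i) x \<in> w ! i}) ` words_over P n"
  proof safe
    fix B :: "nat \<Rightarrow> 'a set" assume B: "\<forall>i<n. B i \<in> P"
    show "{x \<in> space M. \<forall>i<n. (T ^^ i) x \<in> B i} \<in>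
      (\<lambda>w. {x \<in> space M. \<forall>i<n. (T ^^ i) x \<in> w ! i}) ` words_over P n"
      using B by (intro image_eqI[where x = "map B [0..<n]"]) auto
  next
    fix w assume "set w \<subseteq> P" "n = length w"
    then show "\<exists>B. {x \<in> space M. \<forall>i<length w. (T ^^ i) x \<in> w ! i} =
        {x \<in> space M. \<forall>i<length w. (T ^^ i) x \<in> B i} \<and> (\<forall>i<length w. B i \<in> P)"
      by (intro exI[of _ "\<lambda>i. w ! i"]) (auto dest: nth_mem)
  qed
  also have "\<dots> = (\<lambda>w. {x \<in> space M. itin (atom_of P) n x = w}) ` words_over P n"
    by (intro image_cong refl fib)
  finally show ?thesis unfolding iterated_join_def
    using partition_entropy_fibres[of "words_over P n" M "itin (atom_of P) n"] P(1)
    by (simp add: finite_lists_length_eq)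
qed

text \<open>By subadditivity the \<open>lim\<close> in \<open>ks_entropy\<close> is a true limit, so
  it suffices to bound the limits of \<open>block_ent\<close>.\<close>

lemma ks_entropy_le:
  fixes h :: real
  assumes "\<And>P L. finite_measurable_partition M P \<Longrightarrow>
    (\<lambda>n. block_ent P (atom_of P) n / real n) \<longlonglongrightarrow> L \<Longrightarrow> L \<le> h"
  shows "ks_entropy M T \<le> ereal h"
  unfolding ks_entropy_def
proof (rule SUP_least)
  fix P assume "P \<in> {P. finite_measurable_partition M P}"
  then have P: "finite_measurable_partition M P" by simp
  have L: "(\<lambda>n. block_ent P (atom_of P) n / real n) \<longlonglongrightarrow> lim (\<lambda>n. block_ent P (atom_of P) n / real n)"
    using block_ent_convergent[OF finite_valued_atom_of[OF P]] by (simp add: convergent_LIMSEQ_iff)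
  show "ereal (lim (\<lambda>n. partition_entropy M (iterated_join M T P n) / real n)) \<le> ereal h"
    using assms[OF P L] by (simp add: partition_entropy_iterated_join[OF P])
qed

lemma ks_entropy_ge:
  fixes h :: real
  assumes P: "finite_measurable_partition M P"
    and L: "(\<lambda>n. block_ent P (atom_of P) n / real n) \<longlonglongrightarrow> L" and h: "h \<le> L"
  shows "ereal h \<le> ks_entropy M T"
  unfolding ks_entropy_def using h limI[OF L]
  by (intro SUP_upper2[of P]) (auto simp: P partition_entropy_iterated_join)

lemma ks_entropy_nonneg: "ks_entropy M T \<ge> 0"
proof -
  have P: "finite_measurable_partition M {space M}"
    by (auto simp: finite_measurable_partition_def partition_on_def not_empty not_empty[symmetric])
  obtain L where L: "(\<lambda>n. block_ent {space M} (atom_of {space M}) n / real n) \<longlonglongrightarrow> L"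
    using block_ent_convergent[OF finite_valued_atom_of[OF P]] by (auto simp: convergent_def)
  have "L \<ge> 0" using L by (rule LIMSEQ_le_const) (auto simp: ent_nonneg)
  from ks_entropy_ge[OF P L this] show ?thesis by (simp add: zero_ereal_def)
qed

end

section \<open>Invariant measures on shift spaces\<close>

definition pre :: "nat \<Rightarrow> (nat \<Rightarrow> 'a) \<Rightarrow> 'a list" where
  "pre n x = map x [0..<n]"

lemma length_pre [simp]: "length (pre n x) = n"
  by (simp add: pre_def)

lemma nth_pre [simp]: "i < n \<Longrightarrow> pre n x ! i = x i"
  by (simp add: pre_def)

lemma shift_map_iter: "(shift_map ^^ i) x = (\<lambda>k. x (i + k))"
  by (induction i) (auto simp: shift_map_def)

lemma take_drop_pre: "i + k \<le> n \<Longrightarrow> take k (drop i (pre n x)) = pre k ((shift_map ^^ i) x)"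
  by (auto simp: list_eq_iff_nth_eq shift_map_iter)

lemma take_pre: "k \<le> n \<Longrightarrow> take k (pre n x) = pre k x"
  by (auto simp: list_eq_iff_nth_eq)

lemma sets_borel_nat_seq:
  "sets (borel :: (nat \<Rightarrow> nat) measure) = sigma_sets UNIV {{x. x i \<in> A} | i A. True}"
proof -
  have "sets (borel :: (nat \<Rightarrow> nat) measure) = sets (Pi\<^sub>M UNIV (\<lambda>_. borel))"
    by (rule sets_PiM_equal_borel[symmetric])
  also have "\<dots> = sigma_sets UNIV {{x. x i \<in> A} | i A. True}"
    unfolding sets_PiM_single
    by (simp add: sets_borel_eq_count_space)
  finally show ?thesis .
qed

text \<open>Coordinate sets are cylinders; conversely a cylinder is a countable union of finite
  intersections of coordinate sets. Allowing a whole set \<open>W\<close> of words makes complements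
  and finite unions of cylinders cylinders again.\<close>

lemma sets_restrict_borel_cylinders:
  fixes X :: "(nat \<Rightarrow> nat) set"
  assumes "closed X"
  shows "sets (restrict_space borel X) = sigma_sets X {{x \<in> X. pre k x \<in> W} | k W. True}"
proof
  have X: "X \<in> sigma_sets UNIV {{x. x i \<in> A} | i A. True}"
    using borel_closed[OF assms] by (simp only: sets_borel_nat_seq)
  have "sets (restrict_space borel X) = (\<inter>) X ` sets (borel :: (nat \<Rightarrow> nat) measure)"
    by (simp add: sets_restrict_space)
  also have "\<dots> = sigma_sets X ((\<inter>) X ` {{x. x i \<in> A} | i A. True})"
    unfolding sets_borel_nat_seq by (rule sigma_sets_Int[OF X]) simp
  finally have eq: "sets (restrict_space borel X) = sigma_sets X ((\<inter>) X ` {{x. x i \<in> A} | i A. True})" .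
  show "sets (restrict_space borel X) \<subseteq> sigma_sets X {{x \<in> X. pre k x \<in> W} | k W. True}"
    unfolding eq
  proof (rule sigma_sets_mono', safe)
    fix i and A :: "nat set"
    show "\<exists>k W. X \<inter> {x. x i \<in> A} = {x \<in> X. pre k x \<in> W} \<and> True"
      by (intro exI[of _ "Suc i"] exI[of _ "{w. w ! i \<in> A}"]) auto
  qed
  have cyl: "{x \<in> X. pre k x = w} \<in> sigma_sets X ((\<inter>) X ` {{x. x i \<in> A} | i A. True})" for k w
  proof (cases "length w = k")
    case False
    then have "{x \<in> X. pre k x = w} = {}" by auto
    then show ?thesis by (simp only: sigma_sets.Empty)
  next
    case True
    have "{x \<in> X. pre k x = w} = X \<inter> (\<Inter>i\<in>{..<k}. X \<inter> {x. x i \<in> {w ! i}})"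
      using True by (auto simp: list_eq_iff_nth_eq)
    also have "\<dots> \<in> sets (restrict_space borel X)"
    proof (cases "k = 0")
      case False
      have "(\<Inter>i\<in>{..<k}. X \<inter> {x. x i \<in> {w ! i}}) \<in> sets (restrict_space borel X)"
      proof (intro sets.finite_INT)
        fix i show "X \<inter> {x. x i \<in> {w ! i}} \<in> sets (restrict_space borel X)"
          unfolding eq by (intro sigma_sets.Basic) blast
      qed (use False in auto)
      then show ?thesis by (metis (no_types) sets.Int_space_eq2 sets.Int space_restrict_space2 assms borel_closed sets.top inf_commute)
    qed (use sets.top[of "restrict_space borel X"] in \<open>simp add: space_restrict_space\<close>)
    finally show ?thesis by (simp only: eq)
  qed
  have "{x \<in> X. pre k x \<in> W} \<in> sets (restrict_space borel X)" for k W
  proof -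
    have "{x \<in> X. pre k x \<in> W} = (\<Union>w\<in>W. {x \<in> X. pre k x = w})" by auto
    also have "\<dots> \<in> sets (restrict_space borel X)"
      using cyl by (intro sets.countable_UN'') (auto simp: eq)
    finally show ?thesis .
  qed
  then show "sigma_sets X {{x \<in> X. pre k x \<in> W} | k W. True} \<subseteq> sets (restrict_space borel X)"
    using sets.sigma_sets_subset[of "{{x \<in> X. pre k x \<in> W} | k W. True}" "restrict_space borel X"]
    by (auto simp: space_restrict_space)
qed

lemma Int_stable_cylinders: "Int_stable {{x \<in> X. pre k x \<in> W} | k W. True}"
proof (rule Int_stableI, safe)
  fix k l W V
  have "{x \<in> X. pre k x \<in> W} \<inter> {x \<in> X. pre l x \<in> V} =
      {x \<in> X. pre (max k l) x \<in> {w. take k w \<in> W \<and> take l w \<in> V}}"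
    by (auto simp: take_pre)
  then show "\<exists>k' W'. {x \<in> X. pre k x \<in> W} \<inter> {x \<in> X. pre l x \<in> V} = {x \<in> X. pre k' x \<in> W'} \<and> True"
    by blast
qed

locale binary_shift_measure =
  fixes X :: "(nat \<Rightarrow> nat) set" and M :: "(nat \<Rightarrow> nat) measure"
  assumes closed_X: "closed X" and binary: "x \<in> X \<Longrightarrow> x n \<in> {0, 1}"
    and M: "M \<in> invariant_measures X"
begin

lemma sets_M: "sets M = sets (restrict_space borel X)"
  and prob_M: "prob_space M"
  using M by (auto simp: invariant_measures_def)

lemma space_M: "space M = X"
  using sets_eq_imp_space_eq[OF sets_M] by (simp add: space_restrict_space)

end

sublocale binary_shift_measure \<subseteq> measure_preserving_map M shift_map
  using M by (intro measure_preserving_map.intro prob_M measure_preserving_map_axioms.intro) (auto simp: invariant_measures_def)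

context binary_shift_measure
begin

lemma events_cyl [measurable]: "{x \<in> X. pre k x \<in> W} \<in> events"
  unfolding sets_M sets_restrict_borel_cylinders[OF closed_X] by (intro sigma_sets.Basic) auto

lemma finite_valued_pre: "finite_valued M (pre n ` X) (pre n)"
proof -
  have "pre n ` X \<subseteq> {w. set w \<subseteq> {0, 1} \<and> length w = n}"
  proof -
    have "set (pre n x) \<subseteq> {0, 1}" if "x \<in> X" for x
      using binary[OF that] unfolding pre_def set_map by (intro image_subsetI)
    then show ?thesis by auto
  qed
  then have "finite (pre n ` X)"
    by (rule finite_subset) (simp add: finite_lists_length_eq)
  moreover have "{x \<in> X. pre n x = w} \<in> events" for w
    using events_cyl[of n "{w}"] by simp
  ultimately show ?thesis by (auto simp: finite_valued_def space_M)
qed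

text \<open>The sets that cylinders approximate form a sigma algebra. For a countable union, the
  tail beyond a finite \<open>n\<close> gets \<open>e / 2\<close> and the \<open>n + 1\<close>
  remaining sets share the other half; their cylinders are merged by passing to the longest
  prefix.\<close>

lemma approx_by_cylinder:
  assumes "A \<in> events" "e > 0"
  shows "\<exists>k W. prob (sym_diff A {x \<in> X. pre k x \<in> W}) < e"
proof -
  have "A \<in> sigma_sets X {{x \<in> X. pre k x \<in> W} | k W. True}"
    using assms(1) by (simp only: sets_M sets_restrict_borel_cylinders[OF closed_X])
  then show ?thesis using assms(2)
  proof (induction arbitrary: e)
    case (Basic A)
    then obtain k W where "A = {x \<in> X. pre k x \<in> W}" by blast
    then have "sym_diff A {x \<in> X. pre k x \<in> W} = {}" by blast
    then have "prob (sym_diff A {x \<in> X. pre k x \<in> W}) = 0" by (simp only: measure_empty)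
    then show ?case using \<open>e > 0\<close> by (metis (no_types))
  next
    case Empty
    then show ?case by (intro exI[of _ 0] exI[of _ "{}"]) auto
  next
    case (Compl A)
    from Compl.IH[OF Compl.prems] obtain k W where
      kW: "prob (sym_diff A {x \<in> X. pre k x \<in> W}) < e" by blast
    have "A \<subseteq> X"
      using Compl.hyps sets.sets_into_space[of A M]
      by (simp only: sets_M sets_restrict_borel_cylinders[OF closed_X, symmetric] space_M)
    then have "sym_diff (X - A) {x \<in> X. pre k x \<in> -W} = sym_diff A {x \<in> X. pre k x \<in> W}" by auto
    with kW have "prob (sym_diff (X - A) {x \<in> X. pre k x \<in> -W}) < e" by (simp only:)
    then show ?case by blast
  next
    case (Union A)
    have A: "A i \<in> events" for i
      using Union.hyps[of i] by (simp only: sets_M sets_restrict_borel_cylinders[OF closed_X])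
    have "(\<lambda>n. prob (\<Union>i\<le>n. A i)) \<longlonglongrightarrow> prob (\<Union>n. \<Union>i\<le>n. A i)"
      using A by (intro finite_Lim_measure_incseq) (auto simp: incseq_def intro: order_trans)
    moreover have "(\<Union>n. \<Union>i\<le>n. A i) = (\<Union>i. A i)" by auto
    ultimately have "(\<lambda>n. prob (\<Union>i\<le>n. A i)) \<longlonglongrightarrow> prob (\<Union>i. A i)" by simp
    then have "\<forall>\<^sub>F n in sequentially. dist (prob (\<Union>i\<le>n. A i)) (prob (\<Union>i. A i)) < e / 2"
      using \<open>e > 0\<close> by (intro tendstoD) auto
    then obtain n where "dist (prob (\<Union>i\<le>n. A i)) (prob (\<Union>i. A i)) < e / 2"
      by (auto simp: eventually_sequentially)
    moreover have "prob ((\<Union>i. A i) - (\<Union>i\<le>n. A i)) = prob (\<Union>i. A i) - prob (\<Union>i\<le>n. A i)"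
      using A by (intro finite_measure_Diff) auto
    ultimately have tail: "prob ((\<Union>i. A i) - (\<Union>i\<le>n. A i)) < e / 2"
      unfolding dist_real_def by linarith
    have "\<forall>i. \<exists>k W. prob (sym_diff (A i) {x \<in> X. pre k x \<in> W}) < e / (2 * real (Suc n))"
      using Union.IH \<open>e > 0\<close> by simp
    from choice[OF this] obtain k where
      "\<forall>i. \<exists>W. prob (sym_diff (A i) {x \<in> X. pre (k i) x \<in> W}) < e / (2 * real (Suc n))" by blast
    from choice[OF this] obtain W where kW:
      "\<And>i. prob (sym_diff (A i) {x \<in> X. pre (k i) x \<in> W i}) < e / (2 * real (Suc n))" by blast
    define K where "K = Max (k ` {..n})"
    have K: "k i \<le> K" if "i \<le> n" for i using that unfolding K_def by (intro Max_ge) auto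
    define V where "V = {w. \<exists>i\<le>n. take (k i) w \<in> W i}"
    let ?D = "\<lambda>i. sym_diff (A i) {x \<in> X. pre (k i) x \<in> W i}"
    have "sym_diff (\<Union>i. A i) {x \<in> X. pre K x \<in> V} \<subseteq> ((\<Union>i. A i) - (\<Union>i\<le>n. A i)) \<union> (\<Union>i\<in>{..n}. ?D i)"
    proof -
      have "{x \<in> X. pre K x \<in> V} = (\<Union>i\<in>{..n}. {x \<in> X. pre (k i) x \<in> W i})"
        using K by (auto simp: V_def take_pre)
      moreover have "sym_diff (\<Union>i. A i) (\<Union>i\<in>{..n}. B i) \<subseteq>
          ((\<Union>i. A i) - (\<Union>i\<le>n. A i)) \<union> (\<Union>i\<in>{..n}. sym_diff (A i) (B i))" for B
        by blast
      ultimately show ?thesis by (simp only:)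
    qed
    then have "prob (sym_diff (\<Union>i. A i) {x \<in> X. pre K x \<in> V})
        \<le> prob (((\<Union>i. A i) - (\<Union>i\<le>n. A i)) \<union> (\<Union>i\<in>{..n}. ?D i))"
      using A by (intro finite_measure_mono) auto
    also have "\<dots> \<le> prob ((\<Union>i. A i) - (\<Union>i\<le>n. A i)) + prob (\<Union>i\<in>{..n}. ?D i)"
      using A by (intro measure_Un_le) auto
    also have "prob (\<Union>i\<in>{..n}. ?D i) \<le> (\<Sum>i\<in>{..n}. prob (?D i))"
      using A by (intro measure_UNION_le) auto
    also have "\<dots> \<le> (\<Sum>i\<in>{..n}. e / (2 * real (Suc n)))"
      using kW by (intro sum_mono less_imp_le) auto
    also have "\<dots> = e / 2" by (simp del: of_nat_Suc)
    finally have "prob (sym_diff (\<Union>i. A i) {x \<in> X. pre K x \<in> V}) < e" using tail by linarith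
    then show ?case by blast
  qed
qed

text \<open>\<open>l\<close> guesses the atom from a prefix: any atom whose approximating cylinder
  contains it. Outside all the symmetric differences the true atom is such a candidate and every
  candidate contains \<open>x\<close>, so the guess is right.\<close>

lemma approx_partition_by_words:
  assumes fmp: "finite_measurable_partition M P" and e: "e > 0"
  shows "\<exists>k l. (\<forall>w. l w \<in> P) \<and> prob {x \<in> X. atom_of P x \<noteq> l (pre k x)} \<le> e"
proof -
  have P: "finite P" "P \<subseteq> events" "partition_on (space M) P"
    using fmp by (auto simp: finite_measurable_partition_def)
  have ne: "P \<noteq> {}" using P(3) not_empty by (auto simp: partition_on_def)
  define r where "r = real (card P)"
  have r: "r > 0" using P ne by (simp add: r_def card_gt_0_iff)
  have "\<forall>A\<in>P. \<exists>k W. prob (sym_diff A {x \<in> X. pre k x \<in> W}) < e / r"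
    using approx_by_cylinder P e r by (meson divide_pos_pos subsetD)
  from bchoice[OF this] obtain k where
    "\<forall>A\<in>P. \<exists>W. prob (sym_diff A {x \<in> X. pre (k A) x \<in> W}) < e / r" by blast
  from bchoice[OF this] obtain W where
    kW: "\<And>A. A \<in> P \<Longrightarrow> prob (sym_diff A {x \<in> X. pre (k A) x \<in> W A}) < e / r" by blast
  define K where "K = Max (k ` P)"
  have K: "k A \<le> K" if "A \<in> P" for A using that P unfolding K_def by (intro Max_ge) auto
  \<comment> \<open>When no cylinder matches, any atom serves; such points lie in a symmetric
    difference anyway.\<close>
  define l where "l w = (if \<exists>A\<in>P. take (k A) w \<in> W A then SOME A. A \<in> P \<and> take (k A) w \<in> W A
    else SOME A. A \<in> P)" for w
  have l1: "l w \<in> P" for w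
    using someI_ex[of "\<lambda>A. A \<in> P \<and> take (k A) w \<in> W A"] some_in_eq[of P] ne by (auto simp: l_def)
  have l2: "take (k (l w)) w \<in> W (l w)" if "\<exists>A\<in>P. take (k A) w \<in> W A" for w
    using someI_ex[of "\<lambda>A. A \<in> P \<and> take (k A) w \<in> W A"] that by (auto simp: l_def)
  let ?D = "\<lambda>A. sym_diff A {x \<in> X. pre (k A) x \<in> W A}"
  have "x \<in> (\<Union>A\<in>P. ?D A)" if x: "x \<in> X" "atom_of P x \<noteq> l (pre K x)" for x
  proof (rule ccontr)
    assume nD: "x \<notin> (\<Union>A\<in>P. ?D A)"
    note at = atom_of[OF P(3), of x, unfolded space_M, OF x(1)]
    have "take (k (atom_of P x)) (pre K x) \<in> W (atom_of P x)"
    proof -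
      have "x \<notin> ?D (atom_of P x)" using nD at(1) by blast
      then have "pre (k (atom_of P x)) x \<in> W (atom_of P x)" using at(2) by blast
      then show ?thesis using K[OF at(1)] by (simp add: take_pre)
    qed
    then have "take (k (l (pre K x))) (pre K x) \<in> W (l (pre K x))" using at(1) by (intro l2) blast
    then have "pre (k (l (pre K x))) x \<in> W (l (pre K x))" using K l1 by (simp add: take_pre)
    moreover have "x \<notin> ?D (l (pre K x))" using nD l1 by blast
    ultimately have "x \<in> l (pre K x)" using x(1) by blast
    from at(3)[OF l1 this] show False using x(2) by contradiction
  qed
  then have sub: "{x \<in> X. atom_of P x \<noteq> l (pre K x)} \<subseteq> (\<Union>A\<in>P. ?D A)" by blast
  have ev: "?D A \<in> events" if "A \<in> P" for A using that P(2) by auto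
  have "prob {x \<in> X. atom_of P x \<noteq> l (pre K x)} \<le> prob (\<Union>A\<in>P. ?D A)"
    using ev P(1) by (intro finite_measure_mono sub sets.finite_UN)
  also have "\<dots> \<le> (\<Sum>A\<in>P. prob (?D A))"
    using ev P(1) by (intro measure_UNION_le)
  also have "\<dots> \<le> (\<Sum>A\<in>P. e / r)" using kW by (intro sum_mono less_imp_le) auto
  also have "\<dots> = e" using r by (simp add: r_def)
  finally show ?thesis using l1 by blast
qed

end

text \<open>Cylinders form a generating family stable under intersection, and each is a finite union
  of single-word cylinders. The empty word is left out because its cylinder is all of
  \<open>X\<close>, of mass one for both measures.\<close>

lemma invariant_measure_eqI:
  assumes "binary_shift_measure X M" "binary_shift_measure X N"
    and eq: "\<And>w. w \<noteq> [] \<Longrightarrow> measure M {x \<in> X. pre (length w) x = w} = measure N {x \<in> X. pre (length w) x = w}"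
  shows "M = N"
proof -
  interpret M: binary_shift_measure X M by fact
  interpret N: binary_shift_measure X N by fact
  have eq': "measure M {x \<in> X. pre k x = w} = measure N {x \<in> X. pre k x = w}" for k w
  proof (cases "length w = k \<and> k \<noteq> 0")
    case True
    then show ?thesis using eq[of w] by auto
  next
    case False
    then consider "length w \<noteq> k" | "k = 0" "w = []" by auto
    then show ?thesis
    proof cases
      case 1
      then have "{x \<in> X. pre k x = w} = {}" by auto
      then show ?thesis by (simp only: measure_empty)
    next
      case 2
      then show ?thesis using M.prob_space N.prob_space by (simp add: pre_def M.space_M N.space_M)
    qed
  qed
  show ?thesis
  proof (rule measure_eqI_generator_eq[OF Int_stable_cylinders[of X], where A = "\<lambda>_. X" and \<Omega> = X])
    fix A assume "A \<in> {{x \<in> X. pre k x \<in> W} | k W. True}"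
    then obtain k W where A: "A = {x \<in> X. pre k x \<in> W}" by auto
    have fin: "finite (pre k ` X)" using finite_valuedD(1)[OF M.finite_valued_pre] .
    have A': "A = (\<Union>w\<in>W \<inter> pre k ` X. {x \<in> X. pre k x = w})" by (auto simp: A)
    have ev: "{x \<in> X. pre k x = w} \<in> M.events" "{x \<in> X. pre k x = w} \<in> N.events" for w
      using M.events_cyl[of k "{w}"] N.events_cyl[of k "{w}"] by simp_all
    have "measure M A = (\<Sum>w\<in>W \<inter> pre k ` X. measure M {x \<in> X. pre k x = w})"
      unfolding A' using fin by (intro M.finite_measure_finite_Union)
        (auto simp: disjoint_family_on_def ev)
    also have "\<dots> = measure N A"
      unfolding A' eq' using fin by (intro N.finite_measure_finite_Union[symmetric])
        (auto simp: disjoint_family_on_def ev)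
    finally show "emeasure M A = emeasure N A"
      by (simp add: M.emeasure_eq_measure N.emeasure_eq_measure)
  next
    show "range (\<lambda>_. X) \<subseteq> {{x \<in> X. pre k x \<in> W} | k W. True}"
      by (auto intro!: exI[of _ 0] exI[of _ UNIV])
  qed (auto simp: M.sets_M N.sets_M sets_restrict_borel_cylinders[OF M.closed_X] M.emeasure_eq_measure)
qed

section \<open>An entropy bound from weights on words\<close>

lemma sum_prod_words_over:
  fixes g :: "nat \<Rightarrow> 'b \<Rightarrow> real"
  assumes "finite P"
  shows "(\<Sum>w\<in>{w. set w \<subseteq> P \<and> length w = n}. \<Prod>i<n. g i (w ! i)) = (\<Prod>i<n. \<Sum>y\<in>P. g i y)"
proof (induction n)
  case 0
  have "{w. set w \<subseteq> P \<and> length w = 0} = {[]}" by auto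
  then show ?case by simp
next
  case (Suc n)
  have bij: "bij_betw (\<lambda>(w, y). w @ [y]) ({w. set w \<subseteq> P \<and> length w = n} \<times> P)
      {w. set w \<subseteq> P \<and> length w = Suc n}"
    by (rule bij_betwI[where g = "\<lambda>w. (butlast w, last w)"])
      (auto dest: in_set_butlastD simp: subset_iff, (metis last_in_set list.size(3) nat.distinct(1),
        metis append_butlast_last_id list.size(3) nat.distinct(1)))
  have "(\<Sum>w\<in>{w. set w \<subseteq> P \<and> length w = Suc n}. \<Prod>i<Suc n. g i (w ! i)) =
      (\<Sum>(w, y)\<in>{w. set w \<subseteq> P \<and> length w = n} \<times> P. \<Prod>i<Suc n. g i ((w @ [y]) ! i))"
    by (subst sum.reindex_bij_betw[OF bij, symmetric]) (simp add: case_prod_unfold)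
  also have "\<dots> = (\<Sum>(w, y)\<in>{w. set w \<subseteq> P \<and> length w = n} \<times> P. (\<Prod>i<n. g i (w ! i)) * g n y)"
    by (intro sum.cong refl) (auto simp: nth_append)
  also have "\<dots> = (\<Prod>i<n. \<Sum>y\<in>P. g i y) * (\<Sum>y\<in>P. g n y)"
    by (simp add: sum.cartesian_product[symmetric] sum_product[symmetric] Suc.IH)
  finally show ?case by simp
qed

context binary_shift_measure
begin

text \<open>
  An upper bound for the entropy of every finite partition \<open>P\<close>, without a generator theorem: the
  Gibbs inequality is applied to the joint law of the \<open>P\<close>-itinerary and of the word
  \<open>pre (n + k) x\<close>, compared with the law in which the word has a weight proportional to \<open>exp \<circ> \<Psi>\<close> and
  the \<open>P\<close>-labels are independent, each a small perturbation of the label predicted by the word.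
\<close>

lemma ks_entropy_le_weights:
  fixes \<Psi> :: "nat list \<Rightarrow> real"
  assumes C: "\<And>n. (\<Sum>w\<in>pre n ` X. exp (\<Psi> w)) \<le> C n" "(\<lambda>n. ln (C n) / real n) \<longlonglongrightarrow> 0"
    and J: "(\<lambda>n. expectation (\<lambda>x. \<Psi> (pre n x)) / real n) \<longlonglongrightarrow> J"
  shows "ks_entropy M shift_map \<le> ereal (- J)"
proof (rule ks_entropy_le)
  fix P L assume P: "finite_measurable_partition M P"
    and L: "(\<lambda>n. block_ent P (atom_of P) n / real n) \<longlonglongrightarrow> L"
  have fvP: "finite_valued M P (atom_of P)" by (rule finite_valued_atom_of[OF P])
  have finP: "finite P" using finite_valuedD(1)[OF fvP] .
  have neX: "X \<noteq> {}" using not_empty space_M by simp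
  have neP: "P \<noteq> {}" using finite_valuedD(2)[OF fvP] neX space_M by auto
  define r where "r = real (card P)"
  have r: "r \<ge> 1" using finP neP by (simp add: r_def Suc_le_eq card_gt_0_iff)
  have C0: "C n > 0" for n
  proof -
    have "0 < (\<Sum>w\<in>pre n ` X. exp (\<Psi> w))"
      using neX finite_valuedD(1)[OF finite_valued_pre] by (intro sum_pos) auto
    then show ?thesis using C(1)[of n] by linarith
  qed
  show "L \<le> - J"
  proof (rule field_le_epsilon)
    fix e :: real assume e: "e > 0"
    \<comment> \<open>Chosen so that a correct label costs \<open>- ln (1 - p) = e / 2\<close>; a
      wrong one costs \<open>ln (r / p)\<close>.\<close>
    define p where "p = 1 - exp (- (e / 2))"
    have p: "0 < p" "p < 1" using e by (auto simp: p_def)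
    have rp: "ln (r / p) \<ge> 0" using r p by simp
    \<comment> \<open>The probability allowed for wrong guesses, so small that their expected cost
      is also at most \<open>e / 2\<close>; the \<open>+ 1\<close> keeps the denominator
      positive.\<close>
    define d where "d = (e / 2) / (ln (r / p) + 1)"
    have d: "d > 0" "d * ln (r / p) \<le> e / 2"
      using e rp by (auto simp: d_def field_simps mult_nonneg_nonneg)
    obtain k l where l: "\<And>w. l w \<in> P" and err: "prob {x \<in> X. atom_of P x \<noteq> l (pre k x)} \<le> d"
      using approx_partition_by_words[OF P d(1)] by blast
    define K where "K A B = (if A = B then 1 - p else p / r)" for A B :: "(nat \<Rightarrow> nat) set"
    have K0: "K A B > 0" for A B using p r by (auto simp: K_def)
    have sumK: "(\<Sum>A\<in>P. K A B) \<le> 1" if B: "B \<in> P" for B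
    proof -
      have "(\<Sum>A\<in>P. K A B) = K B B + (\<Sum>A\<in>P - {B}. K A B)"
        using finP B by (rule sum.remove)
      also have "(\<Sum>A\<in>P - {B}. K A B) = (\<Sum>A\<in>P - {B}. p / r)"
        by (intro sum.cong) (auto simp: K_def)
      also have "\<dots> = (r - 1) * (p / r)" using finP B r by (simp add: r_def card_Diff_singleton of_nat_diff)
      also have "\<dots> \<le> r * (p / r)" using p r by (intro mult_right_mono) auto
      finally show ?thesis using r by (simp add: K_def)
    qed
    define cost where "cost x = - ln (K (atom_of P x) (l (pre k x)))" for x
    have fv_cost: "finite_valued M (P \<times> pre k ` X) (\<lambda>x. (atom_of P x, pre k x))"
      by (intro finite_valued_Pair fvP finite_valued_pre)
    have cost_int: "integrable M cost"
      using finite_valued_expectation(1)[OF fv_cost, of "\<lambda>(A, w). - ln (K A (l w))"] by (simp add: cost_def[abs_def])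
    have mism: "{x \<in> X. atom_of P x \<noteq> l (pre k x)} \<in> events"
    proof -
      have "{x \<in> X. atom_of P x \<noteq> l (pre k x)} =
          {x \<in> space M. (\<lambda>(A, w). A \<noteq> l w) (atom_of P x, pre k x) = True}" by (auto simp: space_M)
      also have "\<dots> \<in> events"
        by (rule finite_valuedD(3)[OF finite_valued_compose[OF fv_cost, of UNIV]]) auto
      finally show ?thesis .
    qed
    have "expectation cost \<le> expectation (\<lambda>x. e / 2 + indicator {x \<in> X. atom_of P x \<noteq> l (pre k x)} x * ln (r / p))"
    proof (rule integral_mono[OF cost_int])
      fix x assume "x \<in> space M"
      then show "cost x \<le> e / 2 + indicator {x \<in> X. atom_of P x \<noteq> l (pre k x)} x * ln (r / p)"
        using p r e by (auto simp: cost_def K_def space_M ln_div) (simp add: p_def)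
    qed (use mism in \<open>auto intro!: integrable_mult_left integrable_real_indicator simp: emeasure_eq_measure\<close>)
    also have "\<dots> = e / 2 + prob {x \<in> X. atom_of P x \<noteq> l (pre k x)} * ln (r / p)"
      using mism by (subst Bochner_Integration.integral_add)
        (auto intro!: integrable_mult_left integrable_real_indicator simp: emeasure_eq_measure prob_space[unfolded space_M] space_M
            Int_absorb2[OF Collect_restrict])
    also have "\<dots> \<le> e / 2 + d * ln (r / p)"
      using err rp by (intro add_left_mono mult_right_mono) auto
    finally have Ecost: "expectation cost \<le> e" using d(2) by linarith
    \<comment> \<open>A word of length \<open>n + k\<close> suffices: guessing the label at time
      \<open>i < n\<close> uses the \<open>k\<close> symbols from position \<open>i\<close>
      on.\<close>
    have bound: "block_ent P (atom_of P) n \<le> ln (C (n + k)) - expectation (\<lambda>x. \<Psi> (pre (n + k) x)) + real n * e" for n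
    proof -
      let ?S = "words_over P n \<times> pre (n + k) ` X"
      define q where "q = (\<lambda>(B, w). exp (\<Psi> w) / C (n + k) * (\<Prod>i<n. K (B ! i) (l (take k (drop i w)))))"
      have fv: "finite_valued M ?S (\<lambda>x. (itin (atom_of P) n x, pre (n + k) x))"
        by (intro finite_valued_Pair finite_valued_itin fvP finite_valued_pre)
      have "(\<Sum>z\<in>?S. q z) = (\<Sum>B\<in>words_over P n. \<Sum>w\<in>pre (n + k) ` X. q (B, w))"
        by (simp add: sum.cartesian_product)
      \<comment> \<open>Summing over the labels first leaves a product of kernel sums, each at most
        one, times the normalized word weight.\<close>
      also have "\<dots> = (\<Sum>w\<in>pre (n + k) ` X. \<Sum>B\<in>words_over P n. q (B, w))"
        by (rule sum.swap)
      also have "\<dots> = (\<Sum>w\<in>pre (n + k) ` X. exp (\<Psi> w) / C (n + k) * (\<Prod>i<n. \<Sum>A\<in>P. K A (l (take k (drop i w)))))"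
      proof (intro sum.cong refl)
        fix w
        show "(\<Sum>B\<in>words_over P n. q (B, w)) =
            exp (\<Psi> w) / C (n + k) * (\<Prod>i<n. \<Sum>A\<in>P. K A (l (take k (drop i w))))"
          using sum_prod_words_over[OF finP, of "\<lambda>i A. K A (l (take k (drop i w)))" n]
          unfolding q_def split_conv sum_distrib_left[symmetric] by (simp only:)
      qed
      also have "\<dots> \<le> (\<Sum>w\<in>pre (n + k) ` X. exp (\<Psi> w) / C (n + k) * 1)"
        using C0[of "n + k"] K0 sumK l
        by (intro sum_mono mult_left_mono prod_le_1) (auto intro!: sum_nonneg intro: less_imp_le)
      also have "\<dots> \<le> 1"
        using C(1)[of "n + k"] C0[of "n + k"] by (simp add: sum_divide_distrib[symmetric])
      finally have q1: "(\<Sum>z\<in>?S. q z) \<le> 1" .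
      have q0: "q z > 0" for z
        using C0[of "n + k"] K0 by (auto simp: q_def case_prod_unfold intro!: mult_pos_pos divide_pos_pos prod_pos)
      have "block_ent P (atom_of P) n \<le> ent M ?S (\<lambda>x. (itin (atom_of P) n x, pre (n + k) x))"
        by (intro ent_le_ent_Pair finite_valued_itin fvP finite_valued_pre)
      also have "\<dots> \<le> expectation (\<lambda>x. - ln (q (itin (atom_of P) n x, pre (n + k) x)))"
        by (rule ent_le_gibbs[OF fv]) (use q0 q1 in auto)
      also have "\<dots> = expectation (\<lambda>x. (ln (C (n + k)) - \<Psi> (pre (n + k) x)) + (\<Sum>i<n. cost ((shift_map ^^ i) x)))"
      proof (rule Bochner_Integration.integral_cong[OF refl])
        fix x
        have "ln (\<Prod>i<n. K (itin (atom_of P) n x ! i) (l (take k (drop i (pre (n + k) x))))) =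
            (\<Sum>i<n. - cost ((shift_map ^^ i) x))"
          by (subst ln_prod) (auto simp: less_imp_neq[OF K0, symmetric] cost_def itin_def take_drop_pre intro!: sum.cong)
        then show "- ln (q (itin (atom_of P) n x, pre (n + k) x)) =
            (ln (C (n + k)) - \<Psi> (pre (n + k) x)) + (\<Sum>i<n. cost ((shift_map ^^ i) x))"
          using C0[of "n + k"] K0
          by (simp add: q_def ln_mult_pos ln_div prod_pos sum_negf less_imp_neq[OF K0, symmetric])
      qed
      also have "\<dots> = (ln (C (n + k)) - expectation (\<lambda>x. \<Psi> (pre (n + k) x))) + (\<Sum>i<n. expectation (\<lambda>x. cost ((shift_map ^^ i) x)))"
      proof -
        have i1: "integrable M (\<lambda>x. \<Psi> (pre (n + k) x))"
          by (rule finite_valued_expectation(1)[OF finite_valued_pre])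
        have i2: "integrable M (\<lambda>x. cost ((shift_map ^^ i) x))" for i
          using finite_valued_expectation(1)[OF finite_valued_iter[OF fv_cost], of "\<lambda>(A, w). - ln (K A (l w))" i]
          by (simp add: cost_def)
        show ?thesis using i1 i2
          by (subst Bochner_Integration.integral_add) (auto simp: prob_space)
      qed
      also have "(\<Sum>i<n. expectation (\<lambda>x. cost ((shift_map ^^ i) x))) = real n * expectation cost"
        using expectation_iter[OF borel_measurable_integrable[OF cost_int]] by simp
      also have "\<dots> \<le> real n * e" using Ecost by (intro mult_left_mono) auto
      finally show ?thesis by simp
    qed
    \<comment> \<open>\<open>a (n + k)\<close> is the bound per symbol; multiplying by
      \<open>1 + k / n\<close> turns it into one per label, and this factor tends to one.\<close>
    define a where "a n = (ln (C n) - expectation (\<lambda>x. \<Psi> (pre n x))) / real n" for n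
    have "a \<longlonglongrightarrow> 0 - J" unfolding a_def diff_divide_distrib by (intro tendsto_diff C J)
    then have "(\<lambda>n. a (n + k)) \<longlonglongrightarrow> - J" using LIMSEQ_ignore_initial_segment by fastforce
    moreover have "(\<lambda>n. 1 + real k * (1 / real n)) \<longlonglongrightarrow> 1 + real k * 0"
      by (intro tendsto_intros lim_1_over_n)
    ultimately have "(\<lambda>n. a (n + k) * (1 + real k * (1 / real n)) + e) \<longlonglongrightarrow> - J * (1 + real k * 0) + e"
      by (intro tendsto_intros)
    then have lim: "(\<lambda>n. a (n + k) * (1 + real k * (1 / real n)) + e) \<longlonglongrightarrow> - J + e" by simp
    show "L \<le> - J + e"
    proof (rule LIMSEQ_le[OF L lim], intro exI allI impI)
      fix n :: nat assume n: "n \<ge> 1"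
      have "(1 + real k * (1 / real n)) * real n = real (n + k)" using n by (simp add: field_simps)
      then have "a (n + k) * (1 + real k * (1 / real n)) * real n = a (n + k) * real (n + k)"
        by (simp only: mult.assoc)
      also have "\<dots> = ln (C (n + k)) - expectation (\<lambda>x. \<Psi> (pre (n + k) x))"
        using n by (simp add: a_def)
      finally have "a (n + k) * (1 + real k * (1 / real n)) * real n =
          ln (C (n + k)) - expectation (\<lambda>x. \<Psi> (pre (n + k) x))" .
      then have "block_ent P (atom_of P) n \<le> (a (n + k) * (1 + real k * (1 / real n)) + e) * real n"
        using bound[of n] by (simp add: algebra_simps)
      then show "block_ent P (atom_of P) n / real n \<le> a (n + k) * (1 + real k * (1 / real n)) + e"
        using n by (simp add: divide_le_eq)
    qed
  qed
qed

end

section \<open>Words and blocks\<close>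

definition zeros_ones :: "nat \<Rightarrow> nat \<Rightarrow> nat list" where
  "zeros_ones a b = replicate a 0 @ replicate b 1"

text \<open>The index is shifted by one so that every pair of natural numbers names a block.\<close>

definition blk :: "nat \<times> nat \<Rightarrow> nat list" where
  "blk i = zeros_ones (Suc (fst i)) (Suc (snd i))"

abbreviation cat :: "(nat \<times> nat) list \<Rightarrow> nat list" where
  "cat is \<equiv> concat (map blk is)"

lemma length_zeros_ones [simp]: "length (zeros_ones a b) = a + b"
  by (simp add: zeros_ones_def)

lemma length_blk: "length (blk i) = fst i + snd i + 2"
  by (simp add: blk_def)

lemma length_le_length_cat: "length is \<le> length (cat is)"
  by (induction "is") (auto simp: length_blk)

lemma count_zeros_ones: "count_list (zeros_ones a b) 1 = b"
proof -
  have "count_list (replicate n x) y = (if x = y then n else 0)" for n and x y :: nat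
    by (induction n) auto
  then show ?thesis by (simp add: zeros_ones_def)
qed

lemma take_zeros_ones: "take k (zeros_ones a b) = zeros_ones (min k a) (min (k - a) b)"
  by (simp add: zeros_ones_def min_def)

lemma drop_zeros_ones: "drop k (zeros_ones a b) = zeros_ones (a - k) (b - (k - a))"
  by (simp add: zeros_ones_def)

lemma sublist_zeros_ones:
  assumes "sublist w (zeros_ones a b)"
  shows "\<exists>c d. w = zeros_ones c d"
proof -
  from assms obtain p s where "zeros_ones a b = p @ w @ s" by (auto simp: sublist_def)
  then have "w = take (length w) (drop (length p) (zeros_ones a b))" by simp
  then show ?thesis by (metis take_zeros_ones drop_zeros_ones)
qed

lemma zeros_ones_0_0 [simp]: "zeros_ones 0 0 = []"
  by (simp add: zeros_ones_def)

lemma prefix_cat: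
  assumes "prefix w (cat is)" "is \<in> lists A"
  shows "\<exists>js c d. js \<in> lists A \<and> w = cat js @ zeros_ones c d"
  using assms
proof (induction "is" arbitrary: w)
  case Nil
  then show ?case by (intro exI[of _ "[]"] exI[of _ 0]) auto
next
  case (Cons i "is")
  then have "prefix w (blk i) \<or> (\<exists>w'. w = blk i @ w' \<and> prefix w' (cat is))"
    by (simp add: prefix_append)
  then show ?case
  proof
    assume "prefix w (blk i)"
    then obtain c d where "w = zeros_ones c d"
      unfolding blk_def using sublist_zeros_ones prefix_imp_sublist by blast
    then show ?thesis by (intro exI[of _ "[]"]) auto
  next
    assume "\<exists>w'. w = blk i @ w' \<and> prefix w' (cat is)"
    then obtain w' where w': "w = blk i @ w'" "prefix w' (cat is)" by blast
    from Cons.IH[OF this(2)] Cons.prems(2) obtain js c d where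
      "js \<in> lists A" "w' = cat js @ zeros_ones c d" by auto
    then show ?thesis using w' Cons.prems(2)
      by (intro exI[of _ "i # js"] exI[of _ c] exI[of _ d]) auto
  qed
qed

text \<open>Only blocks cut by the ends of \<open>w\<close> are incomplete, and a factor of 0^a 1^b
  has the same form. The end pieces satisfy no constraint, not even positivity of the exponents; a
  word inside one block is a single end piece.\<close>

lemma sublist_cat:
  assumes "sublist w (cat is)" "is \<in> lists A"
  shows "\<exists>a b js c d. js \<in> lists A \<and> w = zeros_ones a b @ cat js @ zeros_ones c d"
  using assms
proof (induction "is")
  case Nil
  then show ?case by (intro exI[of _ 0] exI[of _ "[]"]) auto
next
  case (Cons i "is")
  then consider "sublist w (blk i)" | "sublist w (cat is)"
    | u v where "w = u @ v" "suffix u (blk i)" "prefix v (cat is)"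
    by (auto simp: sublist_append)
  then show ?case
  proof cases
    case 1
    then obtain c d where "w = zeros_ones c d" unfolding blk_def using sublist_zeros_ones by blast
    then show ?thesis
      by (rule_tac x = c in exI, rule_tac x = d in exI, rule_tac x = "[]" in exI,
          rule_tac x = 0 in exI, rule_tac x = 0 in exI) simp
  next
    case 2
    then show ?thesis using Cons by auto
  next
    case (3 u v)
    then obtain a b where "u = zeros_ones a b"
      unfolding blk_def using sublist_zeros_ones suffix_imp_sublist by blast
    moreover obtain js c d where "js \<in> lists A" "v = cat js @ zeros_ones c d"
      using prefix_cat[OF 3(3), of A] Cons.prems(2) by auto
    ultimately show ?thesis using 3(1) by blast
  qed
qed

lemma split_into_chunks:
  assumes "N \<ge> 1" "is \<in> lists A"
  shows "\<exists>Us r. is = concat Us @ r \<and> (\<forall>U\<in>set Us. U \<in> lists A \<and> length U = N) \<and>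
    r \<in> lists A \<and> length r < N"
  using assms(2)
proof (induction "length is" arbitrary: "is" rule: less_induct)
  case less
  show ?case
  proof (cases "length is < N")
    case True
    then show ?thesis using less.prems by (intro exI[of _ "[]"] exI[of _ "is"]) auto
  next
    case False
    then have "length (drop N is) < length is" using assms(1) by simp
    moreover have drp: "drop N is \<in> lists A" and tk: "take N is \<in> lists A"
      using less.prems by (auto simp: in_lists_conv_set dest: in_set_dropD in_set_takeD)
    ultimately obtain Us r where Us: "drop N is = concat Us @ r"
      "\<forall>U\<in>set Us. U \<in> lists A \<and> length U = N" "r \<in> lists A" "length r < N"
      using less.hyps by blast
    have "is = concat (take N is # Us) @ r" using Us(1) append_take_drop_id[of N "is"] by simp
    moreover have "\<forall>U\<in>set (take N is # Us). U \<in> lists A \<and> length U = N"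
      using Us(2) tk False by auto
    ultimately show ?thesis using Us by blast
  qed
qed

subsection \<open>Counting occurrences\<close>

text \<open>Overlapping occurrences all count. The empty word occurs \<open>length w + 1\<close>
  times, so \<open>v \<noteq> []\<close> is required where \<open>occ\<close> is bounded by the
  length or shown to be superadditive.\<close>

definition occ :: "'a list \<Rightarrow> 'a list \<Rightarrow> nat" where
  "occ v w = card {i. i + length v \<le> length w \<and> take (length v) (drop i w) = v}"

lemma finite_occ: "finite {i. i + length v \<le> length w \<and> Q i}"
  by (rule finite_subset[of _ "{..length w}"]) auto

lemma occ_le_length:
  assumes "v \<noteq> []"
  shows "occ v w \<le> length w"
proof -
  have "occ v w \<le> card {..<length w}"
    unfolding occ_def using assms by (intro card_mono) (auto simp: neq_Nil_conv)
  then show ?thesis by simp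
qed

lemma occ_append_ge:
  assumes "v \<noteq> []"
  shows "occ v x + occ v y \<le> occ v (x @ y)"
proof -
  let ?A = "{i. i + length v \<le> length x \<and> take (length v) (drop i x) = v}"
  let ?B = "{i. i + length v \<le> length y \<and> take (length v) (drop i y) = v}"
  have v: "length v > 0" using assms by simp
  have "occ v x + occ v y = card ?A + card ((+) (length x) ` ?B)"
    by (simp add: occ_def card_image)
  also have "\<dots> = card (?A \<union> (+) (length x) ` ?B)"
    using v by (intro card_Un_disjoint[symmetric]) (auto simp: finite_occ)
  also have "\<dots> \<le> occ v (x @ y)"
    unfolding occ_def by (intro card_mono finite_occ) auto
  finally show ?thesis .
qed

text \<open>An occurrence inside neither factor starts among the last \<open>length v\<close>
  positions of \<open>x\<close>.\<close>

lemma occ_append_le: "occ v (x @ y) \<le> occ v x + occ v y + length v"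
proof -
  let ?S = "\<lambda>w. {i. i + length v \<le> length w \<and> take (length v) (drop i w) = v}"
  let ?C = "{i. length x < i + length v \<and> i < length x}"
  have "?S (x @ y) \<subseteq> ?S x \<union> (+) (length x) ` ?S y \<union> ?C"
  proof
    fix i assume i: "i \<in> ?S (x @ y)"
    consider "i + length v \<le> length x" | "i \<in> ?C" | "i \<ge> length x" "\<not> i + length v \<le> length x" by fastforce
    then show "i \<in> ?S x \<union> (+) (length x) ` ?S y \<union> ?C"
    proof cases
      case 3
      then have "i - length x \<in> ?S y" using i by auto
      then have "length x + (i - length x) \<in> (+) (length x) ` ?S y" by (rule imageI)
      then show ?thesis using 3 by simp
    qed (use i in auto)
  qed
  moreover have finC: "finite ?C" by (rule finite_subset[of _ "{..length x}"]) auto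
  ultimately have "occ v (x @ y) \<le> card (?S x \<union> (+) (length x) ` ?S y \<union> ?C)"
    unfolding occ_def by (intro card_mono) (auto simp: finite_occ)
  also have "\<dots> \<le> card (?S x) + card ((+) (length x) ` ?S y) + card ?C"
    by (meson add_right_mono card_Un_le order_trans)
  also have "card ?C \<le> card {length x - length v..<length x}"
    by (intro card_mono) auto
  also have "card {length x - length v..<length x} \<le> length v" by simp
  finally show ?thesis by (simp add: occ_def card_image)
qed

context binary_shift_measure
begin

lemma expectation_indicator_iter:
  assumes "\<And>x. x \<in> X \<Longrightarrow> Q x \<longleftrightarrow> pre k x \<in> W"
  shows "expectation (\<lambda>x. of_bool (Q ((shift_map ^^ i) x))) = prob {x \<in> X. Q x}"
    and "integrable M (\<lambda>x. of_bool (Q ((shift_map ^^ i) x)) :: real)"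
proof -
  have eq: "{x \<in> X. Q x} = {x \<in> X. pre k x \<in> W}" using assms by auto
  have ev: "{x \<in> X. Q x} \<in> events" unfolding eq by simp
  have m: "indicator {x \<in> X. Q x} \<in> borel_measurable M" using ev by simp
  have *: "of_bool (Q ((shift_map ^^ i) x)) = (indicator {x \<in> X. Q x} ((shift_map ^^ i) x) :: real)"
    if "x \<in> space M" for x
    using T_iter_space[OF that] by (auto simp: space_M indicator_def)
  have "expectation (\<lambda>x. of_bool (Q ((shift_map ^^ i) x))) =
      expectation (\<lambda>x. indicator {x \<in> X. Q x} ((shift_map ^^ i) x) :: real)"
    by (intro Bochner_Integration.integral_cong refl *)
  also have "\<dots> = expectation (indicator {x \<in> X. Q x})" by (rule expectation_iter[OF m])
  also have "\<dots> = prob {x \<in> X. Q x}" using ev by simp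
  finally show "expectation (\<lambda>x. of_bool (Q ((shift_map ^^ i) x))) = prob {x \<in> X. Q x}" .
  have "integrable M (\<lambda>x. indicator {x \<in> X. Q x} ((shift_map ^^ i) x) :: real)"
    by (rule integrable_const_bound[where B = 1]) (auto intro!: measurable_compose[OF T_iter m])
  then show "integrable M (\<lambda>x. of_bool (Q ((shift_map ^^ i) x)) :: real)"
    by (subst Bochner_Integration.integrable_cong[OF refl *])
qed

lemma expectation_ones:
  "expectation (\<lambda>x. real (count_list (pre n x) 1)) = real n * prob {x \<in> X. x 0 = 1}"
proof -
  have *: "real (count_list (pre n x) 1) = (\<Sum>i<n. of_bool ((shift_map ^^ i) x 0 = 1))" for x :: "nat \<Rightarrow> nat"
    by (induction n) (auto simp: pre_def shift_map_iter)
  have Q: "x 0 = 1 \<longleftrightarrow> pre 1 x \<in> {[1]}" for x :: "nat \<Rightarrow> nat" by (simp add: pre_def)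
  show ?thesis unfolding *
    by (subst Bochner_Integration.integral_sum)
      (simp_all add: expectation_indicator_iter[of "\<lambda>x. x 0 = 1", OF Q] del: One_nat_def)
qed

lemma expectation_occ:
  assumes "n \<ge> length v"
  shows "expectation (\<lambda>x. real (occ v (pre n x))) = real (Suc n - length v) * prob {x \<in> X. pre (length v) x = v}"
proof -
  have *: "real (occ v (pre n x)) = (\<Sum>i<Suc n - length v. of_bool (pre (length v) ((shift_map ^^ i) x) = v))"
    for x :: "nat \<Rightarrow> nat"
  proof -
    have "{i. i + length v \<le> length (pre n x) \<and> take (length v) (drop i (pre n x)) = v} =
        {i \<in> {..<Suc n - length v}. pre (length v) ((shift_map ^^ i) x) = v}"
      using assms by (auto simp: take_drop_pre)
    then show ?thesis by (simp add: occ_def sum.If_cases of_bool_def Int_def)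
  qed
  have Q: "pre (length v) x = v \<longleftrightarrow> pre (length v) x \<in> {v}" for x :: "nat \<Rightarrow> nat" by simp
  show ?thesis unfolding *
    by (subst Bochner_Integration.integral_sum) (auto simp: expectation_indicator_iter[OF Q])
qed

lemma expectation_occ_limit:
  "(\<lambda>n. expectation (\<lambda>x. real (occ v (pre n x))) / real n) \<longlonglongrightarrow> prob {x \<in> X. pre (length v) x = v}"
proof -
  let ?c = "prob {x \<in> X. pre (length v) x = v}"
  have "(\<lambda>n. (real n + (1 - real (length v))) / real n * ?c) \<longlonglongrightarrow> 1 * ?c"
    by (intro tendsto_mult tendsto_const) real_asymp
  moreover have "\<forall>\<^sub>F n in sequentially. (real n + (1 - real (length v))) / real n * ?c =
      expectation (\<lambda>x. real (occ v (pre n x))) / real n"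
    using eventually_ge_at_top[of "length v"]
    by eventually_elim (simp add: expectation_occ Suc_diff_le of_nat_diff)
  ultimately have "(\<lambda>n. expectation (\<lambda>x. real (occ v (pre n x))) / real n) \<longlonglongrightarrow> 1 * ?c"
    by (rule Lim_transform_eventually)
  then show ?thesis by simp
qed

end

section \<open>The shift generated by a set of blocks\<close>

text \<open>\<open>A\<close> is an arbitrary set of block indices; the function \<open>f\<close>
  enters only in \<open>block_rule\<close>. \<open>X_eq\<close> allows a sequence to be placed in
  \<open>X\<close> by checking its finite words.\<close>

locale block_shift =
  fixes A :: "(nat \<times> nat) set" and X :: "(nat \<Rightarrow> nat) set"
  assumes closed_X: "closed X" and binary: "x \<in> X \<Longrightarrow> x n \<in> {0, 1}"
    and shift_X: "x \<in> X \<Longrightarrow> shift_map x \<in> X"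
    and X_eq: "X = {x. \<forall>i n. map x [i..<i + n] \<in> language X}"
    and language_X: "language X = {w. \<exists>is\<in>lists A. sublist w (cat is)}"
begin

lemma binary_shift_measureI:
  "M \<in> invariant_measures X \<Longrightarrow> binary_shift_measure X M"
  using closed_X binary by (simp add: binary_shift_measure_def)

lemma pre_in_language: "x \<in> X \<Longrightarrow> pre n x \<in> language X"
  unfolding language_def pre_def by (rule CollectI, intro exI[of _ x] exI[of _ 0] exI[of _ n]) simp

lemma language_parse:
  assumes "w \<in> language X"
  shows "\<exists>a b js c d. js \<in> lists A \<and> w = zeros_ones a b @ cat js @ zeros_ones c d"
  using assms sublist_cat unfolding language_X by blast

text \<open>
  Cutting a word into an initial piece, chunks of \<open>N\<close> blocks, fewer than \<open>N\<close> further blocks and a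
  final piece leaves polynomially many choices besides the chunks.
\<close>

lemma sum_exp_weights_le:
  fixes \<Psi> :: "nat list \<Rightarrow> real"
  assumes sub: "\<And>x y. \<Psi> (x @ y) \<le> \<Psi> x + \<Psi> y + D" and neg: "\<And>x. \<Psi> x \<le> 0" and N: "N \<ge> 1"
    and le1: "\<And>F. finite F \<Longrightarrow> F \<subseteq> {U \<in> lists A. length U = N} \<Longrightarrow> (\<Sum>U\<in>F. exp (\<Psi> (cat U) + D)) \<le> 1"
  shows "(\<Sum>w\<in>pre n ` X. exp (\<Psi> w)) \<le> exp (2 * \<bar>D\<bar>) * real (Suc N) * real (Suc n) ^ (2 * N + 5)"
proof -
  define F where "F = {U \<in> lists A. length U = N \<and> length (cat U) \<le> n}"
  \<comment> \<open>Exponents in a word of length at most \<open>n\<close> are at most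
    \<open>n\<close>, so \<open>B\<close> bounds both the block indices and the exponent pairs of
    the end pieces.\<close>
  define B where "B = ({..n} \<times> {..n} :: (nat \<times> nat) set)"
  have in_B: "i \<in> B" if "i \<in> set is" "length (cat is) \<le> n" for i "is"
  proof -
    have "length (blk i) \<le> length (cat is)"
      using that(1) by (induction "is") auto
    then show ?thesis using that(2) by (cases i) (auto simp: B_def length_blk)
  qed
  have "F \<subseteq> {U. set U \<subseteq> B \<and> length U = N}"
    using in_B by (auto simp: F_def)
  then have finF: "finite F"
    by (rule finite_subset) (auto intro!: finite_lists_length_eq simp: B_def)
  have sumF: "(\<Sum>U\<in>F. exp (\<Psi> (cat U) + D)) \<le> 1"
    by (rule le1[OF finF]) (auto simp: F_def)
  define UU where "UU = (\<Union>k\<le>n. {Us. set Us \<subseteq> F \<and> length Us = k})"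
  define RR where "RR = {r. set r \<subseteq> B \<and> length r \<le> N}"
  define J where "J = UU \<times> (RR \<times> (B \<times> B))"
  define word where "word = (\<lambda>(Us, r, (a, b), (c, d)).
    zeros_ones a b @ cat (concat Us) @ cat r @ zeros_ones c d)"
  have finB: "finite B" by (simp add: B_def)
  have finUU: "finite UU" unfolding UU_def using finF by (auto intro!: finite_lists_length_eq)
  have finRR: "finite RR" unfolding RR_def using finB by (rule finite_lists_length_le)
  have cover: "pre n ` X \<subseteq> word ` J"
  proof safe
    fix x assume x: "x \<in> X"
    obtain a b js c d where js: "js \<in> lists A" and w: "pre n x = zeros_ones a b @ cat js @ zeros_ones c d"
      using language_parse[OF pre_in_language[OF x]] by blast
    obtain Us r where Us: "js = concat Us @ r" "\<forall>U\<in>set Us. U \<in> lists A \<and> length U = N"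
      "r \<in> lists A" "length r < N"
      using split_into_chunks[OF N js] by blast
    have len: "n = a + b + (length (cat (concat Us)) + length (cat r)) + (c + d)"
      using arg_cong[OF w, of length] by (simp add: Us(1))
    have lenU: "length (cat U) \<le> length (cat (concat Us))" if "U \<in> set Us" for U
      using that by (induction Us) auto
    have "Us \<in> UU"
    proof -
      have "length Us \<le> length (concat Us)"
        using Us(2) N by (induction Us) auto
      also have "\<dots> \<le> n" using length_le_length_cat[of "concat Us"] len by linarith
      finally have "length Us \<le> n" .
      moreover have "set Us \<subseteq> F"
        using Us(2) lenU len by (fastforce simp: F_def)
      ultimately show ?thesis by (auto simp: UU_def)
    qed
    moreover have "r \<in> RR" using Us(4) in_B[of _ r] len by (auto simp: RR_def)
    moreover have "(a, b) \<in> B" "(c, d) \<in> B" using len by (auto simp: B_def)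
    ultimately have "(Us, r, (a, b), (c, d)) \<in> J" by (simp add: J_def)
    moreover have "pre n x = word (Us, r, (a, b), (c, d))" by (simp add: word_def w Us(1))
    ultimately show "pre n x \<in> word ` J" by blast
  qed
  have chunks: "\<Psi> (cat (concat Us)) \<le> (\<Sum>U\<leftarrow>Us. \<Psi> (cat U) + D)" for Us
  proof (induction Us)
    case Nil
    then show ?case using neg by simp
  next
    case (Cons U Us)
    have "\<Psi> (cat (concat (U # Us))) \<le> \<Psi> (cat U) + \<Psi> (cat (concat Us)) + D"
      using sub[of "cat U" "cat (concat Us)"] by simp
    then show ?case using Cons by simp
  qed
  \<comment> \<open>The remainder \<open>r\<close> and the end pieces are discarded because
    \<open>\<Psi> \<le> 0\<close>. Two junctions are charged to the constant
    \<open>2 * \<bar>D\<bar>\<close>; each chunk carries its own \<open>D\<close>.\<close>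
  have weight: "exp (\<Psi> (word z)) \<le> exp (2 * \<bar>D\<bar>) * (\<Prod>i<length (fst z). exp (\<Psi> (cat (fst z ! i)) + D))" for z
  proof -
    obtain Us r a b c d where z: "z = (Us, r, (a, b), (c, d))" by (metis surj_pair)
    have "\<Psi> (word z) \<le> \<Psi> (zeros_ones a b) + (\<Psi> (cat (concat Us)) + \<Psi> (cat r @ zeros_ones c d) + D) + D"
      using sub[of "zeros_ones a b" "cat (concat Us) @ cat r @ zeros_ones c d"]
        sub[of "cat (concat Us)" "cat r @ zeros_ones c d"]
      by (simp add: z word_def)
    also have "\<dots> \<le> 2 * \<bar>D\<bar> + (\<Sum>U\<leftarrow>Us. \<Psi> (cat U) + D)"
      using neg[of "zeros_ones a b"] neg[of "cat r @ zeros_ones c d"] chunks[of Us] by linarith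
    also have "(\<Sum>U\<leftarrow>Us. \<Psi> (cat U) + D) = (\<Sum>i<length Us. \<Psi> (cat (Us ! i)) + D)"
      by (simp add: sum_list_sum_nth atLeast0LessThan)
    finally show ?thesis by (simp add: z exp_add[symmetric] exp_sum[symmetric])
  qed
  have "(\<Sum>w\<in>pre n ` X. exp (\<Psi> w)) \<le> (\<Sum>w\<in>word ` J. exp (\<Psi> w))"
    using finUU finRR finB by (intro sum_mono2 cover) (auto simp: J_def)
  also have "\<dots> \<le> (\<Sum>z\<in>J. exp (\<Psi> (word z)))"
    using sum_image_le[of J "\<lambda>w. exp (\<Psi> w)" word] finUU finRR finB by (simp add: J_def comp_def)
  also have "\<dots> \<le> (\<Sum>z\<in>J. exp (2 * \<bar>D\<bar>) * (\<Prod>i<length (fst z). exp (\<Psi> (cat (fst z ! i)) + D)))"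
    by (intro sum_mono weight)
  also have "\<dots> = exp (2 * \<bar>D\<bar>) * (real (card (RR \<times> (B \<times> B))) *
      (\<Sum>Us\<in>UU. \<Prod>i<length Us. exp (\<Psi> (cat (Us ! i)) + D)))"
    unfolding J_def sum_distrib_left[symmetric]
    using sum.cartesian_product[of "\<lambda>Us _. \<Prod>i<length Us. exp (\<Psi> (cat (Us ! i)) + D)" "RR \<times> (B \<times> B)" UU, symmetric]
    by (simp add: case_prod_unfold sum_distrib_left)
  also have "(\<Sum>Us\<in>UU. \<Prod>i<length Us. exp (\<Psi> (cat (Us ! i)) + D)) =
      (\<Sum>k\<le>n. \<Sum>Us\<in>{Us. set Us \<subseteq> F \<and> length Us = k}. \<Prod>i<length Us. exp (\<Psi> (cat (Us ! i)) + D))"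
    unfolding UU_def using finF by (intro sum.UNION_disjoint) (auto intro!: finite_lists_length_eq)
  also have "\<dots> = (\<Sum>k\<le>n. \<Sum>Us\<in>{Us. set Us \<subseteq> F \<and> length Us = k}. \<Prod>i<k. exp (\<Psi> (cat (Us ! i)) + D))"
    by (intro sum.cong refl) auto
  \<comment> \<open>Here chunking pays off: sequences of \<open>k\<close> chunks sum to the
    \<open>k\<close>-th power of a number at most one, so only the factor \<open>n + 1\<close>
    survives.\<close>
  also have "\<dots> = (\<Sum>k\<le>n. (\<Sum>U\<in>F. exp (\<Psi> (cat U) + D)) ^ k)"
    by (subst sum_prod_words_over[OF finF]) simp
  also have "\<dots> \<le> (\<Sum>k\<le>n. 1)"
    using sumF by (intro sum_mono power_le_one sum_nonneg) auto
  also have "\<dots> = real (Suc n)" by simp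
  \<comment> \<open>Each of at most \<open>N\<close> block indices in \<open>r\<close> has
    \<open>(n + 1)^2\<close> choices, and the two end pieces have \<open>(n + 1)^4\<close>
    together.\<close>
  also have "real (card (RR \<times> (B \<times> B))) \<le> real (Suc N) * real (Suc n) ^ (2 * N) * real (Suc n) ^ 4"
  proof -
    have cB: "card B = Suc n ^ 2" by (simp add: B_def power2_eq_square)
    have "card RR = (\<Sum>i\<le>N. (Suc n ^ 2) ^ i)"
      unfolding RR_def cB[symmetric] by (rule card_lists_length_le[OF finB])
    also have "\<dots> \<le> (\<Sum>i\<le>N. Suc n ^ (2 * N))"
      unfolding power_mult[symmetric] by (intro sum_mono power_increasing) auto
    also have "\<dots> = Suc N * Suc n ^ (2 * N)" by simp
    finally have "card (RR \<times> (B \<times> B)) \<le> Suc N * Suc n ^ (2 * N) * Suc n ^ 4"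
      unfolding card_cartesian_product cB power_add[symmetric] by simp
    then have "real (card (RR \<times> (B \<times> B))) \<le> real (Suc N * Suc n ^ (2 * N) * Suc n ^ 4)"
      by (simp only: of_nat_le_iff)
    then show ?thesis by (simp only: of_nat_mult of_nat_power)
  qed
  finally have "(\<Sum>w\<in>pre n ` X. exp (\<Psi> w)) \<le>
      exp (2 * \<bar>D\<bar>) * ((real (Suc N) * real (Suc n) ^ (2 * N) * real (Suc n) ^ 4) * real (Suc n))"
    by (simp add: mult_left_mono mult_right_mono)
  also have "\<dots> = exp (2 * \<bar>D\<bar>) * real (Suc N) * real (Suc n) ^ (2 * N + 5)"
    by (simp add: power_add power_numeral_reduce algebra_simps)
  finally show ?thesis .
qed

text \<open>The weight exponent \<open>\<Psi>\<close> gains \<open>s\<close> per occurrence of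
  \<open>v\<close>. For positive \<open>s\<close> a junction can create up to
  \<open>length v\<close> new occurrences, paid for by the summand with \<open>max 0 s\<close>; for
  negative \<open>s\<close> new occurrences only lower \<open>\<Psi>\<close>. The condition
  \<open>s \<le> q\<close> keeps \<open>\<Psi> \<le> 0\<close>, since \<open>v\<close> occurs at
  most once per position.\<close>

lemma ks_entropy_le_block_sums:
  fixes q t s :: real
  assumes M: "M \<in> invariant_measures X" and q: "q \<ge> 0" "s \<le> q" and t: "t \<ge> 0"
    and v: "v \<noteq> []" and N: "N \<ge> 1"
    and le1: "\<And>F. finite F \<Longrightarrow> F \<subseteq> {U \<in> lists A. length U = N} \<Longrightarrow>
      (\<Sum>U\<in>F. exp (s * real (occ v (cat U)) + max 0 s * real (length v)
        - q * real (length (cat U)) - t * real (count_list (cat U) 1))) \<le> 1"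
  shows "ks_entropy M shift_map \<le> ereal (q + t * measure M {x \<in> X. x 0 = 1}
    - s * measure M {x \<in> X. pre (length v) x = v})"
proof -
  interpret binary_shift_measure X M by (rule binary_shift_measureI[OF M])
  define \<Psi> where "\<Psi> w = s * real (occ v w) - q * real (length w) - t * real (count_list w 1)" for w :: "nat list"
  define D where "D = max 0 s * real (length v)"
  define C where "C n = exp (2 * \<bar>D\<bar>) * real (Suc N) * real (Suc n) ^ (2 * N + 5)" for n
  have sub: "\<Psi> (x @ y) \<le> \<Psi> x + \<Psi> y + D" for x y
  proof -
    have "s * real (occ v (x @ y)) \<le> s * (real (occ v x) + real (occ v y)) + D"
    proof (cases "s \<ge> 0")
      case True
      have "real (occ v (x @ y)) \<le> real (occ v x + occ v y + length v)"
        using occ_append_le of_nat_mono by blast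
      then have "s * real (occ v (x @ y)) \<le> s * real (occ v x + occ v y + length v)"
        using True by (intro mult_left_mono)
      then show ?thesis using True by (simp add: D_def algebra_simps)
    next
      case False
      have "real (occ v x + occ v y) \<le> real (occ v (x @ y))"
        using occ_append_ge[OF v] of_nat_mono by blast
      then have "s * real (occ v (x @ y)) \<le> s * real (occ v x + occ v y)"
        using False by (intro mult_left_mono_neg) auto
      then show ?thesis using False by (simp add: D_def)
    qed
    then show ?thesis by (simp add: \<Psi>_def algebra_simps)
  qed
  have neg: "\<Psi> x \<le> 0" for x
  proof -
    have "s * real (occ v x) \<le> q * real (length x)"
    proof (cases "s \<ge> 0")
      case True
      then show ?thesis using q occ_le_length[OF v, of x] by (intro mult_mono) auto
    next
      case False
      then have "s * real (occ v x) \<le> 0" by (simp add: mult_nonpos_nonneg)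
      also have "0 \<le> q * real (length x)" using q by simp
      finally show ?thesis .
    qed
    moreover have "t * real (count_list x 1) \<ge> 0" using t by simp
    ultimately show ?thesis by (simp add: \<Psi>_def)
  qed
  have C: "(\<Sum>w\<in>pre n ` X. exp (\<Psi> w)) \<le> C n" for n
    unfolding C_def
  proof (rule sum_exp_weights_le[OF sub neg N])
    fix F assume "finite F" "F \<subseteq> {U \<in> lists A. length U = N}"
    from le1[OF this] show "(\<Sum>U\<in>F. exp (\<Psi> (cat U) + D)) \<le> 1"
      by (simp add: \<Psi>_def D_def algebra_simps)
  qed
  have "(\<lambda>n. (2 * \<bar>D\<bar> + ln (real (Suc N)) + real (2 * N + 5) * ln (real n + 1)) / real n) \<longlonglongrightarrow> 0"
    by real_asymp
  moreover have "ln (C n) = 2 * \<bar>D\<bar> + ln (real (Suc N)) + real (2 * N + 5) * ln (real n + 1)" for n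
    unfolding C_def by (simp add: ln_mult_pos ln_realpow add.commute del: power_Suc of_nat_Suc)
  ultimately have C': "(\<lambda>n. ln (C n) / real n) \<longlonglongrightarrow> 0" by (simp only:)
  let ?m = "prob {x \<in> X. x 0 = 1}" and ?p = "prob {x \<in> X. pre (length v) x = v}"
  have E: "expectation (\<lambda>x. \<Psi> (pre n x)) =
      s * expectation (\<lambda>x. real (occ v (pre n x))) - q * real n - t * (real n * ?m)" for n
  proof -
    note i = finite_valued_expectation(1)[OF finite_valued_pre[of n]]
    show ?thesis unfolding \<Psi>_def
      using i[of "\<lambda>w. real (occ v w)"] i[of "\<lambda>w. real (count_list w 1)"] expectation_ones[of n]
      by (simp add: prob_space)
  qed
  have "(\<lambda>n. s * (expectation (\<lambda>x. real (occ v (pre n x))) / real n) - q - t * ?m) \<longlonglongrightarrow> s * ?p - q - t * ?m"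
    by (intro tendsto_intros expectation_occ_limit)
  moreover have "\<forall>\<^sub>F n in sequentially. s * (expectation (\<lambda>x. real (occ v (pre n x))) / real n) - q - t * ?m =
      expectation (\<lambda>x. \<Psi> (pre n x)) / real n"
    using eventually_gt_at_top[of 0] by eventually_elim (simp add: E diff_divide_distrib)
  ultimately have J: "(\<lambda>n. expectation (\<lambda>x. \<Psi> (pre n x)) / real n) \<longlonglongrightarrow> s * ?p - q - t * ?m"
    by (rule Lim_transform_eventually)
  from ks_entropy_le_weights[OF C C' J] show ?thesis by (simp add: algebra_simps)
qed

end

section \<open>Block weights\<close>

definition wt :: "real \<Rightarrow> real \<Rightarrow> nat list \<Rightarrow> real" where
  "wt q t w = exp (- q * real (length w) - t * real (count_list w 1))"

lemma wt_pos: "wt q t w > 0"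
  by (simp add: wt_def)

lemma wt_nonneg [simp]: "wt q t w \<ge> 0"
  by (simp add: wt_def)

lemma wt_append: "wt q t (u @ v) = wt q t u * wt q t v"
  by (simp add: wt_def exp_add[symmetric] algebra_simps)

lemma wt_Nil [simp]: "wt q t [] = 1"
  by (simp add: wt_def)

lemma wt_zeros_ones: "wt q t (zeros_ones a b) = exp (- q) ^ a * exp (- (q + t)) ^ b"
  unfolding wt_def count_zeros_ones
  by (simp add: exp_add[symmetric] exp_of_nat_mult[symmetric] algebra_simps)

lemma summable_wt_zeros_ones:
  assumes "q > 0" "t \<ge> 0"
  shows "(\<lambda>i. wt q t (zeros_ones (fst i) (snd i))) summable_on B"
proof -
  let ?S = "\<lambda>n x. \<Sum>k\<le>n. (exp (- x) ^ k :: real)"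
  have geo: "?S n x \<le> 1 / (1 - exp (- x))" if "x > 0" for n :: nat and x :: real
    using sum_le_suminf[OF summable_geometric[of "exp (- x)"], of "{..n}"] that
    by (simp add: suminf_geometric)
  have "(\<lambda>i. wt q t (zeros_ones (fst i) (snd i))) summable_on UNIV"
  proof (rule nonneg_bdd_above_summable_on)
    show "bdd_above (sum (\<lambda>i. wt q t (zeros_ones (fst i) (snd i))) ` {F. F \<subseteq> UNIV \<and> finite F})"
    proof (rule bdd_aboveI2)
      fix F :: "(nat \<times> nat) set" assume "F \<in> {F. F \<subseteq> UNIV \<and> finite F}"
      then have fin: "finite F" by simp
      define n where "n = Max (fst ` F \<union> snd ` F)"
      have n: "fst i \<le> n" "snd i \<le> n" if "i \<in> F" for i
        using fin that unfolding n_def by (auto intro!: Max_ge)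
      then have "F \<subseteq> {..n} \<times> {..n}" by force
      then have "(\<Sum>i\<in>F. wt q t (zeros_ones (fst i) (snd i))) \<le> (\<Sum>i\<in>{..n} \<times> {..n}. wt q t (zeros_ones (fst i) (snd i)))"
        by (intro sum_mono2) auto
      also have "\<dots> = ?S n q * ?S n (q + t)"
        by (simp add: wt_zeros_ones sum_product sum.cartesian_product case_prod_unfold)
      also have "\<dots> \<le> 1 / (1 - exp (- q)) * (1 / (1 - exp (- (q + t))))"
        using assms by (intro mult_mono geo) (auto intro!: sum_nonneg)
      finally show "(\<Sum>i\<in>F. wt q t (zeros_ones (fst i) (snd i))) \<le> 1 / (1 - exp (- q)) * (1 / (1 - exp (- (q + t))))" .
    qed
  qed auto
  then show ?thesis by (rule summable_on_subset_banach) simp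
qed

lemma wt_blk: "wt q t (blk i) = exp (- q) * exp (- (q + t)) * wt q t (zeros_ones (fst i) (snd i))"
  by (simp add: blk_def wt_zeros_ones)

lemma summable_wt_blk:
  assumes "q > 0" "t \<ge> 0"
  shows "(\<lambda>i. wt q t (blk i)) summable_on B"
  unfolding wt_blk by (intro summable_on_cmult_right summable_wt_zeros_ones assms)

text \<open>Every block has at least two symbols; the factor is uniform over blocks, so it can push
  the whole block sum below one.\<close>

lemma wt_blk_mono: "q \<le> p \<Longrightarrow> wt p t (blk i) \<le> exp (- 2 * (p - q)) * wt q t (blk i)"
proof -
  assume "q \<le> p"
  then have "(p - q) * 2 \<le> (p - q) * real (length (blk i))"
    by (intro mult_left_mono) (auto simp: length_blk)
  then show ?thesis by (simp add: wt_def exp_add[symmetric] algebra_simps)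
qed

text \<open>\<open>Z\<close> is continuous on \<open>{q..}\<close> because the weights at
  \<open>q\<close> dominate those further right, and it falls from above one to at most one; the
  intermediate value theorem gives \<open>p\<close>.\<close>

lemma exists_unit_block_sum:
  assumes t: "t \<ge> 0" and q: "q > 0" and F: "finite F" "F \<subseteq> A" "(\<Sum>i\<in>F. wt q t (blk i)) > 1"
  shows "\<exists>p\<ge>q. ((\<lambda>i. wt p t (blk i)) has_sum 1) A"
proof -
  define Z where "Z p = (\<Sum>\<^sub>\<infinity>i\<in>A. wt p t (blk i))" for p
  have le: "wt p t (blk i) \<le> wt q t (blk i)" if "q \<le> p" for p i
  proof -
    have "wt p t (blk i) \<le> exp (- 2 * (p - q)) * wt q t (blk i)" by (rule wt_blk_mono[OF that])
    also have "\<dots> \<le> 1 * wt q t (blk i)" using that by (intro mult_right_mono) auto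
    finally show ?thesis by simp
  qed
  have "uniform_limit {q..} (\<lambda>F p. \<Sum>i\<in>F. wt p t (blk i)) Z (finite_subsets_at_top A)"
    unfolding Z_def
    by (rule Weierstrass_m_test_general[OF _ summable_wt_blk[OF q t]]) (use le in auto)
  then have cont: "continuous_on {q..} Z"
    by (rule uniform_limit_theorem[rotated]) (auto simp: wt_def intro!: always_eventually continuous_intros)
  have "1 < (\<Sum>i\<in>F. wt q t (blk i))" by fact
  also have "\<dots> \<le> Z q" unfolding Z_def by (rule finite_sum_le_infsum[OF summable_wt_blk[OF q t] F(1,2)]) auto
  finally have Zq: "Z q > 1" .
  \<comment> \<open>Moving right by \<open>Z q\<close> suffices: the sum shrinks by
    \<open>exp (- 2 * Z q)\<close> while \<open>Z q \<le> exp (Z q)\<close>.\<close>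
  define r where "r = q + Z q"
  have r: "q \<le> r" using Zq by (simp add: r_def)
  have "Z r \<le> (\<Sum>\<^sub>\<infinity>i\<in>A. exp (- 2 * (r - q)) * wt q t (blk i))"
    unfolding Z_def using r q
    by (intro infsum_mono summable_wt_blk summable_on_cmult_right wt_blk_mono t) auto
  also have "\<dots> = exp (- 2 * Z q) * Z q" by (simp add: infsum_cmult_right' r_def Z_def)
  also have "\<dots> \<le> exp (- 2 * Z q) * exp (Z q)"
    using exp_ge_add_one_self[of "Z q"] by (intro mult_left_mono) (linarith, simp)
  also have "\<dots> \<le> 1" using Zq by (simp add: exp_add[symmetric])
  finally have "Z r \<le> 1" .
  then obtain p where p: "q \<le> p" "Z p = 1"
    using IVT2'[of Z r 1 q] Zq r continuous_on_subset[OF cont, of "{q..r}"] by auto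
  have "((\<lambda>i. wt p t (blk i)) has_sum Z p) A"
    unfolding Z_def using p q t by (intro has_sum_infsum summable_wt_blk) auto
  then show ?thesis using p by auto
qed

section \<open>Small exponential tilts of a random variable\<close>

lemma abs_exp_minus_one_le: "\<bar>exp x - 1\<bar> \<le> \<bar>x\<bar> * exp \<bar>x\<bar>" for x :: real
proof (cases "x \<ge> 0")
  case True
  have "(1 - x) * exp x \<le> exp (- x) * exp x"
    using exp_ge_add_one_self[of "- x"] by (intro mult_right_mono) auto
  then show ?thesis using True by (simp add: exp_add[symmetric] algebra_simps)
next
  case False
  then have "1 - exp x \<le> - x" using exp_ge_add_one_self[of x] by linarith
  also have "\<dots> \<le> - x * exp (- x)" using False by (simp add: mult_le_cancel_left1)
  finally show ?thesis using False by simp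
qed

text \<open>The derivative of \<open>s \<mapsto> E (exp (s Y))\<close> at \<open>0\<close> is \<open>E Y\<close>.\<close>

lemma (in prob_space) exp_moment_le_1:
  fixes Y g :: "'a \<Rightarrow> real"
  assumes Y [measurable]: "Y \<in> borel_measurable M" and g [measurable]: "g \<in> borel_measurable M"
    and le: "\<And>x. \<bar>Y x\<bar> \<le> c * g x" and c: "c > 0" and g0: "\<And>x. g x \<ge> 0"
    and eta: "\<eta> > 0" and int: "integrable M (\<lambda>x. exp (\<eta> * g x))" and neg: "expectation Y < 0"
    and s1: "s1 > 0"
  shows "\<exists>s. 0 < s \<and> s < s1 \<and> integrable M (\<lambda>x. exp (s * Y x)) \<and> expectation (\<lambda>x. exp (s * Y x)) \<le> 1"
proof -
  \<comment> \<open>Half of \<open>s1\<close> for the strict bound;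
    \<open>s0 * c \<le> \<eta> / 2\<close> uses only half of the exponential moment and leaves the
    rest to absorb the linear factor in the difference quotient.\<close>
  define s0 where "s0 = min (s1 / 2) (\<eta> / (2 * c))"
  define s where "s n = s0 / real (Suc n)" for n
  have s0: "s0 > 0" using s1 eta c by (simp add: s0_def)
  have s: "0 < s n" "s n < s1" "s n * c \<le> \<eta> / 2" for n
  proof -
    show "0 < s n" using s0 by (simp add: s_def)
    have *: "s n \<le> s0" using s0 by (simp add: s_def divide_le_eq_1 field_simps)
    then show "s n < s1" using s1 by (simp add: s0_def)
    have "s n * c \<le> \<eta> / (2 * c) * c" using * c by (intro mult_right_mono) (auto simp: s0_def)
    then show "s n * c \<le> \<eta> / 2" using c by simp
  qed
  have sY: "\<bar>s n * Y x\<bar> \<le> \<eta> / 2 * g x" for n x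
  proof -
    have "\<bar>s n * Y x\<bar> = s n * \<bar>Y x\<bar>" using s(1)[of n] by (simp add: abs_mult)
    also have "\<dots> \<le> s n * (c * g x)" using s(1)[of n] le by (intro mult_left_mono) auto
    also have "\<dots> = s n * c * g x" by simp
    also have "\<dots> \<le> \<eta> / 2 * g x" using s(3) g0 by (intro mult_right_mono) auto
    finally show ?thesis .
  qed
  have int_exp: "integrable M (\<lambda>x. exp (s n * Y x))" for n
  proof (rule Bochner_Integration.integrable_bound[OF int])
    have "exp (s n * Y x) \<le> exp (\<eta> * g x)" for x
    proof -
      have "s n * Y x \<le> \<eta> / 2 * g x" using sY[of n x] by linarith
      also have "\<dots> \<le> \<eta> * g x" using eta g0[of x] by (intro mult_right_mono) auto
      finally show ?thesis by simp
    qed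
    then show "AE x in M. norm (exp (s n * Y x)) \<le> norm (exp (\<eta> * g x))" by simp
  qed measurable
  have g_le: "g x \<le> 2 / \<eta> * exp (\<eta> / 2 * g x)" for x
    using exp_ge_add_one_self[of "\<eta> / 2 * g x"] eta by (simp add: field_simps)
  have "(\<lambda>n. expectation (\<lambda>x. (exp (s n * Y x) - 1) / s n)) \<longlonglongrightarrow> expectation Y"
  proof (rule integral_dominated_convergence[where w = "\<lambda>x. c * (2 / \<eta>) * exp (\<eta> * g x)"])
    have "(\<lambda>n. s0 / real (Suc n)) \<longlonglongrightarrow> 0"
      using LIMSEQ_Suc[OF lim_const_over_n[of s0]] by simp
    then have s_lim: "s \<longlonglongrightarrow> 0" unfolding s_def .
    have "(\<lambda>n. (exp (s n * y) - 1) / s n) \<longlonglongrightarrow> y" for y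
    proof -
      have "((\<lambda>h. exp (h * y)) has_field_derivative exp (0 * y) * y) (at 0)"
        by (auto intro!: derivative_eq_intros)
      then have "(\<lambda>h. (exp (h * y) - 1) / h) \<midarrow>0\<rightarrow> y" by (simp add: DERIV_def)
      moreover have "filterlim s (at 0) sequentially"
        using s_lim s(1) by (auto simp: filterlim_at less_imp_neq[symmetric])
      ultimately show ?thesis by (rule filterlim_compose)
    qed
    then show "AE x in M. (\<lambda>n. (exp (s n * Y x) - 1) / s n) \<longlonglongrightarrow> Y x" by simp
    show "integrable M (\<lambda>x. c * (2 / \<eta>) * exp (\<eta> * g x))" by (intro integrable_mult_right int)
    show "AE x in M. norm ((exp (s n * Y x) - 1) / s n) \<le> c * (2 / \<eta>) * exp (\<eta> * g x)" for n
    proof (rule AE_I2)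
      fix x
      have "\<bar>exp (s n * Y x) - 1\<bar> \<le> \<bar>s n * Y x\<bar> * exp \<bar>s n * Y x\<bar>" by (rule abs_exp_minus_one_le)
      also have "\<dots> \<le> s n * (c * g x) * exp (\<eta> / 2 * g x)"
        using sY[of n x] s(1)[of n] le[of x] by (intro mult_mono) (auto simp: abs_mult)
      finally have "\<bar>exp (s n * Y x) - 1\<bar> / s n \<le> c * g x * exp (\<eta> / 2 * g x)"
        using s(1)[of n] by (simp add: field_simps)
      also have "\<dots> \<le> c * (2 / \<eta> * exp (\<eta> / 2 * g x)) * exp (\<eta> / 2 * g x)"
        using c g_le by (intro mult_right_mono mult_left_mono) auto
      also have "\<dots> = c * (2 / \<eta>) * exp (\<eta> * g x)"
        by (simp add: exp_add[symmetric] mult.assoc)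
      finally show "norm ((exp (s n * Y x) - 1) / s n) \<le> c * (2 / \<eta>) * exp (\<eta> * g x)"
        using s(1)[of n] by simp
    qed
  qed measurable
  \<comment> \<open>The difference quotients of the moment function at zero tend to a negative
    number, so one of them is negative and its moment is below one.\<close>
  from order_tendstoD(2)[OF this neg] obtain n where
    "expectation (\<lambda>x. (exp (s n * Y x) - 1) / s n) < 0" by (auto simp: eventually_sequentially)
  then have "(expectation (\<lambda>x. exp (s n * Y x)) - 1) / s n < 0"
    using int_exp[of n] by (simp add: prob_space)
  then have "expectation (\<lambda>x. exp (s n * Y x)) \<le> 1" using s(1)[of n] by (simp add: divide_less_0_iff)
  then show ?thesis using s int_exp by blast
qed

section \<open>Independent random blocks with weights of total mass one\<close>

locale unit_block_sum =
  fixes A :: "(nat \<times> nat) set" and p t :: real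
  assumes p: "p > 0" and t: "t \<ge> 0" and unit: "((\<lambda>i. wt p t (blk i)) has_sum 1) A"
begin

definition \<rho> :: "(nat \<times> nat) pmf" where
  "\<rho> = embed_pmf (\<lambda>i. if i \<in> A then wt p t (blk i) else 0)"

lemma nn_integral_wt:
  assumes "q > 0"
  shows "(\<integral>\<^sup>+i. ennreal (if i \<in> A then wt q t (blk i) else 0) \<partial>count_space UNIV) =
    ennreal (\<Sum>\<^sub>\<infinity>i\<in>A. wt q t (blk i))"
proof -
  have s: "Infinite_Set_Sum.abs_summable_on (\<lambda>i. wt q t (blk i)) A"
    using summable_wt_blk[OF assms t, of A] by (subst abs_summable_equivalent[symmetric]) simp
  have "(\<integral>\<^sup>+i. ennreal (if i \<in> A then wt q t (blk i) else 0) \<partial>count_space UNIV) =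
      (\<integral>\<^sup>+i. ennreal (wt q t (blk i)) * indicator A i \<partial>count_space UNIV)"
    by (intro nn_integral_cong) auto
  also have "\<dots> = (\<integral>\<^sup>+i. ennreal (wt q t (blk i)) \<partial>count_space A)"
    by (simp add: nn_integral_count_space_indicator)
  also have "\<dots> = ennreal (infsetsum (\<lambda>i. wt q t (blk i)) A)"
    by (rule nn_integral_conv_infsetsum[OF s]) simp
  also have "infsetsum (\<lambda>i. wt q t (blk i)) A = (\<Sum>\<^sub>\<infinity>i\<in>A. wt q t (blk i))"
    by (rule infsetsum_infsum[OF s])
  finally show ?thesis .
qed

lemma pmf_\<rho>: "pmf \<rho> i = (if i \<in> A then wt p t (blk i) else 0)"
  unfolding \<rho>_def
  by (rule pmf_embed_pmf) (use nn_integral_wt[OF p] infsumI[OF unit] in auto)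

text \<open>An exponential factor in the length lowers \<open>p\<close> to
  \<open>p - \<eta>\<close>, where the block weights are still summable. Block lengths thus have
  exponential tails.\<close>

lemma nn_integral_exp_length_blk:
  assumes "\<eta> < p"
  shows "(\<integral>\<^sup>+i. ennreal (exp (\<eta> * real (length (blk i)))) \<partial>measure_pmf \<rho>) < \<infinity>"
proof -
  have "(\<integral>\<^sup>+i. ennreal (exp (\<eta> * real (length (blk i)))) \<partial>measure_pmf \<rho>) =
      (\<integral>\<^sup>+i. ennreal (if i \<in> A then wt (p - \<eta>) t (blk i) else 0) \<partial>count_space UNIV)"
    unfolding nn_integral_measure_pmf pmf_\<rho>
    by (intro nn_integral_cong) (auto simp: wt_def ennreal_mult[symmetric] exp_add[symmetric] algebra_simps)
  then show ?thesis using nn_integral_wt[of "p - \<eta>"] assms by simp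
qed

abbreviation R :: "nat \<Rightarrow> (nat \<times> nat) list pmf" where
  "R N \<equiv> replicate_pmf N \<rho>"

lemma set_pmf_\<rho>: "set_pmf \<rho> = A"
  by (auto simp: set_pmf_eq pmf_\<rho> wt_pos less_imp_neq[symmetric])

lemma pmf_R: "U \<in> lists A \<Longrightarrow> pmf (R (length U)) U = wt p t (cat U)"
proof (induction U)
  case (Cons i U)
  have "R (Suc (length U)) = map_pmf (\<lambda>(i, U). i # U) (pair_pmf \<rho> (R (length U)))"
    by (simp add: map_pmf_def pair_pmf_def bind_assoc_pmf bind_return_pmf)
  then have "pmf (R (length (i # U))) (i # U) = pmf (pair_pmf \<rho> (R (length U))) (i, U)"
    using pmf_map_inj'[of "\<lambda>(i, U). i # U" "pair_pmf \<rho> (R (length U))" "(i, U)"]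
    by (simp add: inj_def split_beta prod_eq_iff)
  then show ?case using Cons by (simp add: pmf_pair pmf_\<rho> wt_append)
qed simp

lemma nn_integral_exp_length_cat:
  assumes "\<eta> < p"
  shows "(\<integral>\<^sup>+U. ennreal (exp (\<eta> * real (length (cat U)))) \<partial>measure_pmf (R N)) < \<infinity>"
proof (induction N)
  case (Suc N)
  have "(\<integral>\<^sup>+U. ennreal (exp (\<eta> * real (length (cat U)))) \<partial>measure_pmf (R (Suc N))) =
      (\<integral>\<^sup>+i. ennreal (exp (\<eta> * real (length (blk i)))) *
        (\<integral>\<^sup>+U. ennreal (exp (\<eta> * real (length (cat U)))) \<partial>measure_pmf (R N)) \<partial>measure_pmf \<rho>)"
    by (simp add: ennreal_mult exp_add distrib_left nn_integral_cmult)
  also have "\<dots> = (\<integral>\<^sup>+i. ennreal (exp (\<eta> * real (length (blk i)))) \<partial>measure_pmf \<rho>) *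
        (\<integral>\<^sup>+U. ennreal (exp (\<eta> * real (length (cat U)))) \<partial>measure_pmf (R N))"
    by (rule nn_integral_multc) simp
  also have "\<dots> < \<infinity>"
    using Suc nn_integral_exp_length_blk[OF assms] by (simp add: ennreal_mult_less_top)
  finally show ?case .
qed simp

lemma integrable_exp_length_cat:
  "\<eta> < p \<Longrightarrow> integrable (measure_pmf (R N)) (\<lambda>U. exp (\<eta> * real (length (cat U))))"
  using nn_integral_exp_length_cat[of \<eta> N] by (intro integrableI_bounded) auto

text \<open>Linear growth is dominated by an exponential moment of order \<open>p / 2\<close>,
  through \<open>x \<le> 2 / p * exp (p / 2 * x)\<close>.\<close>

lemma integrable_of_length_cat:
  fixes h :: "(nat \<times> nat) list \<Rightarrow> real"
  assumes "\<And>U. \<bar>h U\<bar> \<le> c * real (length (cat U))"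
  shows "integrable (measure_pmf (R N)) h"
proof (rule Bochner_Integration.integrable_bound)
  show "integrable (measure_pmf (R N)) (\<lambda>U. \<bar>c\<bar> * (2 / p) * exp (p / 2 * real (length (cat U))))"
    using p by (intro integrable_mult_right integrable_exp_length_cat) auto
  have "\<bar>h U\<bar> \<le> \<bar>c\<bar> * (2 / p) * exp (p / 2 * real (length (cat U)))" for U
  proof -
    have "\<bar>h U\<bar> \<le> \<bar>c\<bar> * real (length (cat U))"
      by (rule order_trans[OF assms]) (intro mult_right_mono, auto)
    also have "real (length (cat U)) \<le> 2 / p * exp (p / 2 * real (length (cat U)))"
      using exp_ge_add_one_self[of "p / 2 * real (length (cat U))"] p by (simp add: field_simps)
    finally show ?thesis by (simp add: mult_left_mono mult.assoc)
  qed
  then show "AE U in measure_pmf (R N). norm (h U) \<le> norm (\<bar>c\<bar> * (2 / p) * exp (p / 2 * real (length (cat U))))"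
    using p by (simp add: abs_mult)
qed auto

text \<open>With negative mean, a small tilt of \<open>Y\<close> has moment at most one; a finite
  sum of tilted weights is part of that moment, because \<open>wt p t\<close> of a concatenation is
  its probability under \<open>R N\<close>. The bound allows \<open>+ 1\<close> since
  \<open>Y\<close> may contain a constant.\<close>

lemma perturbed_block_sums_le_1:
  fixes Y :: "(nat \<times> nat) list \<Rightarrow> real"
  assumes le: "\<And>U. \<bar>Y U\<bar> \<le> c * (real (length (cat U)) + 1)" and c: "c > 0"
    and neg: "measure_pmf.expectation (R N) Y < 0" and s1: "s1 > 0"
  shows "\<exists>s. 0 < s \<and> s < s1 \<and> (\<forall>F. finite F \<longrightarrow> F \<subseteq> {U \<in> lists A. length U = N} \<longrightarrow>
    (\<Sum>U\<in>F. wt p t (cat U) * exp (s * Y U)) \<le> 1)"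
proof -
  have "integrable (measure_pmf (R N)) (\<lambda>U. exp (p / 2) * exp (p / 2 * real (length (cat U))))"
    using p by (intro integrable_mult_right integrable_exp_length_cat) auto
  then have int: "integrable (measure_pmf (R N)) (\<lambda>U. exp (p / 2 * (real (length (cat U)) + 1)))"
    by (simp add: exp_add[symmetric] distrib_left add.commute)
  obtain s where s: "0 < s" "s < s1" and ints: "integrable (measure_pmf (R N)) (\<lambda>U. exp (s * Y U))"
    and E: "measure_pmf.expectation (R N) (\<lambda>U. exp (s * Y U)) \<le> 1"
    using measure_pmf.exp_moment_le_1[OF _ _ le c _ _ int neg s1] p by auto
  have "(\<Sum>U\<in>F. wt p t (cat U) * exp (s * Y U)) \<le> 1"
    if F: "finite F" "F \<subseteq> {U \<in> lists A. length U = N}" for F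
  proof -
    have "(\<Sum>U\<in>F. wt p t (cat U) * exp (s * Y U)) = (\<Sum>U\<in>F. (indicator F U * exp (s * Y U)) * pmf (R N) U)"
    proof (intro sum.cong refl)
      fix U assume "U \<in> F"
      then show "wt p t (cat U) * exp (s * Y U) = (indicator F U * exp (s * Y U)) * pmf (R N) U"
        using subsetD[OF F(2)] pmf_R[of U] by (simp add: Cons_in_lists_iff)
    qed
    also have "\<dots> = measure_pmf.expectation (R N) (\<lambda>U. indicator F U * exp (s * Y U))"
      by (rule integral_measure_pmf_real[symmetric, OF F(1)]) (auto simp: indicator_eq_0_iff)
    also have "\<dots> \<le> measure_pmf.expectation (R N) (\<lambda>U. exp (s * Y U))"
      by (intro integral_mono integrable_real_mult_indicator[OF _ ints, simplified mult.commute] ints)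
        (auto simp: indicator_def)
    also have "\<dots> \<le> 1" by (rule E)
    finally show ?thesis .
  qed
  then show ?thesis using s by blast
qed

text \<open>This linear growth in \<open>N\<close> is what makes the fixed junction error
  negligible.\<close>

lemma expectation_length_cat_ge:
  "measure_pmf.expectation (R N) (\<lambda>U. real (length (cat U))) \<ge> real N"
proof -
  have "measure_pmf.expectation (R N) (\<lambda>U. real (length (cat U))) \<ge> measure_pmf.expectation (R N) (\<lambda>U. real N)"
  proof (rule integral_mono_AE)
    have "real N \<le> real (length (cat U))" if "U \<in> set_pmf (R N)" for U
      using that length_le_length_cat[of U] by (simp add: set_replicate_pmf)
    then show "AE U in measure_pmf (R N). real N \<le> real (length (cat U))"
      by (simp add: AE_measure_pmf_iff)
  qed (auto intro!: integrable_of_length_cat[of _ 1])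
  then show ?thesis by simp
qed

end

context block_shift
begin

text \<open>The untilted case \<open>s = 0\<close> with chunks of one block; any nonempty word could
  stand for \<open>[1]\<close>, as its occurrences get coefficient zero.\<close>

lemma ks_entropy_le_pressure:
  assumes M: "M \<in> invariant_measures X" and q: "q \<ge> 0" and t: "t \<ge> 0"
    and le1: "\<And>F. finite F \<Longrightarrow> F \<subseteq> A \<Longrightarrow> (\<Sum>i\<in>F. wt q t (blk i)) \<le> 1"
  shows "ks_entropy M shift_map \<le> ereal (q + t * measure M {x \<in> X. x 0 = 1})"
proof -
  let ?s = "\<lambda>F. \<Sum>U\<in>F. exp (0 * real (occ [1] (cat U)) + max 0 0 * real (length [1 :: nat])
    - q * real (length (cat U)) - t * real (count_list (cat U) 1))"
  have "ks_entropy M shift_map \<le> ereal (q + t * measure M {x \<in> X. x 0 = 1}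
    - 0 * measure M {x \<in> X. pre (length [1 :: nat]) x = [1]})"
  proof (rule ks_entropy_le_block_sums[OF M, where N = 1])
    fix F assume F: "finite F" "F \<subseteq> {U \<in> lists A. length U = 1}"
    have sing: "\<exists>i\<in>A. U = [i]" if "U \<in> F" for U
    proof -
      have "length U = 1" "U \<in> lists A" using F(2) that by auto
      then show ?thesis by (cases U) auto
    qed
    have "?s F = (\<Sum>U\<in>F. wt q t (blk (hd U)))"
      by (intro sum.cong refl) (auto simp: wt_def dest!: sing)
    also have "\<dots> = (\<Sum>i\<in>hd ` F. wt q t (blk i))"
    proof -
      have "inj_on hd F" by (rule inj_onI) (auto dest!: sing)
      then show ?thesis by (simp add: sum.reindex)
    qed
    also have "\<dots> \<le> 1"
      using F(1) by (intro le1) (auto dest!: sing)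
    finally show "?s F \<le> 1" .
  qed (use q t in auto)
  then show ?thesis by simp
qed

end

section \<open>Uniqueness of the equilibrium state\<close>

locale unit_block_shift = block_shift A X + unit_block_sum A p t for A X p t
begin

text \<open>
  The frequency of a word under an equilibrium state is squeezed between its expected numbers of
  occurrences in \<open>N\<close> independent blocks, with and without those that overlap the end.
\<close>

lemma equilibrium_frequency_bounds:
  fixes v :: "nat list"
  assumes M: "M \<in> invariant_measures X" and v: "v \<noteq> []" and N: "N \<ge> 1"
    and eq: "ks_entropy M shift_map \<ge> ereal (p + t * measure M {x \<in> X. x 0 = 1})"
  defines "l \<equiv> measure_pmf.expectation (R N) (\<lambda>U. real (length (cat U)))"
    and "e \<equiv> measure_pmf.expectation (R N) (\<lambda>U. real (occ v (cat U)))"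
    and "m \<equiv> measure M {x \<in> X. pre (length v) x = v}"
  shows "e \<le> l * m" "l * m \<le> e + real (length v)"
proof -
  interpret binary_shift_measure X M by (rule binary_shift_measureI[OF M])
  have l: "l > 0" using expectation_length_cat_ge[of N] N by (simp add: l_def)
  have int_l: "integrable (measure_pmf (R N)) (\<lambda>U. real (length (cat U)))"
    by (rule integrable_of_length_cat[of _ 1]) simp
  have int_e: "integrable (measure_pmf (R N)) (\<lambda>U. real (occ v (cat U)))"
    by (rule integrable_of_length_cat[of _ 1]) (simp add: occ_le_length[OF v])
  have occ: "real (occ v (cat U)) \<le> real (length (cat U))" for U
    using occ_le_length[OF v] by simp
  show "l * m \<le> e + real (length v)"
  proof (rule ccontr)
    assume "\<not> l * m \<le> e + real (length v)"
    then have "(e + real (length v)) / l < m" using l by (simp add: field_simps)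
    \<comment> \<open>A value strictly between the claimed bound and \<open>m\<close> fixes the
      tilt: each unit of length is charged \<open>m'\<close>, less than the gain \<open>m\<close>
      per unit of length under \<open>M\<close>.\<close>
    then obtain m' where m': "(e + real (length v)) / l < m'" "m' < m" using dense by blast
    have "(e + real (length v)) / l \<ge> 0" using l by (auto simp: e_def)
    then have m'0: "m' \<ge> 0" using m' by linarith
    \<comment> \<open>The constant \<open>length v\<close> prepays the occurrences across a junction
      next to the chunk, as positive \<open>s\<close> demands.\<close>
    define Y where "Y U = real (occ v (cat U)) + real (length v) - m' * real (length (cat U))" for U
    have "measure_pmf.expectation (R N) Y = e + real (length v) - m' * l"
      unfolding Y_def e_def l_def using int_l int_e by simp
    also have "\<dots> < 0" using m'(1) l by (simp add: field_simps)
    finally have neg: "measure_pmf.expectation (R N) Y < 0" .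
    have "\<bar>Y U\<bar> \<le> (1 + real (length v) + m') * (real (length (cat U)) + 1)" for U
    proof -
      have "\<bar>Y U\<bar> \<le> real (length (cat U)) + real (length v) + m' * real (length (cat U))"
      proof -
        have "0 \<le> m' * real (length (cat U))" using m'0 by simp
        then show ?thesis using occ[of U] unfolding Y_def by linarith
      qed
      also have "\<dots> \<le> (1 + real (length v) + m') * (real (length (cat U)) + 1)"
        using m'0 by (simp add: algebra_simps)
      finally show ?thesis .
    qed
    from perturbed_block_sums_le_1[OF this _ neg p] m'0 obtain s where s: "0 < s" "s < p" and
      F: "\<And>F. finite F \<Longrightarrow> F \<subseteq> {U \<in> lists A. length U = N} \<Longrightarrow> (\<Sum>U\<in>F. wt p t (cat U) * exp (s * Y U)) \<le> 1"
      by auto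
    \<comment> \<open>The tilt replaces \<open>p\<close> by \<open>p + s * m' - s * m < p\<close>,
      against the assumed lower bound; \<open>s < p\<close> secures
      \<open>s \<le> p + s * m'\<close>.\<close>
    have "ks_entropy M shift_map \<le> ereal ((p + s * m') + t * measure M {x \<in> X. x 0 = 1} - s * m)"
      unfolding m_def
    proof (rule ks_entropy_le_block_sums[OF M _ _ t v N])
      fix F' assume "finite F'" "F' \<subseteq> {U \<in> lists A. length U = N}"
      from F[OF this] show "(\<Sum>U\<in>F'. exp (s * real (occ v (cat U)) + max 0 s * real (length v)
        - (p + s * m') * real (length (cat U)) - t * real (count_list (cat U) 1))) \<le> 1"
        using s by (simp add: wt_def Y_def exp_add[symmetric] algebra_simps)
    next
      show "0 \<le> p + s * m'" "s \<le> p + s * m'" using p s m'0 by (simp_all add: add_increasing2)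
    qed
    with eq have "ereal (p + t * prob {x \<in> X. x 0 = 1}) \<le>
      ereal ((p + s * m') + t * measure M {x \<in> X. x 0 = 1} - s * m)" by (rule order_trans)
    then have "s * m \<le> s * m'" by simp
    then show False using s m'(2) by simp
  qed
  show "e \<le> l * m"
  proof (rule ccontr)
    assume "\<not> e \<le> l * m"
    then have "m < e / l" using l by (simp add: field_simps)
    then obtain m' where m': "m < m'" "m' < e / l" using dense by blast
    have m'0: "m' > 0" using m'(1) measure_nonneg[of M] unfolding m_def by (rule le_less_trans[rotated])
    \<comment> \<open>Now occurrences are penalized, so junctions cost nothing and no
      \<open>length v\<close> appears; \<open>s < p / m'\<close> below keeps
      \<open>p - s * m'\<close> positive.\<close>
    define Y where "Y U = m' * real (length (cat U)) - real (occ v (cat U))" for U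
    have "measure_pmf.expectation (R N) Y = m' * l - e"
      unfolding Y_def e_def l_def using int_l int_e by simp
    also have "\<dots> < 0" using m'(2) l by (simp add: field_simps)
    finally have neg: "measure_pmf.expectation (R N) Y < 0" .
    have "\<bar>Y U\<bar> \<le> (1 + m') * (real (length (cat U)) + 1)" for U
    proof -
      have "\<bar>Y U\<bar> \<le> m' * real (length (cat U)) + real (length (cat U))"
      proof -
        have "0 \<le> m' * real (length (cat U))" using m'0 by simp
        then show ?thesis using occ[of U] unfolding Y_def by linarith
      qed
      also have "\<dots> \<le> (1 + m') * (real (length (cat U)) + 1)"
        using m'0 by (simp add: algebra_simps)
      finally show ?thesis .
    qed
    from perturbed_block_sums_le_1[OF this _ neg, of "p / m'"] m'0 p obtain s where s: "0 < s" "s < p / m'" and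
      F: "\<And>F. finite F \<Longrightarrow> F \<subseteq> {U \<in> lists A. length U = N} \<Longrightarrow> (\<Sum>U\<in>F. wt p t (cat U) * exp (s * Y U)) \<le> 1"
      by auto
    have sm: "s * m' < p" using s m'0 by (simp add: field_simps)
    have "ks_entropy M shift_map \<le> ereal ((p - s * m') + t * measure M {x \<in> X. x 0 = 1} - (- s) * m)"
      unfolding m_def
    proof (rule ks_entropy_le_block_sums[OF M _ _ t v N])
      fix F' assume "finite F'" "F' \<subseteq> {U \<in> lists A. length U = N}"
      from F[OF this] show "(\<Sum>U\<in>F'. exp (- s * real (occ v (cat U)) + max 0 (- s) * real (length v)
        - (p - s * m') * real (length (cat U)) - t * real (count_list (cat U) 1))) \<le> 1"
        using s by (simp add: wt_def Y_def exp_add[symmetric] algebra_simps)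
    qed (use sm s in auto)
    with eq have "ereal (p + t * prob {x \<in> X. x 0 = 1}) \<le>
      ereal ((p - s * m') + t * measure M {x \<in> X. x 0 = 1} - (- s) * m)" by (rule order_trans)
    then have "s * m' \<le> s * m" by simp
    then show False using s m'(1) by simp
  qed
qed

text \<open>\<open>l\<close> and \<open>e\<close> depend on \<open>A\<close>, \<open>p\<close>,
  \<open>t\<close>, \<open>N\<close> and \<open>v\<close> but not on the measure, so the frequencies
  under \<open>M\<close> and \<open>M'\<close> differ by at most \<open>length v / l\<close> for
  every positive \<open>N\<close>.\<close>

lemma equilibrium_unique:
  assumes M: "M \<in> invariant_measures X" and M': "M' \<in> invariant_measures X"
    and eq: "ks_entropy M shift_map \<ge> ereal (p + t * measure M {x \<in> X. x 0 = 1})"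
    and eq': "ks_entropy M' shift_map \<ge> ereal (p + t * measure M' {x \<in> X. x 0 = 1})"
  shows "M = M'"
proof (rule invariant_measure_eqI[OF binary_shift_measureI[OF M] binary_shift_measureI[OF M']])
  fix v :: "nat list" assume v: "v \<noteq> []"
  let ?m = "measure M {x \<in> X. pre (length v) x = v}" and ?m' = "measure M' {x \<in> X. pre (length v) x = v}"
  have bound: "real N * \<bar>?m - ?m'\<bar> \<le> real (length v)" for N
  proof (cases "N \<ge> 1")
    case True
    let ?l = "measure_pmf.expectation (R N) (\<lambda>U. real (length (cat U)))"
    have "real N * \<bar>?m - ?m'\<bar> \<le> ?l * \<bar>?m - ?m'\<bar>"
      by (intro mult_right_mono expectation_length_cat_ge) auto
    also have "\<dots> = \<bar>?l * ?m - ?l * ?m'\<bar>"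
      using expectation_length_cat_ge[of N] by (simp add: abs_mult right_diff_distrib[symmetric])
    also have "\<dots> \<le> real (length v)"
      using equilibrium_frequency_bounds[OF M v True eq] equilibrium_frequency_bounds[OF M' v True eq']
      by linarith
    finally show ?thesis .
  next
    case False
    then have "N = 0" by simp
    then show ?thesis by simp
  qed
  show "?m = ?m'"
  proof (rule ccontr)
    assume "?m \<noteq> ?m'"
    then obtain N where "real (length v) < real N * \<bar>?m - ?m'\<bar>"
      using reals_Archimedean3[of "\<bar>?m - ?m'\<bar>"] by auto
    with bound[of N] show False by linarith
  qed
qed

end

section \<open>Existence of an equilibrium state\<close>

text \<open>Blocks are nonempty, so the first \<open>n + 1\<close> of them reach position
  \<open>n\<close>; by \<open>unroll_eq\<close> any other number of blocks that reaches it reads the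
  same symbol.\<close>

definition unroll :: "(nat \<times> nat) stream \<Rightarrow> nat \<Rightarrow> nat" where
  "unroll s n = cat (stake (Suc n) s) ! n"

lemma unroll_eq:
  assumes "n < length (cat (stake m s))"
  shows "unroll s n = cat (stake m s) ! n"
proof -
  have prefix: "\<exists>u. cat (stake (k + l) s) = cat (stake k s) @ u" for k l
    using arg_cong[OF stake_add[of k s l], of cat] by (metis concat_append map_append)
  have n: "n < length (cat (stake (Suc n) s))"
    using length_le_length_cat[of "stake (Suc n) s"] by simp
  show ?thesis
  proof (cases "m \<le> Suc n")
    case True
    then obtain u where "cat (stake (Suc n) s) = cat (stake m s) @ u"
      using prefix[of m "Suc n - m"] by auto
    then show ?thesis using assms by (simp add: unroll_def nth_append)
  next
    case False
    then obtain u where "cat (stake m s) = cat (stake (Suc n) s) @ u"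
      using prefix[of "Suc n" "m - Suc n"] by auto
    then show ?thesis using n by (simp add: unroll_def nth_append del: stake.simps)
  qed
qed

lemma unroll_shd:
  assumes "n < length (blk (shd s))"
  shows "unroll s n = blk (shd s) ! n"
  using unroll_eq[of n 1 s] assms by simp

lemma unroll_stl: "unroll s (length (blk (shd s)) + n) = unroll (stl s) n"
proof -
  have n: "n < length (cat (stake (Suc n) (stl s)))"
    using length_le_length_cat[of "stake (Suc n) (stl s)"] by simp
  have "unroll s (length (blk (shd s)) + n) = cat (stake (Suc (Suc n)) s) ! (length (blk (shd s)) + n)"
    using n by (intro unroll_eq) simp
  then show ?thesis by (simp add: unroll_def nth_append)
qed

lemma nth_blk: "n < length (blk i) \<Longrightarrow> blk i ! n = (if n \<le> fst i then 0 else 1)"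
  by (auto simp: blk_def zeros_ones_def nth_append simp del: replicate_Suc)

lemma unroll_0: "unroll s 0 = 0"
  by (subst unroll_shd) (auto simp: nth_blk length_blk)

text \<open>The third clause is the opening zero of the second block: it shows where the first block
  ends, so the first block can be read off the sequence.\<close>

lemma unroll_cases:
  "n \<le> fst (shd s) \<Longrightarrow> unroll s n = 0"
  "fst (shd s) < n \<Longrightarrow> n \<le> fst (shd s) + snd (shd s) + 1 \<Longrightarrow> unroll s n = 1"
  "unroll s (fst (shd s) + snd (shd s) + 2) = 0"
  using unroll_stl[of s 0] unroll_0[of "stl s"]
  by (auto simp: unroll_shd nth_blk length_blk)

lemma zeros_ones_inject: "zeros_ones a b = zeros_ones c d \<longleftrightarrow> a = c \<and> b = d"
  by (metis add_right_cancel count_zeros_ones length_zeros_ones)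

lemma blk_inject: "blk i = blk j \<longleftrightarrow> i = j"
  by (auto simp: blk_def zeros_ones_inject prod_eq_iff)

definition shifted :: "nat \<Rightarrow> (nat \<Rightarrow> nat) \<Rightarrow> nat \<Rightarrow> nat" where
  "shifted j x = (\<lambda>k. x (j + k))"

lemma shifted_measurable [measurable]: "shifted j \<in> borel \<rightarrow>\<^sub>M borel"
  unfolding shifted_def
  by (intro measurable_coordinatewise_then_product borel_measurable_continuous_onI continuous_on_product_coordinates)

lemma shift_map_eq_shifted: "shift_map = shifted 1"
  by (auto simp: shifted_def shift_map_def)

lemma cylinder_borel [measurable]: "{x :: nat \<Rightarrow> nat. pre k x = w} \<in> sets borel"
proof -
  have "{x :: nat \<Rightarrow> nat. pre k x = w} = {x \<in> UNIV. pre k x \<in> {w}}" by simp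
  moreover have "\<dots> \<in> sets (restrict_space borel (UNIV :: (nat \<Rightarrow> nat) set))"
    unfolding sets_restrict_borel_cylinders[OF closed_UNIV] by (rule sigma_sets.Basic) blast
  ultimately show ?thesis by (simp add: sets_restrict_space)
qed

section \<open>The law of the concatenated stream of blocks\<close>

context unit_block_sum
begin

abbreviation S :: "(nat \<times> nat) stream measure" where
  "S \<equiv> stream_space (measure_pmf \<rho>)"

lemma prob_S: "prob_space S"
  by (rule prob_space.prob_space_stream_space[OF prob_space_measure_pmf])

lemma sets_S: "sets S = sets (stream_space (count_space UNIV))"
  by (rule sets_stream_space_cong) simp

lemma space_S [simp]: "space S = UNIV"
  by (simp add: space_stream_space)

lemma shd_measurable_S [measurable]: "shd \<in> S \<rightarrow>\<^sub>M count_space UNIV"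
  by (subst measurable_cong_sets[OF sets_S refl]) measurable

lemma stl_measurable_S [measurable]: "stl \<in> S \<rightarrow>\<^sub>M S"
  by measurable

lemma unroll_measurable [measurable]: "unroll \<in> S \<rightarrow>\<^sub>M borel"
proof (rule measurable_coordinatewise_then_product)
  fix n
  have "stake (Suc n) \<in> S \<rightarrow>\<^sub>M count_space UNIV"
    by (subst measurable_cong_sets[OF sets_S refl]) (rule measurable_stake)
  then show "(\<lambda>s. unroll s n) \<in> borel_measurable S"
    unfolding unroll_def by (rule measurable_compose) (simp add: measurable_count_space_eq1)
qed

lemma nn_integral_stl: 
  assumes [measurable]: "f \<in> borel_measurable S"
  shows "(\<integral>\<^sup>+s. indicator (shd -` {i}) s * f (stl s) \<partial>S) = ennreal (pmf \<rho> i) * (\<integral>\<^sup>+s. f s \<partial>S)"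
proof -
  have "(\<integral>\<^sup>+s. indicator (shd -` {i}) s * f (stl s) \<partial>S) = (\<integral>\<^sup>+x. \<integral>\<^sup>+s. indicator {i} x * f s \<partial>S \<partial>measure_pmf \<rho>)"
    by (subst prob_space.nn_integral_stream_space[OF prob_space_measure_pmf]) (auto intro!: nn_integral_cong simp: indicator_def)
  also have "\<dots> = (\<integral>\<^sup>+x. (\<integral>\<^sup>+s. f s \<partial>S) * indicator {i} x \<partial>measure_pmf \<rho>)"
    by (intro nn_integral_cong) (simp add: nn_integral_cmult mult.commute[of "\<integral>\<^sup>+s. f s \<partial>S"])
  also have "\<dots> = ennreal (pmf \<rho> i) * (\<integral>\<^sup>+s. f s \<partial>S)"
    by (subst nn_integral_cmult_indicator) (auto simp: emeasure_pmf_single mult.commute)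
  finally show ?thesis .
qed

lemma emeasure_shd_stl:
  assumes [measurable]: "B \<in> sets S"
  shows "emeasure S {s. shd s = i \<and> stl s \<in> B} = ennreal (pmf \<rho> i) * emeasure S B"
proof -
  have "{s. shd s = i \<and> stl s \<in> B} = shd -` {i} \<inter> space S \<inter> (stl -` B \<inter> space S)" by auto
  also have "\<dots> \<in> sets S" by measurable
  finally have "emeasure S {s. shd s = i \<and> stl s \<in> B} = (\<integral>\<^sup>+s. indicator {s. shd s = i \<and> stl s \<in> B} s \<partial>S)"
    by (rule nn_integral_indicator[symmetric])
  also have "\<dots> = (\<integral>\<^sup>+s. indicator (shd -` {i}) s * indicator B (stl s) \<partial>S)"
    by (intro nn_integral_cong) (auto simp: indicator_def)
  also have "\<dots> = ennreal (pmf \<rho> i) * emeasure S B"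
    by (subst nn_integral_stl) auto
  finally show ?thesis .
qed

lemma emeasure_shd: "emeasure S {s. shd s \<in> B} = emeasure (measure_pmf \<rho>) B"
proof -
  have m: "{s. shd s \<in> B} \<in> sets S"
    using measurable_sets[OF shd_measurable_S, of B] by (simp add: vimage_def)
  interpret S: prob_space S by (rule prob_S)
  show ?thesis
    using S.emeasure_space_1
    by (subst prob_space.emeasure_stream_space[OF prob_space_measure_pmf m]) (simp add: indicator_def nn_integral_indicator[symmetric] if_distrib cong: if_cong, auto intro!: nn_integral_cong simp: indicator_def)
qed

lemma emeasure_stl:
  assumes [measurable]: "B \<in> sets S"
  shows "emeasure S {s. stl s \<in> B} = emeasure S B"
proof -
  have m: "{s. stl s \<in> B} \<in> sets S"
    using measurable_sets[OF stl_measurable_S assms] by (simp add: vimage_def)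
  show ?thesis
    by (subst prob_space.emeasure_stream_space[OF prob_space_measure_pmf m]) simp
qed

text \<open>The total weight of all words 0^c 1^d, zero exponents included. It bounds the ways to
  complete a truncated block and, later, the part of the first block to the left of the
  origin.\<close>

definition K :: real where
  "K = (\<Sum>\<^sub>\<infinity>i. wt p t (zeros_ones (fst i) (snd i)))"

lemma sum_le_K: "finite F \<Longrightarrow> (\<Sum>i\<in>F. wt p t (zeros_ones (fst i) (snd i))) \<le> K"
  unfolding K_def using p t by (intro finite_sum_le_infsum summable_wt_zeros_ones) auto

lemma K_ge_1: "K \<ge> 1"
  using sum_le_K[of "{(0, 0)}"] by simp

text \<open>\<open>blk\<close> is injective, so different blocks complete \<open>v\<close>
  differently; multiplicativity of \<open>wt\<close> factors out \<open>v\<close>, and the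
  completions weigh at most \<open>K\<close> together.\<close>

lemma prob_blk_extends_le:
  assumes B: "\<And>i. i \<in> B \<Longrightarrow> \<exists>c d. blk i = v @ zeros_ones c d"
  shows "emeasure (measure_pmf \<rho>) B \<le> ennreal (K * wt p t v)"
proof -
  have "\<exists>g. \<forall>i\<in>B. blk i = v @ zeros_ones (fst (g i)) (snd (g i))"
    using B by (intro bchoice) (metis fst_conv snd_conv)
  then obtain g where g: "\<And>i. i \<in> B \<Longrightarrow> blk i = v @ zeros_ones (fst (g i)) (snd (g i))" by blast
  have inj: "inj_on g B" using g blk_inject by (metis inj_onI)
  have s: "Infinite_Set_Sum.abs_summable_on (pmf \<rho>) B" by (rule pmf_abs_summable)
  have "measure (measure_pmf \<rho>) B = infsum (pmf \<rho>) B"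
    by (simp add: measure_pmf_conv_infsetsum infsetsum_infsum[OF s])
  also have "\<dots> \<le> K * wt p t v"
  proof (rule infsum_le_finite_sums)
    show "pmf \<rho> summable_on B"
      using s abs_summable_equivalent abs_summable_summable by blast
    fix F assume F: "finite F" "F \<subseteq> B"
    have "sum (pmf \<rho>) F \<le> (\<Sum>i\<in>F. wt p t (zeros_ones (fst (g i)) (snd (g i))) * wt p t v)"
      using F g by (intro sum_mono) (auto simp: pmf_\<rho> wt_append subset_iff)
    also have "\<dots> = (\<Sum>i\<in>g ` F. wt p t (zeros_ones (fst i) (snd i))) * wt p t v"
      using inj_on_subset[OF inj F(2)] by (simp add: sum.reindex sum_distrib_right)
    also have "\<dots> \<le> K * wt p t v" using F by (intro mult_right_mono sum_le_K) auto
    finally show "sum (pmf \<rho>) F \<le> K * wt p t v" .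
  qed
  finally show ?thesis
    by (simp add: measure_pmf.emeasure_eq_measure ennreal_leI)
qed

lemma unroll_starts_measurable [measurable]: "{s. pre n (unroll s) = v} \<in> sets S"
  using measurable_sets[OF unroll_measurable cylinder_borel[of n v]] by (simp add: vimage_def)

lemma pre_eq_iff: "pre (length v) x = v \<longleftrightarrow> (\<forall>n<length v. x n = v ! n)"
  by (auto simp: list_eq_iff_nth_eq)

text \<open>
  Unique decipherability makes the recursion deterministic except in the last block of \<open>v\<close>,
  which may be completed arbitrarily.
\<close>

lemma emeasure_unroll_starts_le:
  assumes "set v \<subseteq> {0, 1}"
  shows "emeasure S {s. pre (length v) (unroll s) = v} \<le> ennreal (K * wt p t v)"
  using assms
proof (induction "length v" arbitrary: v rule: less_induct)
  case less
  interpret S: prob_space S by (rule prob_S)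
  show ?case
  proof (cases "v = [] \<or> hd v \<noteq> 0")
    case True
    show ?thesis
    proof (cases "v = []")
      case True
      then have "emeasure S {s. pre (length v) (unroll s) = v} \<le> 1" by (simp add: S.emeasure_le_1)
      also have "1 \<le> ennreal (K * wt p t v)" using K_ge_1 True by simp
      finally show ?thesis .
    next
      case False
      have "pre (length v) (unroll s) \<noteq> v" for s
        using False True unroll_0[of s] nth_pre[of 0 "length v" "unroll s"] by (metis hd_conv_nth length_greater_0_conv)
      then show ?thesis by simp
    qed
  next
    case False
    then obtain v0 where v0: "v = 0 # v0" by (cases v) auto
    \<comment> \<open>\<open>v\<close> is cut as 0^(a+1) 1^b followed by \<open>v2\<close>, which is
      empty or starts with the zero of a new block; only in the latter case is the first block known
      to be complete.\<close>
    define a where "a = length (takeWhile (\<lambda>c. c = 0) v0)"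
    define v1 where "v1 = dropWhile (\<lambda>c. c = 0) v0"
    define b where "b = length (takeWhile (\<lambda>c. c = 1) v1)"
    define v2 where "v2 = dropWhile (\<lambda>c. c = 1) v1"
    have rep: "takeWhile (\<lambda>c. c = (k :: nat)) w = replicate (length (takeWhile (\<lambda>c. c = k) w)) k" for k w
      by (rule replicate_length_same[symmetric]) (auto dest: set_takeWhileD)
    have v: "v = zeros_ones (Suc a) b @ v2"
    proof -
      have "v0 = replicate a 0 @ v1"
        using takeWhile_dropWhile_id[of "\<lambda>c. c = 0" v0] rep[of 0 v0]
        unfolding a_def v1_def by argo
      moreover have "v1 = replicate b 1 @ v2"
        using takeWhile_dropWhile_id[of "\<lambda>c. c = 1" v1] rep[of 1 v1]
        unfolding b_def v2_def by argo
      ultimately show ?thesis by (simp add: v0 zeros_ones_def)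
    qed
    have hd1: "v1 = [] \<or> hd v1 = 1"
    proof -
      have "hd v1 \<noteq> 0" if "v1 \<noteq> []" using that hd_dropWhile[of "\<lambda>c. c = 0" v0] by (simp add: v1_def)
      moreover have "set v1 \<subseteq> {0, 1}" using less.prems set_dropWhileD by (fastforce simp: v0 v1_def)
      ultimately show ?thesis by (metis hd_in_set insertE singletonD subset_iff)
    qed
    have hd2: "v2 = [] \<or> (hd v2 = 0 \<and> b \<ge> 1)"
    proof -
      have "hd v2 \<noteq> 1" if "v2 \<noteq> []" using that hd_dropWhile[of "\<lambda>c. c = 1" v1] by (simp add: v2_def)
      moreover have "set v2 \<subseteq> {0, 1}" using less.prems by (auto simp: v)
      moreover have "b \<ge> 1" if "v2 \<noteq> []"
      proof -
        have "v1 \<noteq> []" using that by (auto simp: v2_def)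
        then show ?thesis using hd1 by (cases v1) (auto simp: b_def)
      qed
      ultimately show ?thesis by (metis hd_in_set insertE singletonD subset_iff)
    qed
    have zeros: "unroll s n = 0" if s: "pre (length v) (unroll s) = v" and "n \<le> a" for s n
    proof -
      have "unroll s n = v ! n" using s that(2) unfolding pre_eq_iff by (auto simp: v)
      then show ?thesis using that(2) by (simp add: v zeros_ones_def nth_append del: replicate_Suc)
    qed
    have ones: "unroll s n = 1" if s: "pre (length v) (unroll s) = v" and "a < n" "n \<le> a + b" for s n
    proof -
      have "unroll s n = v ! n" using s that(2,3) unfolding pre_eq_iff by (auto simp: v)
      moreover have "\<not> n - Suc 0 < a" "n - Suc a < b" using that(2,3) by auto
      ultimately show ?thesis using that(2,3) by (simp add: v zeros_ones_def nth_append)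
    qed
    have a_le: "a \<le> fst (shd s)" if "pre (length v) (unroll s) = v" for s
      using zeros[OF that, of "Suc (fst (shd s))"] unroll_cases(2)[of s "Suc (fst (shd s))"] by force
    have a_eq: "a = fst (shd s)" if "pre (length v) (unroll s) = v" "b \<ge> 1" for s
      using a_le[OF that(1)] ones[OF that(1), of "Suc a"] that(2) unroll_cases(1)[of "Suc a" s] by force
    have b_le: "b \<le> Suc (snd (shd s))" if "pre (length v) (unroll s) = v" "b \<ge> 1" for s
      using a_eq[OF that] ones[OF that(1), of "fst (shd s) + snd (shd s) + 2"] unroll_cases(3)[of s] by force
    show ?thesis
    proof (cases "v2 = []")
      case True
      \<comment> \<open>The first block of the stream may go on after \<open>v\<close>: possibly by
        further zeros, then ones, if \<open>b = 0\<close>; by ones only otherwise.\<close>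
      have ext: "\<exists>c d. blk (shd s) = v @ zeros_ones c d" if "pre (length v) (unroll s) = v" for s
      proof (cases "b = 0")
        case True
        have "blk (shd s) = v @ zeros_ones (fst (shd s) - a) (Suc (snd (shd s)))"
          using a_le[OF that] True \<open>v2 = []\<close>
          by (simp add: v blk_def zeros_ones_def append_assoc[symmetric] replicate_add[symmetric] del: append_assoc replicate_Suc)
        then show ?thesis by blast
      next
        case False
        then have "blk (shd s) = v @ zeros_ones 0 (Suc (snd (shd s)) - b)"
          using a_eq[OF that] b_le[OF that] \<open>v2 = []\<close>
          by (simp add: v blk_def zeros_ones_def replicate_add[symmetric] del: replicate_Suc)
        then show ?thesis by blast
      qed
      let ?B = "shd ` {s. pre (length v) (unroll s) = v}"
      have "emeasure S {s. pre (length v) (unroll s) = v} \<le> emeasure S {s. shd s \<in> ?B}"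
        using measurable_sets[OF shd_measurable_S, of ?B] by (intro emeasure_mono) (auto simp: vimage_def)
      also have "\<dots> = emeasure (measure_pmf \<rho>) ?B" by (rule emeasure_shd)
      also have "\<dots> \<le> ennreal (K * wt p t v)" using ext by (intro prob_blk_extends_le) blast
      finally show ?thesis .
    next
      case False
      then have b: "b \<ge> 1" and h2: "hd v2 = 0" using hd2 by auto
      have bl: "length (blk (a, b - 1)) = Suc a + b" using b by (simp add: length_blk)
      have vb: "v = blk (a, b - 1) @ v2" using b by (simp add: v blk_def)
      \<comment> \<open>The zero after the ones forces the first block to be exactly
        \<open>(a, b - 1)\<close>, in shifted exponents, so independence of the remaining stream
        gives the recursion.\<close>
      have sub: "{s. pre (length v) (unroll s) = v} \<subseteq> {s. shd s = (a, b - 1) \<and> stl s \<in> {s. pre (length v2) (unroll s) = v2}}"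
      proof safe
        fix s assume s: "pre (length v) (unroll s) = v"
        have "unroll s (Suc a + b) = v ! (Suc a + b)"
          using s False unfolding pre_eq_iff by (auto simp: v)
        also have "\<dots> = 0" using False h2 by (simp add: v nth_append hd_conv_nth)
        finally have "unroll s (Suc a + b) = 0" .
        then have "\<not> Suc a + b \<le> fst (shd s) + snd (shd s) + 1"
          using unroll_cases(2)[of s "Suc a + b"] a_eq[OF s b] by auto
        then have "b = Suc (snd (shd s))" using a_eq[OF s b] b_le[OF s b] by auto
        then show sh: "shd s = (a, b - 1)" using a_eq[OF s b] by (simp add: prod_eq_iff)
        show "pre (length v2) (unroll (stl s)) = v2"
          unfolding pre_eq_iff
        proof (intro allI impI)
          fix n assume n: "n < length v2"
          have "unroll (stl s) n = unroll s (length (blk (shd s)) + n)" by (rule unroll_stl[symmetric])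
          also have "\<dots> = v ! (length (blk (shd s)) + n)"
            using s n unfolding pre_eq_iff by (simp add: sh vb)
          also have "\<dots> = v2 ! n" by (simp add: sh vb)
          finally show "unroll (stl s) n = v2 ! n" .
        qed
      qed
      have "{s. shd s = (a, b - 1) \<and> stl s \<in> {s. pre (length v2) (unroll s) = v2}} =
          shd -` {(a, b - 1)} \<inter> space S \<inter> (stl -` {s. pre (length v2) (unroll s) = v2} \<inter> space S)" by auto
      also have "\<dots> \<in> sets S" by measurable
      finally have "emeasure S {s. pre (length v) (unroll s) = v} \<le>
          emeasure S {s. shd s = (a, b - 1) \<and> stl s \<in> {s. pre (length v2) (unroll s) = v2}}"
        by (intro emeasure_mono sub)
      also have "\<dots> = ennreal (pmf \<rho> (a, b - 1)) * emeasure S {s. pre (length v2) (unroll s) = v2}"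
        by (rule emeasure_shd_stl) measurable
      also have "\<dots> \<le> ennreal (wt p t (blk (a, b - 1))) * ennreal (K * wt p t v2)"
      proof (intro mult_mono ennreal_leI)
        show "emeasure S {s. pre (length v2) (unroll s) = v2} \<le> ennreal (K * wt p t v2)"
          using less.prems by (intro less.hyps) (auto simp: v)
      qed (auto simp: pmf_\<rho>)
      also have "\<dots> = ennreal (K * wt p t v)"
        unfolding vb using K_ge_1 by (simp add: wt_append ennreal_mult[symmetric] mult_ac)
      finally show ?thesis .
    qed
  qed
qed

end

section \<open>The stationary version of the block process\<close>

context unit_block_sum
begin

definition mean_length :: ennreal where
  "mean_length = (\<integral>\<^sup>+i. ennreal (real (length (blk i))) \<partial>measure_pmf \<rho>)"

lemma mean_length_bounds: "1 \<le> mean_length" "mean_length < \<infinity>"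
proof -
  have "1 = (\<integral>\<^sup>+i. 1 \<partial>measure_pmf \<rho>)" by simp
  also have "\<dots> \<le> mean_length" unfolding mean_length_def
  proof (rule nn_integral_mono)
    fix i
    have "ennreal 1 \<le> ennreal (real (length (blk i)))" by (intro ennreal_leI) (simp add: length_blk)
    then show "1 \<le> ennreal (real (length (blk i)))" by simp
  qed
  finally show "1 \<le> mean_length" .
  have "mean_length \<le> (\<integral>\<^sup>+i. ennreal (2 / p) * ennreal (exp (p / 2 * real (length (blk i)))) \<partial>measure_pmf \<rho>)"
    unfolding mean_length_def
  proof (intro nn_integral_mono)
    fix i
    have "real (length (blk i)) \<le> 2 / p * exp (p / 2 * real (length (blk i)))"
      using exp_ge_add_one_self[of "p / 2 * real (length (blk i))"] p by (simp add: field_simps)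
    then show "ennreal (real (length (blk i))) \<le> ennreal (2 / p) * ennreal (exp (p / 2 * real (length (blk i))))"
      using p by (simp add: ennreal_mult[symmetric] ennreal_leI)
  qed
  also have "\<dots> < \<infinity>"
    using nn_integral_exp_length_blk[of "p / 2"] p by (simp add: nn_integral_cmult ennreal_mult_less_top)
  finally show "mean_length < \<infinity>" .
qed

text \<open>The origin sits at position \<open>j\<close> of the first block. Summing the
  probabilities over \<open>j\<close> realizes the length bias: each block counts once per
  position.\<close>

definition visit :: "nat \<Rightarrow> (nat \<Rightarrow> nat) set \<Rightarrow> (nat \<times> nat) stream set" where
  "visit j B = {s. j < length (blk (shd s)) \<and> shifted j (unroll s) \<in> B}"

lemma shd_sets: "{s. Q (shd s)} \<in> sets S"
  using measurable_sets[OF shd_measurable_S, of "Collect Q"] by (simp add: vimage_def)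

lemma unroll_sets: "B \<in> sets borel \<Longrightarrow> {s. shifted j (unroll s) \<in> B} \<in> sets S"
  using measurable_sets[OF measurable_compose[OF unroll_measurable shifted_measurable[of j]], of B]
  by (simp add: vimage_def)

lemma visit_sets: "B \<in> sets borel \<Longrightarrow> visit j B \<in> sets S"
  unfolding visit_def Collect_conj_eq by (intro sets.Int shd_sets unroll_sets)

text \<open>
  The stationary version of the block process: the first block is biased by its length, and the
  origin is uniform in it.
\<close>

definition stationary :: "(nat \<Rightarrow> nat) measure" where
  "stationary = distr
     (density (S \<Otimes>\<^sub>M count_space UNIV) (\<lambda>x. indicator {x. snd x < length (blk (shd (fst x)))} x / mean_length))
     borel (\<lambda>x. shifted (snd x) (unroll (fst x)))"

lemma sets_stationary: "sets stationary = sets borel"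
  by (simp add: stationary_def)

lemma emeasure_stationary:
  assumes B: "B \<in> sets borel"
  shows "emeasure stationary B = (\<Sum>j. emeasure S (visit j B)) / mean_length"
proof -
  let ?P = "S \<Otimes>\<^sub>M count_space (UNIV :: nat set)"
  let ?I = "\<lambda>x. indicator {x. snd x < length (blk (shd (fst x)))} x :: ennreal"
  let ?f = "\<lambda>x :: (nat \<times> nat) stream \<times> nat. shifted (snd x) (unroll (fst x))"
  have f: "?f \<in> ?P \<rightarrow>\<^sub>M borel"
  proof (rule measurable_compose_countable[where g = snd and f = "\<lambda>j x. shifted j (unroll (fst x))"])
    fix j show "(\<lambda>x. shifted j (unroll (fst x))) \<in> ?P \<rightarrow>\<^sub>M borel" by measurable
  qed measurable
  have I: "?I \<in> borel_measurable ?P"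
  proof (rule borel_measurable_indicator)
    have "(\<lambda>x. shd (fst x)) \<in> ?P \<rightarrow>\<^sub>M count_space UNIV" by measurable
    moreover have "(\<lambda>x. snd x) \<in> ?P \<rightarrow>\<^sub>M count_space UNIV" by measurable
    ultimately have "(\<lambda>x. (snd x, shd (fst x))) \<in> ?P \<rightarrow>\<^sub>M count_space UNIV \<Otimes>\<^sub>M count_space UNIV"
      by (intro measurable_Pair)
    then have "(\<lambda>x. (snd x, shd (fst x))) \<in> ?P \<rightarrow>\<^sub>M count_space UNIV"
      by (simp add: pair_measure_countable)
    from measurable_sets[OF this, of "{(j, i). j < length (blk i)}"]
    show "{x. snd x < length (blk (shd (fst x)))} \<in> sets ?P"
      by (simp add: vimage_def space_pair_measure)
  qed
  let ?g = "\<lambda>x. ?I x / mean_length * indicator B (?f x)"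
  have g: "?g \<in> borel_measurable ?P"
    by (intro borel_measurable_times_ennreal borel_measurable_divide_ennreal I borel_measurable_const
        measurable_compose[OF f] borel_measurable_indicator B)
  interpret C: sigma_finite_measure "count_space (UNIV :: nat set)"
    by (rule sigma_finite_measure_count_space)
  have "emeasure stationary B = emeasure (density ?P (\<lambda>x. ?I x / mean_length)) (?f -` B \<inter> space ?P)"
    unfolding stationary_def using f B by (subst emeasure_distr) auto
  also have "\<dots> = (\<integral>\<^sup>+x. ?I x / mean_length * indicator (?f -` B \<inter> space ?P) x \<partial>?P)"
    by (rule emeasure_density) (use I measurable_sets[OF f B] in \<open>auto intro!: borel_measurable_divide_ennreal\<close>)
  also have "\<dots> = (\<integral>\<^sup>+x. ?g x \<partial>?P)"
    by (intro nn_integral_cong) (auto simp: indicator_def)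
  also have "\<dots> = (\<integral>\<^sup>+s. \<integral>\<^sup>+j. ?g (s, j) \<partial>count_space UNIV \<partial>S)"
    by (rule C.nn_integral_fst[OF g, symmetric])
  also have "\<dots> = (\<integral>\<^sup>+s. (\<Sum>j. ?g (s, j)) \<partial>S)"
    by (simp add: nn_integral_count_space_nat)
  also have "\<dots> = (\<integral>\<^sup>+s. (\<Sum>j. indicator (visit j B) s / mean_length) \<partial>S)"
    by (intro nn_integral_cong arg_cong[where f = suminf] ext) (auto simp: indicator_def visit_def)
  also have "\<dots> = (\<Sum>j. \<integral>\<^sup>+s. indicator (visit j B) s / mean_length \<partial>S)"
    using visit_sets[OF B]
    by (intro nn_integral_suminf borel_measurable_divide_ennreal borel_measurable_indicator) auto
  also have "\<dots> = (\<Sum>j. emeasure S (visit j B) / mean_length)"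
    using visit_sets[OF B] by (simp add: nn_integral_divide)
  also have "\<dots> = (\<Sum>j. emeasure S (visit j B)) / mean_length"
    by (simp add: divide_ennreal_def)
  finally show ?thesis .
qed

text \<open>Shifting moves the origin from position \<open>j\<close> to \<open>j + 1\<close> of the
  first block, or from the last position to the start of the next block. The latter events add up to
  the law of the sequence after the first block, which equals that of \<open>unroll\<close> itself
  and restores the missing term \<open>j = 0\<close>.\<close>

lemma stationary_invariant:
  assumes B: "B \<in> sets borel"
  shows "emeasure stationary (shift_map -` B) = emeasure stationary B"
proof -
  let ?V = "\<lambda>j. {s. length (blk (shd s)) = Suc j} \<inter> {s. unroll (stl s) \<in> B}"
  have B': "shift_map -` B \<in> sets borel"
    using measurable_sets[OF shifted_measurable[of 1] B] by (simp add: shift_map_eq_shifted)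
  have stl: "{s. unroll (stl s) \<in> B} \<in> sets S"
    using measurable_sets[OF measurable_compose[OF stl_measurable_S unroll_measurable] B] by (simp add: vimage_def)
  have V: "?V j \<in> sets S" for j by (intro sets.Int shd_sets stl)
  have at_end: "shifted (length (blk (shd s))) (unroll s) = unroll (stl s)" for s
    by (simp add: shifted_def unroll_stl)
  have "visit j (shift_map -` B) = visit (Suc j) B \<union> ?V j" for j
  proof -
    have "shift_map (shifted j x) = shifted (Suc j) x" for x by (simp add: shifted_def shift_map_def)
    then have "visit j (shift_map -` B) = {s. j < length (blk (shd s)) \<and> shifted (Suc j) (unroll s) \<in> B}"
      by (simp add: visit_def)
    also have "\<dots> = visit (Suc j) B \<union> {s. length (blk (shd s)) = Suc j \<and> shifted (Suc j) (unroll s) \<in> B}"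
      by (auto simp: visit_def)
    also have "{s. length (blk (shd s)) = Suc j \<and> shifted (Suc j) (unroll s) \<in> B} = ?V j"
      using at_end by (auto simp del: length_blk) (metis, metis)
    finally show ?thesis .
  qed
  then have "emeasure S (visit j (shift_map -` B)) = emeasure S (visit (Suc j) B) + emeasure S (?V j)" for j
    using visit_sets[OF B] V by (subst plus_emeasure) (auto simp: visit_def)
  then have "(\<Sum>j. emeasure S (visit j (shift_map -` B))) =
      (\<Sum>j. emeasure S (visit (Suc j) B)) + (\<Sum>j. emeasure S (?V j))"
    by (simp add: suminf_add[symmetric])
  also have "(\<Sum>j. emeasure S (?V j)) = emeasure S (\<Union>j. ?V j)"
    using V by (intro suminf_emeasure) (auto simp: disjoint_family_on_def)
  also have "(\<Union>j. ?V j) = {s. unroll (stl s) \<in> B}"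
  proof -
    have "\<exists>j. length (blk (shd s)) = Suc j" for s by (simp add: length_blk)
    then show ?thesis by blast
  qed
  also have "emeasure S {s. unroll (stl s) \<in> B} = emeasure S {s. unroll s \<in> B}"
    using emeasure_stl[of "{s. unroll s \<in> B}"] unroll_sets[OF B, of 0] by (simp add: shifted_def)
  also have "{s. unroll s \<in> B} = visit 0 B" by (simp add: visit_def shifted_def length_blk)
  also have "(\<Sum>j. emeasure S (visit (Suc j) B)) + emeasure S (visit 0 B) = (\<Sum>j. emeasure S (visit j B))"
    by (rule sums_unique[OF sums_Suc]) (rule summable_sums[OF summableI])
  finally show ?thesis unfolding emeasure_stationary[OF B] emeasure_stationary[OF B'] by simp
qed

text \<open>The tail sum formula for the mean; it confirms that \<open>mean_length\<close> is the
  right normalizing constant.\<close>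

lemma stationary_UNIV: "emeasure stationary UNIV = 1"
proof -
  have "(\<Sum>j. emeasure S (visit j UNIV)) = (\<Sum>j. emeasure (measure_pmf \<rho>) {i. j < length (blk i)})"
    using emeasure_shd[of "{i. _ < length (blk i)}"] by (simp add: visit_def)
  also have "\<dots> = (\<integral>\<^sup>+i. (\<Sum>j. indicator {i. j < length (blk i)} i) \<partial>measure_pmf \<rho>)"
    by (subst nn_integral_suminf) auto
  also have "\<dots> = mean_length"
    unfolding mean_length_def
  proof (intro nn_integral_cong)
    fix i
    have "(\<Sum>j. indicator {i. j < length (blk i)} i) = (\<Sum>j<length (blk i). 1 :: ennreal)"
      by (subst suminf_finite[of "{..<length (blk i)}"]) auto
    then show "(\<Sum>j. indicator {i. j < length (blk i)} i) = ennreal (real (length (blk i)))"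
      by (simp add: ennreal_of_nat_eq_real_of_nat)
  qed
  finally show ?thesis
    using mean_length_bounds by (subst emeasure_stationary) (auto intro!: ennreal_divide_self)
qed

text \<open>To the left of the origin the first block shows 0^a 1^(j-a), so \<open>visit\<close> is
  covered by the events that the stream starts with such a word followed by \<open>v\<close>. One
  factor \<open>K\<close> bounds the completions of the last block, the other the sum over all
  \<open>j\<close> and \<open>a\<close>; dividing by \<open>mean_length\<close>, which is at least
  one, only helps.\<close>

lemma stationary_cylinder_le:
  assumes v: "set v \<subseteq> {0, 1}"
  shows "emeasure stationary {x. pre (length v) x = v} \<le> ennreal (K * K * wt p t v)"
proof -
  let ?c = "{x :: nat \<Rightarrow> nat. pre (length v) x = v}"
  let ?U = "\<lambda>j a. {s. pre (length (zeros_ones a (j - a) @ v)) (unroll s) = zeros_ones a (j - a) @ v}"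
  let ?w = "\<lambda>j a. K * wt p t (zeros_ones a (j - a) @ v)"
  have cover: "visit j ?c \<subseteq> (\<Union>a\<le>j. ?U j a)" for j
  proof
    fix s assume s: "s \<in> visit j ?c"
    let ?a = "min j (Suc (fst (shd s)))"
    have "take j (blk (shd s)) = zeros_ones ?a (min (j - Suc (fst (shd s))) (Suc (snd (shd s))))"
      by (simp add: blk_def take_zeros_ones)
    also have "min (j - Suc (fst (shd s))) (Suc (snd (shd s))) = j - ?a"
      using s by (auto simp: visit_def length_blk)
    finally have t: "take j (blk (shd s)) = zeros_ones ?a (j - ?a)" .
    have "pre (j + length v) (unroll s) = zeros_ones ?a (j - ?a) @ v"
    proof (rule nth_equalityI)
      fix n assume n: "n < length (pre (j + length v) (unroll s))"
      show "pre (j + length v) (unroll s) ! n = (zeros_ones ?a (j - ?a) @ v) ! n"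
      proof (cases "n < j")
        case True
        then have "unroll s n = take j (blk (shd s)) ! n"
          using s by (subst unroll_shd) (auto simp: visit_def)
        then show ?thesis using True n by (simp add: t nth_append)
      next
        case False
        have "shifted j (unroll s) (n - j) = v ! (n - j)"
          using s False n pre_eq_iff[of v "shifted j (unroll s)"] by (auto simp: visit_def)
        then show ?thesis using False n by (simp add: nth_append shifted_def)
      qed
    qed simp
    then show "s \<in> (\<Union>a\<le>j. ?U j a)"
      by (intro UN_I[of ?a]) simp_all
  qed
  have each: "emeasure S (visit j ?c) \<le> ennreal (\<Sum>a\<le>j. ?w j a)" for j
  proof -
    have "emeasure S (visit j ?c) \<le> emeasure S (\<Union>a\<le>j. ?U j a)"
      by (intro emeasure_mono cover) measurable
    also have "\<dots> \<le> (\<Sum>a\<le>j. emeasure S (?U j a))"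
      by (intro emeasure_subadditive_finite) auto
    also have "\<dots> \<le> (\<Sum>a\<le>j. ennreal (?w j a))"
      using v by (intro sum_mono emeasure_unroll_starts_le) (auto simp: zeros_ones_def)
    also have "\<dots> = ennreal (\<Sum>a\<le>j. ?w j a)"
      using K_ge_1 by (intro sum_ennreal) auto
    finally show ?thesis .
  qed
  have "(\<Sum>j. emeasure S (visit j ?c)) + 0 \<le> ennreal (K * K * wt p t v)"
  proof (rule ennreal_suminf_bound_add)
    fix N
    have "(\<Sum>j<N. emeasure S (visit j ?c)) \<le> (\<Sum>j<N. ennreal (\<Sum>a\<le>j. ?w j a))"
      by (intro sum_mono each)
    also have "\<dots> = ennreal (\<Sum>j<N. \<Sum>a\<le>j. ?w j a)"
      using K_ge_1 by (intro sum_ennreal sum_nonneg) auto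
    also have "(\<Sum>j<N. \<Sum>a\<le>j. ?w j a) =
        K * (\<Sum>j<N. \<Sum>a\<le>j. wt p t (zeros_ones a (j - a))) * wt p t v"
      by (simp add: wt_append sum_distrib_left sum_distrib_right mult.assoc)
    also have "(\<Sum>j<N. \<Sum>a\<le>j. wt p t (zeros_ones a (j - a))) =
        (\<Sum>z\<in>(SIGMA j:{..<N}. {..j}). wt p t (zeros_ones (snd z) (fst z - snd z)))"
      by (subst sum.Sigma) (auto simp: case_prod_unfold)
    also have "\<dots> = (\<Sum>i\<in>(\<lambda>z. (snd z, fst z - snd z)) ` (SIGMA j:{..<N}. {..j}). wt p t (zeros_ones (fst i) (snd i)))"
      by (subst sum.reindex) (auto simp: inj_on_def)
    also have "\<dots> \<le> K" by (intro sum_le_K) auto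
    finally show "(\<Sum>j<N. emeasure S (visit j ?c)) + 0 \<le> ennreal (K * K * wt p t v)"
      using K_ge_1 by (simp add: ennreal_leI mult_left_mono mult_right_mono)
  qed
  moreover have "inverse mean_length \<le> 1"
  proof -
    obtain e where e: "mean_length = ennreal e" "e \<ge> 1" using mean_length_bounds by (cases mean_length) auto
    then have "inverse mean_length = ennreal (inverse e)" by (simp add: inverse_ennreal)
    also have "\<dots> \<le> ennreal 1" using e by (intro ennreal_leI) (simp add: inverse_le_1_iff)
    finally show ?thesis by simp
  qed
  ultimately have "(\<Sum>j. emeasure S (visit j ?c)) * inverse mean_length \<le> ennreal (K * K * wt p t v) * 1"
    by (intro mult_mono) auto
  then have "(\<Sum>j. emeasure S (visit j ?c)) / mean_length \<le> ennreal (K * K * wt p t v)"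
    by (simp add: divide_ennreal_def)
  then show ?thesis by (subst emeasure_stationary) auto
qed

end

section \<open>The equilibrium state on the shift space\<close>

context block_shift
begin

lemma shift_measurable: "shift_map \<in> restrict_space borel X \<rightarrow>\<^sub>M restrict_space borel X"
  using shift_X unfolding shift_map_eq_shifted
  by (intro measurable_restrict_space3) (auto simp: shift_map_eq_shifted[symmetric])

end

context unit_block_shift
begin

lemma shifted_X: "x \<in> X \<Longrightarrow> shifted j x \<in> X"
proof (induction j)
  case 0
  then show ?case by (simp add: shifted_def)
next
  case (Suc j)
  then have "shift_map (shifted j x) \<in> X" using shift_X by blast
  then show ?case by (simp add: shifted_def shift_map_def)
qed

lemma unroll_in_X:
  assumes "stream_all (\<lambda>i. i \<in> A) s"
  shows "unroll s \<in> X"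
proof (subst X_eq, intro CollectI allI)
  fix i n
  let ?c = "cat (stake (i + n) s)"
  have len: "i + n \<le> length ?c" using length_le_length_cat[of "stake (i + n) s"] by simp
  have "map (unroll s) [i..<i + n] = take n (drop i ?c)"
    using len by (intro nth_equalityI) (auto simp: unroll_eq[of _ "i + n"])
  moreover have "sublist (take n (drop i ?c)) ?c"
    by (meson sublist_drop sublist_order.order_trans sublist_take)
  moreover have "stake (i + n) s \<in> lists A"
    unfolding in_lists_conv_set
  proof
    fix k assume "k \<in> set (stake (i + n) s)"
    then obtain m where "m < i + n" "k = stake (i + n) s ! m" by (auto simp: in_set_conv_nth)
    then show "k \<in> A" using assms by (simp add: stream_all_def)
  qed
  ultimately show "map (unroll s) [i..<i + n] \<in> language X"
    unfolding language_X by (metis (mono_tags, lifting) mem_Collect_eq)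
qed

lemma AE_unroll_in_X: "AE s in S. unroll s \<in> X"
proof -
  have "AE s in S. stream_all (\<lambda>i. i \<in> A) s"
    using set_pmf_\<rho> by (intro prob_space.AE_stream_all[OF prob_space_measure_pmf]) (auto simp: AE_measure_pmf_iff)
  then show ?thesis by eventually_elim (rule unroll_in_X)
qed

lemma X_borel: "X \<in> sets borel"
  using closed_X by (rule borel_closed)

text \<open>Almost every stream uses only blocks from \<open>A\<close>, so its unrolled sequence and
  all its shifts lie in \<open>X\<close>.\<close>

lemma stationary_Compl_X: "emeasure stationary (- X) = 0"
proof -
  have "emeasure S (visit j (- X)) = 0" for j
  proof -
    have "visit j (- X) = {s \<in> space S. s \<in> visit j (- X)}" by simp
    moreover have "emeasure S {s \<in> space S. s \<in> visit j (- X)} = 0"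
    proof (rule emeasure_eq_0_AE)
      show "AE s in S. s \<notin> visit j (- X)"
        using AE_unroll_in_X by eventually_elim (auto simp: visit_def shifted_X)
    qed
    ultimately show ?thesis by simp
  qed
  then show ?thesis using X_borel by (subst emeasure_stationary) auto
qed

definition equilibrium :: "(nat \<Rightarrow> nat) measure" where
  "equilibrium = restrict_space stationary X"

lemma emeasure_stationary_Int_X:
  "B \<in> sets borel \<Longrightarrow> emeasure stationary (X \<inter> B) = emeasure stationary B"
proof -
  assume B: "B \<in> sets borel"
  have "emeasure stationary B = emeasure stationary (X \<inter> B \<union> (- X \<inter> B))"
    by (intro arg_cong[where f = "emeasure stationary"]) auto
  also have "\<dots> = emeasure stationary (X \<inter> B) + emeasure stationary (- X \<inter> B)"
    using X_borel B by (intro plus_emeasure[symmetric]) (auto simp: sets_stationary)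
  also have "emeasure stationary (- X \<inter> B) = 0"
    using emeasure_mono[of "- X \<inter> B" "- X" stationary] X_borel stationary_Compl_X by (simp add: sets_stationary)
  finally show ?thesis by simp
qed

lemma sets_equilibrium: "sets equilibrium = sets (restrict_space borel X)"
  by (simp add: equilibrium_def sets_restrict_space sets_stationary)

lemma space_equilibrium: "space equilibrium = X"
  using sets_eq_imp_space_eq[OF sets_equilibrium] by (simp add: space_restrict_space)

lemma emeasure_equilibrium:
  "B \<in> sets borel \<Longrightarrow> emeasure equilibrium (X \<inter> B) = emeasure stationary B"
  unfolding equilibrium_def using X_borel emeasure_stationary_Int_X[of B]
  by (subst emeasure_restrict_space) (auto simp: sets_stationary sets_eq_imp_space_eq[OF sets_stationary])

lemma equilibrium_invariant: "equilibrium \<in> invariant_measures X"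
  unfolding invariant_measures_def
proof (intro CollectI conjI)
  show "prob_space equilibrium"
    using emeasure_equilibrium[of UNIV] stationary_UNIV by (intro prob_spaceI) (simp add: space_equilibrium)
  show "sets equilibrium = sets (restrict_space borel X)" by (rule sets_equilibrium)
  show m: "shift_map \<in> equilibrium \<rightarrow>\<^sub>M equilibrium"
    using shift_measurable by (subst measurable_cong_sets[OF sets_equilibrium sets_equilibrium])
  show "distr equilibrium equilibrium shift_map = equilibrium"
  proof (rule measure_eqI)
    fix C assume "C \<in> sets (distr equilibrium equilibrium shift_map)"
    then have C: "C \<in> sets equilibrium" by simp
    then obtain B where B: "B \<in> sets borel" "C = X \<inter> B"
      by (auto simp: sets_equilibrium sets_restrict_space)
    have B': "shift_map -` B \<in> sets borel"
      using measurable_sets[OF shifted_measurable[of 1] B(1)] by (simp add: shift_map_eq_shifted)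
    have "shift_map -` C \<inter> space equilibrium = X \<inter> shift_map -` B"
      using shift_X by (auto simp: B(2) space_equilibrium)
    then have "emeasure (distr equilibrium equilibrium shift_map) C = emeasure equilibrium (X \<inter> shift_map -` B)"
      using C m by (simp add: emeasure_distr)
    also have "\<dots> = emeasure equilibrium C"
      by (simp only: B(2) emeasure_equilibrium[OF B'] emeasure_equilibrium[OF B(1)] stationary_invariant[OF B(1)])
    finally show "emeasure (distr equilibrium equilibrium shift_map) C = emeasure equilibrium C" .
  qed simp
qed

lemma equilibrium_cylinder_le:
  assumes "set v \<subseteq> {0, 1}"
  shows "measure equilibrium {x \<in> X. pre (length v) x = v} \<le> K * K * wt p t v"
proof -
  interpret binary_shift_measure X equilibrium
    by (rule binary_shift_measureI[OF equilibrium_invariant])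
  have "emeasure equilibrium {x \<in> X. pre (length v) x = v} = emeasure stationary {x. pre (length v) x = v}"
    using emeasure_equilibrium[OF cylinder_borel[of "length v" v]] by (simp add: Int_def)
  also have "\<dots> \<le> ennreal (K * K * wt p t v)" by (rule stationary_cylinder_le[OF assms])
  finally show ?thesis
    using K_ge_1 by (simp add: emeasure_eq_measure ennreal_le_iff)
qed

text \<open>By the cylinder estimate, \<open>- ln\<close> of the mass of a word is at least
  \<open>p\<close> per symbol plus \<open>t\<close> per one, up to \<open>ln (K * K)\<close>.
  Averaging over words bounds the entropy of the partition by the first symbol from below, and the
  constant vanishes after division by the length.\<close>

lemma ks_entropy_equilibrium_ge:
  assumes A: "A \<noteq> {}"
  shows "ks_entropy equilibrium shift_map \<ge> ereal (p + t * measure equilibrium {x \<in> X. x 0 = 1})"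
proof -
  interpret binary_shift_measure X equilibrium
    by (rule binary_shift_measureI[OF equilibrium_invariant])
  define Z where "Z = {x \<in> X. x 0 = 0}"
  define O1 where "O1 = {x \<in> X. x 0 = 1}"
  define P where "P = {Z, O1}"
  have ev: "Z \<in> events" "O1 \<in> events"
    using events_cyl[of 1 "{[0]}"] events_cyl[of 1 "{[1]}"] by (simp_all add: Z_def O1_def pre_def)
  obtain i where i: "i \<in> A" using A by blast
  have u: "unroll (sconst i) \<in> X" using i by (intro unroll_in_X) (simp add: stream_all_def sconst_alt)
  then have "unroll (sconst i) \<in> Z" by (simp add: Z_def unroll_0)
  moreover have "shifted (Suc (fst i)) (unroll (sconst i)) \<in> O1"
  proof -
    have "unroll (sconst i) (Suc (fst i)) = 1" using unroll_cases(2)[of "sconst i" "Suc (fst i)"] by simp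
    then have "shifted (Suc (fst i)) (unroll (sconst i)) 0 = 1" by (simp add: shifted_def)
    then show ?thesis using shifted_X[OF u] unfolding O1_def by blast
  qed
  ultimately have ne: "Z \<noteq> {}" "O1 \<noteq> {}" by auto
  have "partition_on X P"
  proof (rule partition_onI)
    have "x \<in> Z \<union> O1" if "x \<in> X" for x
      using that binary[OF that, of 0] by (auto simp: Z_def O1_def)
    then show "\<Union>P = X" by (auto simp: P_def Z_def O1_def)
    show "disjnt B C" if "B \<in> P" "C \<in> P" "B \<noteq> C" for B C
    proof -
      have "disjnt Z O1" "disjnt O1 Z" by (auto simp: Z_def O1_def disjnt_def)
      then show ?thesis using that by (auto simp: P_def)
    qed
    show "{} \<notin> P" using ne by (auto simp: P_def)
  qed
  then have fmp: "finite_measurable_partition equilibrium P"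
    using ev by (simp add: finite_measurable_partition_def space_M P_def)
  have ZO: "Z \<noteq> O1"
  proof -
    have "Z \<inter> O1 = {}" by (auto simp: Z_def O1_def)
    then show ?thesis using ne by auto
  qed
  \<comment> \<open>Translates atoms back into symbols, so that itineraries correspond to
    prefixes.\<close>
  define dec where "dec B = (if B = Z then 0 else 1 :: nat)" for B
  have dec: "dec (atom_of P x) = x 0" if "x \<in> X" for x
  proof -
    have "atom_of P x = Z" if "x 0 = 0"
      using that \<open>x \<in> X\<close> by (intro atom_of(3)[OF \<open>partition_on X P\<close>]) (auto simp: P_def Z_def)
    moreover have "atom_of P x = O1" if "x 0 = 1"
      using that \<open>x \<in> X\<close> by (intro atom_of(3)[OF \<open>partition_on X P\<close>]) (auto simp: P_def O1_def)
    ultimately show ?thesis using binary[OF that, of 0] ZO by (auto simp: dec_def)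
  qed
  have dec_itin: "map dec (itin (atom_of P) n x) = pre n x" if "x \<in> X" for x n
  proof (rule nth_equalityI)
    fix i assume "i < length (map dec (itin (atom_of P) n x))"
    then have "map dec (itin (atom_of P) n x) ! i = dec (atom_of P ((shift_map ^^ i) x))" by (simp add: itin_def)
    also have "\<dots> = (shift_map ^^ i) x 0" using T_iter_space[of x i] that by (intro dec) (simp add: space_M)
    finally show "map dec (itin (atom_of P) n x) ! i = pre n x ! i"
      using \<open>i < _\<close> by (simp add: shift_map_iter)
  qed simp
  note fv = finite_valued_itin[OF finite_valued_atom_of[OF fmp]]
  have bound: "block_ent P (atom_of P) n \<ge> real n * (p + t * prob {x \<in> X. x 0 = 1}) - ln (K * K)" for n
  proof -
    have KK: "K * K > 0" using K_ge_1 by simp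
    let ?q = "\<lambda>w. K * K * wt p t (map dec w)"
    have le: "prob {x \<in> space equilibrium. itin (atom_of P) n x = w} \<le> ?q w" if "w \<in> words_over P n" for w
    proof -
      have "{x \<in> space equilibrium. itin (atom_of P) n x = w} \<subseteq> {x \<in> X. pre (length (map dec w)) x = map dec w}"
      proof
        fix x assume "x \<in> {x \<in> space equilibrium. itin (atom_of P) n x = w}"
        then have "x \<in> X" "itin (atom_of P) n x = w" by (simp_all add: space_M)
        then show "x \<in> {x \<in> X. pre (length (map dec w)) x = map dec w}"
          using dec_itin[of x n] that by auto
      qed
      then have "prob {x \<in> space equilibrium. itin (atom_of P) n x = w} \<le> prob {x \<in> X. pre (length (map dec w)) x = map dec w}"
        using events_cyl[of "length (map dec w)" "{map dec w}"] by (intro finite_measure_mono) auto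
      also have "\<dots> \<le> ?q w" by (rule equilibrium_cylinder_le) (auto simp: dec_def)
      finally show ?thesis .
    qed
    have "(\<Sum>w\<in>words_over P n. prob {x \<in> space equilibrium. itin (atom_of P) n x = w} * - ln (?q w)) \<le> block_ent P (atom_of P) n"
      unfolding ent_def
    proof (rule sum_mono)
      fix w assume w: "w \<in> words_over P n"
      let ?a = "prob {x \<in> space equilibrium. itin (atom_of P) n x = w}"
      show "?a * - ln (?q w) \<le> eta ?a"
      proof (cases "?a = 0")
        case False
        then have "?a > 0" using measure_nonneg by (simp add: order_less_le)
        then have "?a * ln ?a \<le> ?a * ln (?q w)" using le[OF w] by (intro mult_left_mono) auto
        then show ?thesis by (simp add: eta_def)
      qed simp
    qed
    also have "(\<Sum>w\<in>words_over P n. prob {x \<in> space equilibrium. itin (atom_of P) n x = w} * - ln (?q w)) =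
        expectation (\<lambda>x. - ln (?q (itin (atom_of P) n x)))"
      by (rule finite_valued_expectation(2)[OF fv, symmetric])
    also have "\<dots> = expectation (\<lambda>x. (p * real n - ln (K * K)) + t * real (count_list (pre n x) 1))"
    proof (rule Bochner_Integration.integral_cong[OF refl])
      fix x assume "x \<in> space equilibrium"
      then have q: "?q (itin (atom_of P) n x) = K * K * wt p t (pre n x)" by (simp add: dec_itin space_M)
      have "ln (K * K * wt p t (pre n x)) = ln (K * K) + ln (wt p t (pre n x))"
        using KK wt_pos by (intro ln_mult_pos)
      then show "- ln (?q (itin (atom_of P) n x)) = (p * real n - ln (K * K)) + t * real (count_list (pre n x) 1)"
        unfolding q by (simp add: wt_def)
    qed
    also have "\<dots> = (p * real n - ln (K * K)) + t * expectation (\<lambda>x. real (count_list (pre n x) 1))"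
      using finite_valued_expectation(1)[OF finite_valued_pre[of n], of "\<lambda>w. real (count_list w 1)"]
      by (simp add: prob_space)
    also have "\<dots> = real n * (p + t * prob {x \<in> X. x 0 = 1}) - ln (K * K)"
      unfolding expectation_ones by (simp add: algebra_simps)
    finally show ?thesis .
  qed
  obtain L where L: "(\<lambda>n. block_ent P (atom_of P) n / real n) \<longlonglongrightarrow> L"
    using block_ent_convergent[OF finite_valued_atom_of[OF fmp]] by (auto simp: convergent_def)
  have "(\<lambda>n. (p + t * prob {x \<in> X. x 0 = 1}) - ln (K * K) / real n) \<longlonglongrightarrow> (p + t * prob {x \<in> X. x 0 = 1}) - 0"
    by (intro tendsto_diff tendsto_const lim_const_over_n)
  then have "(p + t * prob {x \<in> X. x 0 = 1}) - 0 \<le> L"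
  proof (rule LIMSEQ_le[OF _ L], intro exI allI impI)
    fix n :: nat assume n: "n \<ge> 1"
    have "(real n * (p + t * prob {x \<in> X. x 0 = 1}) - ln (K * K)) / real n \<le> block_ent P (atom_of P) n / real n"
      using bound[of n] by (intro divide_right_mono) auto
    then show "(p + t * prob {x \<in> X. x 0 = 1}) - ln (K * K) / real n \<le> block_ent P (atom_of P) n / real n"
      using n by (simp add: diff_divide_distrib)
  qed
  then show ?thesis by (intro ks_entropy_ge[OF fmp L]) simp
qed

lemma A_nonempty: "A \<noteq> {}"
proof
  assume "A = {}"
  then have "((\<lambda>i. wt p t (blk i)) has_sum 0) A" by simp
  with unit show False using has_sum_unique by fastforce
qed

end

section \<open>Pressure\<close>

locale block_shift_0 = block_shift +
  assumes zero_X: "(\<lambda>_. 0) \<in> X"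
begin

definition \<phi> :: "(nat \<Rightarrow> nat) \<Rightarrow> real" where
  "\<phi> = (\<lambda>x. - indicator {x \<in> X. x 0 = 1} x)"

definition freq :: "(nat \<Rightarrow> nat) measure \<Rightarrow> real" where
  "freq M = measure M {x \<in> X. x 0 = 1}"

abbreviation Pr :: "real \<Rightarrow> ereal" where
  "Pr t \<equiv> pressure X (\<lambda>x. t * \<phi> x)"

abbreviation \<delta>0 :: "(nat \<Rightarrow> nat) measure" where
  "\<delta>0 \<equiv> return (restrict_space borel X) (\<lambda>_. 0)"

lemma integral_\<phi>:
  assumes "M \<in> invariant_measures X"
  shows "integral\<^sup>L M \<phi> = - freq M"
proof -
  interpret binary_shift_measure X M by (rule binary_shift_measureI[OF assms])
  have "{x \<in> X. x 0 = 1} \<in> events" using events_cyl[of 1 "{[1]}"] by (simp add: pre_def)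
  then show ?thesis by (simp add: \<phi>_def freq_def)
qed

lemma freq_nonneg [simp]: "freq M \<ge> 0"
  by (simp add: freq_def)

lemma freq_le_1: "M \<in> invariant_measures X \<Longrightarrow> freq M \<le> 1"
  using prob_space.prob_le_1 by (auto simp: invariant_measures_def freq_def)

lemma ks_nonneg: "M \<in> invariant_measures X \<Longrightarrow> ks_entropy M shift_map \<ge> 0"
proof -
  assume "M \<in> invariant_measures X"
  then interpret binary_shift_measure X M by (rule binary_shift_measureI)
  show ?thesis by (rule ks_entropy_nonneg)
qed

lemma Pr_eq: "Pr t = (SUP M\<in>invariant_measures X. ks_entropy M shift_map + ereal (- t * freq M))"
  unfolding pressure_def by (intro SUP_cong refl) (simp add: integral_\<phi>)

lemma Pr_ge: "M \<in> invariant_measures X \<Longrightarrow> ks_entropy M shift_map + ereal (- t * freq M) \<le> Pr t"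
  unfolding Pr_eq by (rule SUP_upper)

lemma equilibrium_state_iff:
  "equilibrium_state X (\<lambda>x. t * \<phi> x) M \<longleftrightarrow>
    M \<in> invariant_measures X \<and> ks_entropy M shift_map + ereal (- t * freq M) = Pr t"
  unfolding equilibrium_state_def using integral_\<phi>[of M] by auto

lemma antimono_Pr: "antimono Pr"
proof (rule antimonoI)
  fix s t :: real assume "s \<le> t"
  then show "Pr t \<le> Pr s"
    unfolding Pr_eq by (intro SUP_mono' add_left_mono) (auto intro: mult_right_mono)
qed

lemma \<delta>0_invariant: "\<delta>0 \<in> invariant_measures X"
  unfolding invariant_measures_def
proof (intro CollectI conjI)
  have sp: "(\<lambda>_. 0) \<in> space (restrict_space borel X)" using zero_X by (simp add: space_restrict_space)
  show "prob_space \<delta>0" by (rule prob_space_return[OF sp])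
  show s: "sets \<delta>0 = sets (restrict_space borel X)" by simp
  show "shift_map \<in> \<delta>0 \<rightarrow>\<^sub>M \<delta>0" using shift_measurable by simp
  have "distr \<delta>0 \<delta>0 shift_map = distr \<delta>0 (restrict_space borel X) shift_map"
    by (intro distr_cong) auto
  also have "\<dots> = return (restrict_space borel X) (shift_map (\<lambda>_. 0))"
    using shift_measurable sp by (rule distr_return)
  finally show "distr \<delta>0 \<delta>0 shift_map = \<delta>0" by (simp add: shift_map_def)
qed

lemma freq_\<delta>0: "freq \<delta>0 = 0"
proof -
  interpret binary_shift_measure X \<delta>0 by (rule binary_shift_measureI[OF \<delta>0_invariant])
  have "{x \<in> X. x 0 = 1} \<in> events" using events_cyl[of 1 "{[1]}"] by (simp add: pre_def)
  then show ?thesis by (simp add: measure_return freq_def)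
qed

lemma Pr_nonneg: "Pr t \<ge> 0"
  using Pr_ge[OF \<delta>0_invariant, of t] ks_nonneg[OF \<delta>0_invariant] by (simp add: freq_\<delta>0)

text \<open>By invariance each coordinate is zero almost surely, and countably many coordinates
  determine the point.\<close>

lemma eq_\<delta>0:
  assumes M: "M \<in> invariant_measures X" and "freq M = 0"
  shows "M = \<delta>0"
proof -
  interpret binary_shift_measure X M by (rule binary_shift_measureI[OF M])
  have ev: "{x \<in> X. x 0 = 1} \<in> events" using events_cyl[of 1 "{[1]}"] by (simp add: pre_def)
  have "AE x in M. x n = 0" for n
  proof -
    have "prob {x \<in> space M. (shift_map ^^ n) x \<in> {x \<in> X. x 0 = 1}} = 0"
      using prob_iter[OF ev] assms(2) by (simp add: freq_def)
    moreover have "{x \<in> space M. (shift_map ^^ n) x \<in> {x \<in> X. x 0 = 1}} \<in> events"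
      using measurable_sets[OF T_iter ev, of n] by (simp add: vimage_def Int_def conj_commute)
    ultimately have "AE x in M. \<not> (shift_map ^^ n) x \<in> {x \<in> X. x 0 = 1}"
      by (subst AE_iff_measurable[OF _ refl]) (auto simp: emeasure_eq_measure)
    then show ?thesis
      using AE_space
    proof eventually_elim
      case (elim x)
      have x: "(shift_map ^^ n) x \<in> X" using T_iter_space[OF elim(2), of n] by (simp add: space_M)
      then have "(shift_map ^^ n) x 0 \<noteq> 1" using elim(1) by blast
      then show ?case using binary[OF x, of 0] by (simp add: shift_map_iter)
    qed
  qed
  then have AE: "AE x in M. x = (\<lambda>_. 0)" by (simp add: AE_all_countable fun_eq_iff)
  show ?thesis
  proof (rule measure_eqI)
    show "sets M = sets \<delta>0" by (simp add: sets_M)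
    fix C assume C: "C \<in> events"
    then have C': "C \<in> sets (restrict_space borel X)" by (simp add: sets_M)
    show "emeasure M C = emeasure \<delta>0 C"
    proof (cases "(\<lambda>_. 0) \<in> C")
      case True
      have "emeasure M C = emeasure M (space M)"
        by (rule emeasure_eq_AE) (use AE C True in \<open>auto elim!: eventually_mono\<close>)
      then show ?thesis using True C' by (simp add: emeasure_space_1)
    next
      case False
      have "emeasure M C = emeasure M {}"
        by (rule emeasure_eq_AE) (use AE C False in \<open>auto elim!: eventually_mono\<close>)
      then show ?thesis using False C' by simp
    qed
  qed
qed

text \<open>A measure that witnesses positivity still does so for slightly larger \<open>t\<close>,
  since \<open>freq M \<le> 1\<close> bounds the loss by the increment. Thus the pressure vanishes
  at \<open>t0\<close> itself when \<open>t0\<close> is finite.\<close>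

lemma Pr_pos_open:
  assumes "Pr t > 0"
  shows "\<exists>t'>t. Pr t' > 0"
proof -
  obtain M where M: "M \<in> invariant_measures X" and pos: "0 < ks_entropy M shift_map + ereal (- t * freq M)"
    using assms unfolding Pr_eq less_SUP_iff by blast
  have "\<exists>t'>t. 0 < ks_entropy M shift_map + ereal (- t' * freq M)"
  proof (cases "ks_entropy M shift_map")
    case (real h)
    define e where "e = h - t * freq M"
    have e: "e > 0" using pos by (simp add: real e_def)
    have "e / 2 * freq M \<le> e / 2 * 1" using freq_le_1[OF M] e by (intro mult_left_mono) auto
    moreover have "(t + e / 2) * freq M = t * freq M + e / 2 * freq M" by (rule distrib_right)
    moreover have "h = e + t * freq M" by (simp add: e_def)
    ultimately have "0 < h - (t + e / 2) * freq M" using e by linarith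
    then have "0 < ks_entropy M shift_map + ereal (- (t + e / 2) * freq M)"
      by (simp add: real del: minus_add_distrib)
    then show ?thesis using e by (intro exI[of _ "t + e / 2"]) simp
  next
    case PInf
    then show ?thesis by (intro exI[of _ "t + 1"]) simp
  next
    case MInf
    then show ?thesis using pos by simp
  qed
  then show ?thesis using Pr_ge[OF M] less_le_trans by blast
qed

definition t0 :: ereal where
  "t0 = Inf {ereal t | t. Pr t = 0}"

lemma Pr_eq_0_iff: "Pr t = 0 \<longleftrightarrow> \<not> Pr t > 0"
  using Pr_nonneg[of t] by auto

text \<open>Every \<open>t\<close> belongs to exactly one of the two sets, and monotonicity puts one
  to the left of the other, so the cut has no gap.\<close>

lemma t0_eq_Sup: "t0 = Sup {ereal t | t. Pr t > 0}"
proof (rule antisym)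
  show "t0 \<le> Sup {ereal t | t. Pr t > 0}"
  proof (rule ccontr)
    assume "\<not> t0 \<le> Sup {ereal t | t. Pr t > 0}"
    then obtain r where r: "Sup {ereal t | t. Pr t > 0} < ereal r" "ereal r < t0"
      using ereal_dense2[of "Sup {ereal t | t. Pr t > 0}" t0] unfolding not_le by blast
    show False
    proof (cases "Pr r > 0")
      case True
      then have "ereal r \<le> Sup {ereal t | t. Pr t > 0}" by (intro Sup_upper) blast
      then show ?thesis using r by simp
    next
      case False
      then have "t0 \<le> ereal r" unfolding t0_def by (intro Inf_lower) (auto simp: Pr_eq_0_iff)
      then show ?thesis using r by simp
    qed
  qed
  show "Sup {ereal t | t. Pr t > 0} \<le> t0"
    unfolding t0_def
  proof (intro Sup_least Inf_greatest)
    fix x y assume "x \<in> {ereal t | t. Pr t > 0}" "y \<in> {ereal t | t. Pr t = 0}"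
    then obtain s t where st: "x = ereal s" "y = ereal t" "Pr s > 0" "Pr t = 0" by auto
    have "s \<le> t"
    proof (rule ccontr)
      assume "\<not> s \<le> t"
      then have "Pr s \<le> Pr t" using antimonoD[OF antimono_Pr, of t s] by simp
      then show False using st by simp
    qed
    then show "x \<le> y" by (simp add: st)
  qed
qed

lemma Pr_pos_iff: "Pr t > 0 \<longleftrightarrow> ereal t < t0"
proof
  assume "Pr t > 0"
  then obtain t' where t': "t' > t" "Pr t' > 0" using Pr_pos_open by blast
  then have "ereal t < ereal t'" by simp
  also have "\<dots> \<le> t0" unfolding t0_eq_Sup using t' by (intro Sup_upper) blast
  finally show "ereal t < t0" .
next
  assume "ereal t < t0"
  then obtain t' where t': "ereal t < ereal t'" "Pr t' > 0"
    unfolding t0_eq_Sup less_Sup_iff by auto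
  then have "Pr t' \<le> Pr t" using antimonoD[OF antimono_Pr, of t t'] by simp
  then show "Pr t > 0" using t'(2) by simp
qed

text \<open>For \<open>t \<ge> 0\<close> all integrals are nonpositive and \<open>\<delta>0\<close>
  attains zero, so hyperbolicity means positive pressure.\<close>

lemma hyperbolic_iff:
  assumes "t \<ge> 0"
  shows "hyperbolic_potential X (\<lambda>x. t * \<phi> x) \<longleftrightarrow> ereal t < t0"
proof -
  have "continuous_on X (\<lambda>x. - t * real (x 0))"
    by (intro continuous_intros continuous_on_subset[OF continuous_on_product_coordinates])
       auto
  moreover have "t * \<phi> x = - t * real (x 0)" if "x \<in> X" for x
    using binary[OF that, of 0] that by (auto simp: \<phi>_def)
  ultimately have cont: "continuous_on X (\<lambda>x. t * \<phi> x)" by (simp cong: continuous_on_cong)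
  have "(SUP M\<in>invariant_measures X. ereal (\<integral>x. t * \<phi> x \<partial>M)) = 0"
  proof (rule antisym)
    show "(SUP M\<in>invariant_measures X. ereal (\<integral>x. t * \<phi> x \<partial>M)) \<le> 0"
      using assms by (intro SUP_least) (simp add: integral_\<phi>)
    show "0 \<le> (SUP M\<in>invariant_measures X. ereal (\<integral>x. t * \<phi> x \<partial>M))"
      by (rule SUP_upper2[OF \<delta>0_invariant]) (simp add: integral_\<phi>[OF \<delta>0_invariant] freq_\<delta>0)
  qed
  then show ?thesis unfolding hyperbolic_potential_def using cont by (simp add: Pr_pos_iff)
qed

text \<open>Zero pressure at some \<open>t' < t\<close> does the work: an equilibrium state has
  entropy \<open>t * freq M\<close>, and the bound at \<open>t'\<close> makes this at most
  \<open>t' * freq M\<close>, which forces frequency zero.\<close>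

lemma equilibrium_state_above:
  assumes "ereal t > t0"
  shows "equilibrium_state X (\<lambda>x. t * \<phi> x) M \<longleftrightarrow> M = \<delta>0"
proof -
  obtain t' where t': "Pr t' = 0" "t' < t"
    using assms unfolding t0_def Inf_less_iff by auto
  have Pt: "Pr t = 0"
    using antimonoD[OF antimono_Pr, of t' t] t' Pr_nonneg[of t] by simp
  show ?thesis
  proof
    assume "M = \<delta>0"
    moreover have "ks_entropy \<delta>0 shift_map + ereal (- t * freq \<delta>0) = Pr t"
      using Pr_ge[OF \<delta>0_invariant, of t] ks_nonneg[OF \<delta>0_invariant] by (simp add: freq_\<delta>0 Pt)
    ultimately show "equilibrium_state X (\<lambda>x. t * \<phi> x) M"
      using \<delta>0_invariant by (simp add: equilibrium_state_iff)
  next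
    assume "equilibrium_state X (\<lambda>x. t * \<phi> x) M"
    then have M: "M \<in> invariant_measures X" and eq: "ks_entropy M shift_map + ereal (- t * freq M) = 0"
      by (auto simp: equilibrium_state_iff Pt)
    obtain h where h: "ks_entropy M shift_map = ereal h" using eq by (cases "ks_entropy M shift_map") auto
    have "h - t * freq M = 0" using eq by (simp add: h)
    moreover have "h - t' * freq M \<le> 0" using Pr_ge[OF M, of t'] by (simp add: h t')
    ultimately have "(t - t') * freq M \<le> 0" by (simp add: algebra_simps)
    then have "freq M \<le> 0" using t' by (simp add: mult_le_0_iff)
    moreover have "freq M \<ge> 0" by (simp add: freq_def)
    ultimately show "M = \<delta>0" by (intro eq_\<delta>0[OF M]) linarith
  qed
qed

section \<open>Pressure in terms of block sums\<close>

lemma Pr_le_of_block_sums: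
  assumes t: "t \<ge> 0" and le1: "\<And>q F. q > 0 \<Longrightarrow> finite F \<Longrightarrow> F \<subseteq> A \<Longrightarrow> (\<Sum>i\<in>F. wt q t (blk i)) \<le> 1"
  shows "Pr t = 0"
proof -
  have "Pr t \<le> 0"
  proof (rule ereal_le_epsilon2[rule_format])
    fix q :: real assume q: "q > 0"
    have "Pr t \<le> ereal q"
      unfolding Pr_eq
    proof (rule SUP_least)
      fix M assume M: "M \<in> invariant_measures X"
      have "ks_entropy M shift_map \<le> ereal (q + t * freq M)"
        unfolding freq_def using q t le1[OF q] by (intro ks_entropy_le_pressure[OF M]) auto
      then have "ks_entropy M shift_map + ereal (- t * freq M) \<le> ereal (q + t * freq M) + ereal (- t * freq M)"
        by (rule add_right_mono)
      then show "ks_entropy M shift_map + ereal (- t * freq M) \<le> ereal q" by simp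
    qed
    then show "Pr t \<le> 0 + ereal q" by simp
  qed
  then show ?thesis using Pr_nonneg[of t] by simp
qed

text \<open>Raising \<open>q\<close> to the value \<open>p\<close> with unit block sum yields
  matching bounds: no measure exceeds \<open>p\<close> and the stationary process attains it.
  Uniqueness then rests on the word frequencies.\<close>

lemma unique_equilibrium_of_block_sums:
  assumes t: "t \<ge> 0" and q: "q > 0" and F: "finite F" "F \<subseteq> A" "(\<Sum>i\<in>F. wt q t (blk i)) > 1"
  shows "Pr t > 0 \<and> (\<exists>!M. equilibrium_state X (\<lambda>x. t * \<phi> x) M)"
proof -
  obtain p where p: "p \<ge> q" "((\<lambda>i. wt p t (blk i)) has_sum 1) A"
    using exists_unit_block_sum[OF t q F] by blast
  then interpret U: unit_block_shift A X p t
    using t q by unfold_locales auto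
  have le: "ks_entropy M shift_map + ereal (- t * freq M) \<le> ereal p" if M: "M \<in> invariant_measures X" for M
  proof -
    have "ks_entropy M shift_map \<le> ereal (p + t * freq M)"
      unfolding freq_def using p q t by (intro ks_entropy_le_pressure[OF M] finite_sum_le_has_sum[OF p(2)]) auto
    then have "ks_entropy M shift_map + ereal (- t * freq M) \<le> ereal (p + t * freq M) + ereal (- t * freq M)"
      by (rule add_right_mono)
    then show ?thesis by simp
  qed
  have "ereal (p + t * freq U.equilibrium) \<le> ks_entropy U.equilibrium shift_map"
    unfolding freq_def by (rule U.ks_entropy_equilibrium_ge[OF U.A_nonempty])
  then have "ereal (p + t * freq U.equilibrium) + ereal (- t * freq U.equilibrium) \<le>
      ks_entropy U.equilibrium shift_map + ereal (- t * freq U.equilibrium)"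
    by (rule add_right_mono)
  then have ge: "ereal p \<le> ks_entropy U.equilibrium shift_map + ereal (- t * freq U.equilibrium)" by simp
  have Pp: "Pr t = ereal p"
    using le ge Pr_ge[OF U.equilibrium_invariant, of t] by (intro antisym) (auto simp: Pr_eq intro: SUP_least order_trans)
  have eq: "equilibrium_state X (\<lambda>x. t * \<phi> x) U.equilibrium"
    using le[OF U.equilibrium_invariant] ge U.equilibrium_invariant by (simp add: equilibrium_state_iff Pp)
  have ge': "M \<in> invariant_measures X \<and> ereal (p + t * freq M) \<le> ks_entropy M shift_map"
    if "equilibrium_state X (\<lambda>x. t * \<phi> x) M" for M
  proof -
    have "M \<in> invariant_measures X" "ks_entropy M shift_map + ereal (- t * freq M) = ereal p"
      using that by (auto simp: equilibrium_state_iff Pp)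
    then show ?thesis by (cases "ks_entropy M shift_map") auto
  qed
  have "Pr t > 0" using p q by (simp add: Pp)
  moreover have "\<exists>!M. equilibrium_state X (\<lambda>x. t * \<phi> x) M"
    using eq ge' U.equilibrium_unique[folded freq_def] by (intro ex1I[of _ U.equilibrium]) blast+
  ultimately show ?thesis by blast
qed

text \<open>Positive pressure must come from a block sum above one. In an equilibrium state the
  entropy is the pressure plus \<open>t * freq M\<close>, hence positive.\<close>

lemma unique_equilibrium_below:
  assumes t: "t \<ge> 0" and "ereal t < t0"
  shows "(\<exists>!M. equilibrium_state X (\<lambda>x. t * \<phi> x) M) \<and>
    (\<forall>M. equilibrium_state X (\<lambda>x. t * \<phi> x) M \<longrightarrow> ks_entropy M shift_map > 0)"
proof
  have pos: "Pr t > 0" using assms by (simp add: Pr_pos_iff)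
  then obtain q F where "q > 0" "finite F" "F \<subseteq> A" "(\<Sum>i\<in>F. wt q t (blk i)) > 1"
    using Pr_le_of_block_sums[OF t] by (metis less_irrefl not_le)
  from unique_equilibrium_of_block_sums[OF t this]
  show "\<exists>!M. equilibrium_state X (\<lambda>x. t * \<phi> x) M" by blast
  show "\<forall>M. equilibrium_state X (\<lambda>x. t * \<phi> x) M \<longrightarrow> ks_entropy M shift_map > 0"
  proof (intro allI impI)
    fix M assume "equilibrium_state X (\<lambda>x. t * \<phi> x) M"
    then have eq: "ks_entropy M shift_map + ereal (- t * freq M) = Pr t" by (simp add: equilibrium_state_iff)
    have "0 \<le> t * freq M" using t by simp
    then show "ks_entropy M shift_map > 0"
      using pos unfolding eq[symmetric] by (cases "ks_entropy M shift_map") auto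
  qed
qed

lemma t0_finite_iff: "t0 < \<infinity> \<longleftrightarrow>
  (\<exists>t\<ge>0. \<forall>q>0. \<forall>F. finite F \<longrightarrow> F \<subseteq> A \<longrightarrow> (\<Sum>i\<in>F. wt q t (blk i)) \<le> 1)"
proof
  assume "t0 < \<infinity>"
  then obtain s where "Pr s = 0" unfolding t0_def Inf_less_iff by auto
  \<comment> \<open>Replacing \<open>s\<close> by \<open>max s 0\<close> keeps zero pressure by
    monotonicity and reaches the range where block sums describe the pressure.\<close>
  then have "Pr (max s 0) = 0"
    using antimonoD[OF antimono_Pr, of s "max s 0"] Pr_nonneg[of "max s 0"] by simp
  then have "(\<Sum>i\<in>F. wt q (max s 0) (blk i)) \<le> 1" if "q > 0" "finite F" "F \<subseteq> A" for q F
    using unique_equilibrium_of_block_sums[OF _ that, of "max s 0"] by (cases "(\<Sum>i\<in>F. wt q (max s 0) (blk i)) \<le> 1") (simp_all add: \<open>Pr (max s 0) = 0\<close>)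
  then show "\<exists>t\<ge>0. \<forall>q>0. \<forall>F. finite F \<longrightarrow> F \<subseteq> A \<longrightarrow> (\<Sum>i\<in>F. wt q t (blk i)) \<le> 1"
    by (intro exI[of _ "max s 0"]) simp
next
  assume "\<exists>t\<ge>0. \<forall>q>0. \<forall>F. finite F \<longrightarrow> F \<subseteq> A \<longrightarrow> (\<Sum>i\<in>F. wt q t (blk i)) \<le> 1"
  then obtain t where t: "t \<ge> 0" "\<And>q F. q > 0 \<Longrightarrow> finite F \<Longrightarrow> F \<subseteq> A \<Longrightarrow> (\<Sum>i\<in>F. wt q t (blk i)) \<le> 1"
    by auto
  have "Pr t = 0" by (rule Pr_le_of_block_sums[OF t])
  then have "t0 \<le> ereal t" unfolding t0_def by (intro Inf_lower) blast
  then show "t0 < \<infinity>" by auto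
qed

end

section \<open>Hamming approachability\<close>

lemma hamming_dist_self [simp]: "hamming_dist v v = 0"
  by (simp add: hamming_dist_def)

lemma hamming_dist_le_length: "hamming_dist v w \<le> length v"
proof -
  have "hamming_dist v w \<le> card {..<length v}"
    unfolding hamming_dist_def by (intro card_mono) auto
  then show ?thesis by simp
qed

lemma hamming_dist_append:
  assumes "length x = length x'"
  shows "hamming_dist (x @ y) (x' @ y') \<le> hamming_dist x x' + hamming_dist y y'"
proof -
  let ?A = "{i. i < length x \<and> x ! i \<noteq> x' ! i}" and ?B = "{i. i < length y \<and> y ! i \<noteq> y' ! i}"
  have "{i. i < length (x @ y) \<and> (x @ y) ! i \<noteq> (x' @ y') ! i} \<subseteq> ?A \<union> (+) (length x) ` ?B"
  proof
    fix i assume i: "i \<in> {i. i < length (x @ y) \<and> (x @ y) ! i \<noteq> (x' @ y') ! i}"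
    show "i \<in> ?A \<union> (+) (length x) ` ?B"
    proof (cases "i < length x")
      case True
      then show ?thesis using i assms by (auto simp: nth_append)
    next
      case False
      then have "i - length x \<in> ?B" using i assms by (auto simp: nth_append)
      then have "length x + (i - length x) \<in> (+) (length x) ` ?B" by (rule imageI)
      then show ?thesis using False by simp
    qed
  qed
  then have "hamming_dist (x @ y) (x' @ y') \<le> card (?A \<union> (+) (length x) ` ?B)"
    unfolding hamming_dist_def by (intro card_mono) auto
  also have "\<dots> \<le> card ?A + card ((+) (length x) ` ?B)" by (rule card_Un_le)
  also have "\<dots> = hamming_dist x x' + hamming_dist y y'" by (simp add: hamming_dist_def card_image)
  finally show ?thesis .
qed

lemma hamming_dist_triangle:
  assumes "length u = length v"
  shows "hamming_dist u w \<le> hamming_dist u v + hamming_dist v w"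
proof -
  have "hamming_dist u w \<le> card ({i. i < length u \<and> u ! i \<noteq> v ! i} \<union> {i. i < length v \<and> v ! i \<noteq> w ! i})"
    unfolding hamming_dist_def using assms by (intro card_mono) auto
  also have "\<dots> \<le> hamming_dist u v + hamming_dist v w"
    unfolding hamming_dist_def by (rule card_Un_le)
  finally show ?thesis .
qed

lemma hamming_dist_zeros_ones:
  assumes "a + b = c + d" "a \<le> c + m" "c \<le> a + m"
  shows "hamming_dist (zeros_ones a b) (zeros_ones c d) \<le> m"
proof -
  have nth: "zeros_ones k l ! i = (if i < k then 0 else 1)" if "i < k + l" for i k l
    using that by (simp add: zeros_ones_def nth_append)
  have "hamming_dist (zeros_ones a b) (zeros_ones c d) \<le> card {min a c..<max a c}"
    unfolding hamming_dist_def
  proof (intro card_mono subsetI)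
    fix i assume "i \<in> {i. i < length (zeros_ones a b) \<and> zeros_ones a b ! i \<noteq> zeros_ones c d ! i}"
    then show "i \<in> {min a c..<max a c}" using assms(1) by (auto simp: nth split: if_splits)
  qed simp
  also have "\<dots> \<le> m" using assms by (auto simp: min_def max_def)
  finally show ?thesis .
qed

locale block_rule =
  fixes f :: "nat \<Rightarrow> nat" and n1 :: nat
  assumes f_pos: "\<And>n. n \<ge> 1 \<Longrightarrow> f n \<ge> 1"
    and f_mono: "\<And>m n. 1 \<le> m \<Longrightarrow> m \<le> n \<Longrightarrow> f m \<le> f n"
    and n1: "n1 \<ge> 1" "\<And>n. n \<ge> n1 \<Longrightarrow> 2 * f n \<le> n"
begin

definition A :: "(nat \<times> nat) set" where
  "A = {(a, b). f (a + b + 2) \<le> Suc a \<and> f (a + b + 2) \<le> Suc b}"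

text \<open>Clip the number of zeros to the interval from \<open>f n\<close> to
  \<open>n - f n\<close>, nonempty as \<open>2 * f n \<le> n\<close>. The boundary between zeros and
  ones moves by at most \<open>f n\<close>, so at most that many symbols change.\<close>

lemma zeros_ones_near_block:
  assumes "c + d \<ge> n1" "c + d \<le> N"
  shows "\<exists>i\<in>A. length (blk i) = c + d \<and> hamming_dist (blk i) (zeros_ones c d) \<le> f N"
proof -
  define n where "n = c + d"
  define a where "a = max (f n) (min c (n - f n))"
  have f: "2 * f n \<le> n" "f n \<ge> 1" using n1 assms f_pos by (auto simp: n_def)
  have a: "a \<ge> f n" "a \<le> n - f n" using f by (auto simp: a_def)
  have ac: "a \<le> c + f n" "c \<le> a + f n" using f by (auto simp: a_def n_def)
  define i where "i = (a - 1, n - a - 1)"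
  have "Suc (n - Suc a) = n - a" using a f by (intro Suc_diff_Suc) linarith
  then have blk: "blk i = zeros_ones a (n - a)" using a f by (simp add: i_def blk_def)
  have "a - 1 + (n - a - 1) + 2 = n" using a f by linarith
  then have "i \<in> A" using a f by (auto simp: i_def A_def)
  moreover have "length (blk i) = c + d" using a f by (simp add: blk n_def)
  moreover have "hamming_dist (blk i) (zeros_ones c d) \<le> f n"
    unfolding blk using a ac by (intro hamming_dist_zeros_ones) (auto simp: n_def)
  moreover have "f n \<le> f N" using f_mono[of n N] assms n1 by (simp add: n_def)
  ultimately show ?thesis by (meson order_trans)
qed

lemma zeros_blk: "replicate k 0 @ blk i = zeros_ones (k + Suc (fst i)) (Suc (snd i))"
  by (simp add: blk_def zeros_ones_def replicate_add del: replicate_Suc add_Suc_right)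

lemma blk_ones: "blk i @ replicate k 1 = zeros_ones (Suc (fst i)) (Suc (snd i) + k)"
  by (simp add: blk_def zeros_ones_def replicate_add[symmetric] del: replicate_Suc)

text \<open>A short piece \<open>u\<close> swallows blocks until it has \<open>n1\<close> symbols.
  Overwriting what precedes the last swallowed block by zeros costs fewer than \<open>n1\<close>
  changes and gives a word 0^a 1^b, which is then adjusted at cost \<open>f N\<close>.\<close>

lemma repair_left:
  assumes "js \<in> lists A" "length u < n1" "length (u @ cat js) \<ge> n1" "length (u @ cat js) \<le> N"
  shows "\<exists>js'\<in>lists A. length (cat js') = length (u @ cat js) \<and>
    hamming_dist (cat js') (u @ cat js) \<le> n1 + f N"
  using assms
proof (induction js arbitrary: u rule: list.induct)
  case (Cons i js)
  show ?case
  proof (cases "length (u @ blk i) \<ge> n1")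
    case True
    let ?z = "replicate (length u) 0 @ blk i"
    have "length (blk i) = Suc (fst i) + Suc (snd i)" by (simp add: length_blk)
    then obtain j where j: "j \<in> A" "length (blk j) = length ?z" "hamming_dist (blk j) ?z \<le> f N"
      using zeros_ones_near_block[of "length u + Suc (fst i)" "Suc (snd i)" N] True Cons.prems(4)
      unfolding zeros_blk by auto
    have "hamming_dist (blk j) (u @ blk i) \<le> hamming_dist (blk j) ?z + hamming_dist ?z (u @ blk i)"
      using j(2) by (rule hamming_dist_triangle)
    also have "hamming_dist ?z (u @ blk i) \<le> hamming_dist (replicate (length u) 0) u + hamming_dist (blk i) (blk i)"
      by (rule hamming_dist_append) simp
    also have "hamming_dist (replicate (length u) 0) u \<le> length u"
      using hamming_dist_le_length[of "replicate (length u) 0" u] by simp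
    finally have "hamming_dist (blk j) (u @ blk i) \<le> n1 + f N" using j(3) Cons.prems(2) by simp
    moreover have "hamming_dist (cat (j # js)) (u @ cat (i # js)) \<le>
        hamming_dist (blk j) (u @ blk i) + hamming_dist (cat js) (cat js)"
      using hamming_dist_append[of "blk j" "u @ blk i" "cat js" "cat js"] j(2) by simp
    ultimately show ?thesis using j Cons.prems(1) by (intro bexI[of _ "j # js"]) auto
  next
    case False
    then show ?thesis using Cons.IH[of "u @ blk i"] Cons.prems by auto
  qed
qed simp

text \<open>The mirror image: what follows the last swallowed block is overwritten by ones, which
  prolong that block.\<close>

lemma repair_right:
  assumes "js \<in> lists A" "length s < n1" "length (cat js @ s) \<ge> n1" "length (cat js @ s) \<le> N"
  shows "\<exists>js'\<in>lists A. length (cat js') = length (cat js @ s) \<and>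
    hamming_dist (cat js') (cat js @ s) \<le> n1 + f N"
  using assms
proof (induction js arbitrary: s rule: rev_induct)
  case (snoc i js)
  show ?case
  proof (cases "length (blk i @ s) \<ge> n1")
    case True
    let ?z = "blk i @ replicate (length s) 1"
    have "length (blk i) = Suc (fst i) + Suc (snd i)" by (simp add: length_blk)
    then obtain j where j: "j \<in> A" "length (blk j) = length ?z" "hamming_dist (blk j) ?z \<le> f N"
      using zeros_ones_near_block[of "Suc (fst i)" "Suc (snd i) + length s" N] True snoc.prems(4)
      unfolding blk_ones by auto
    have "hamming_dist (blk j) (blk i @ s) \<le> hamming_dist (blk j) ?z + hamming_dist ?z (blk i @ s)"
      using j(2) by (rule hamming_dist_triangle)
    also have "hamming_dist ?z (blk i @ s) \<le> hamming_dist (blk i) (blk i) + hamming_dist (replicate (length s) 1) s"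
      by (rule hamming_dist_append) simp
    also have "hamming_dist (replicate (length s) 1) s \<le> length s"
      using hamming_dist_le_length[of "replicate (length s) 1" s] by simp
    finally have "hamming_dist (blk j) (blk i @ s) \<le> n1 + f N" using j(3) snoc.prems(2) by simp
    moreover have "hamming_dist (cat (js @ [j])) (cat (js @ [i]) @ s) \<le>
        hamming_dist (cat js) (cat js) + hamming_dist (blk j) (blk i @ s)"
      using hamming_dist_append[of "cat js" "cat js" "blk j" "blk i @ s"] by simp
    ultimately show ?thesis using j snoc.prems(1) by (intro bexI[of _ "js @ [j]"]) auto
  next
    case False
    then show ?thesis using snoc.IH[of "blk i @ s"] snoc.prems by auto
  qed
qed simp

text \<open>A long end piece is adjusted on its own; a short one is merged with neighbouring
  blocks.\<close>

lemma repair_prefix: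
  assumes js: "js \<in> lists A" and len: "length (zeros_ones a b @ cat js) \<ge> n1" "length (zeros_ones a b @ cat js) \<le> N"
  shows "\<exists>js'\<in>lists A. length (cat js') = length (zeros_ones a b @ cat js) \<and>
    hamming_dist (cat js') (zeros_ones a b @ cat js) \<le> n1 + f N"
proof (cases "a + b < n1")
  case True
  then show ?thesis using repair_left[OF js _ len] by simp
next
  case False
  then obtain j where j: "j \<in> A" "length (blk j) = a + b" "hamming_dist (blk j) (zeros_ones a b) \<le> f N"
    using zeros_ones_near_block[of a b N] len by auto
  have "hamming_dist (cat (j # js)) (zeros_ones a b @ cat js) \<le> n1 + f N"
    using hamming_dist_append[of "blk j" "zeros_ones a b" "cat js" "cat js"] j by simp
  then show ?thesis using j js by (intro bexI[of _ "j # js"]) auto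
qed

lemma repair_suffix:
  assumes js: "js \<in> lists A" and len: "length (cat js @ zeros_ones a b) \<ge> n1" "length (cat js @ zeros_ones a b) \<le> N"
  shows "\<exists>js'\<in>lists A. length (cat js') = length (cat js @ zeros_ones a b) \<and>
    hamming_dist (cat js') (cat js @ zeros_ones a b) \<le> n1 + f N"
proof (cases "a + b < n1")
  case True
  then show ?thesis using repair_right[OF js _ len] by simp
next
  case False
  then obtain j where j: "j \<in> A" "length (blk j) = a + b" "hamming_dist (blk j) (zeros_ones a b) \<le> f N"
    using zeros_ones_near_block[of a b N] len by auto
  have "hamming_dist (cat (js @ [j])) (cat js @ zeros_ones a b) \<le> n1 + f N"
    using hamming_dist_append[of "cat js" "cat js" "blk j" "zeros_ones a b"] j by simp
  then show ?thesis using j js by (intro bexI[of _ "js @ [j]"]) auto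
qed

text \<open>The initial part is repaired before the final one, each at cost
  \<open>n1 + f (length w)\<close>. If the initial piece and the blocks together are shorter than
  \<open>n1\<close>, they are overwritten by zeros and merged with the final piece into one word 0^a
  1^b.\<close>

lemma word_near_concatenation:
  assumes js: "js \<in> lists A" and w: "w = zeros_ones a b @ cat js @ zeros_ones c d"
    and len: "length w \<ge> 2 * n1"
  shows "\<exists>js'\<in>lists A. length (cat js') = length w \<and>
    hamming_dist (cat js') w \<le> 2 * n1 + 2 * f (length w)"
proof (cases "length (zeros_ones a b @ cat js) \<ge> n1")
  case True
  obtain ks where ks: "ks \<in> lists A" "length (cat ks) = length (zeros_ones a b @ cat js)"
    "hamming_dist (cat ks) (zeros_ones a b @ cat js) \<le> n1 + f (length w)"
    using repair_prefix[OF js True, of "length w"] by (auto simp: w)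
  then obtain ls where ls: "ls \<in> lists A" "length (cat ls) = length (cat ks @ zeros_ones c d)"
    "hamming_dist (cat ls) (cat ks @ zeros_ones c d) \<le> n1 + f (length w)"
    using repair_suffix[OF ks(1), of c d "length w"] True by (auto simp: w)
  have "hamming_dist (cat ls) w \<le> hamming_dist (cat ls) (cat ks @ zeros_ones c d) + hamming_dist (cat ks @ zeros_ones c d) w"
    using ls(2) by (rule hamming_dist_triangle)
  also have "hamming_dist (cat ks @ zeros_ones c d) w \<le> hamming_dist (cat ks) (zeros_ones a b @ cat js)"
    using hamming_dist_append[OF ks(2), of "zeros_ones c d" "zeros_ones c d"] by (simp add: w)
  finally show ?thesis using ks ls by (intro bexI[of _ ls]) (auto simp: w)
next
  case False
  let ?u = "zeros_ones a b @ cat js"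
  let ?z = "replicate (length ?u) 0 @ zeros_ones c d"
  have z: "?z = zeros_ones (length ?u + c) d" by (simp add: zeros_ones_def replicate_add)
  obtain j where j: "j \<in> A" "length (blk j) = length ?z" "hamming_dist (blk j) ?z \<le> f (length w)"
    using zeros_ones_near_block[of "length ?u + c" d "length w"] len n1(1) unfolding z by (auto simp: w)
  have "hamming_dist (blk j) w \<le> hamming_dist (blk j) ?z + hamming_dist ?z w"
    using j(2) by (rule hamming_dist_triangle)
  also have "hamming_dist ?z w \<le> hamming_dist (replicate (length ?u) 0) ?u + hamming_dist (zeros_ones c d) (zeros_ones c d)"
    using hamming_dist_append[of "replicate (length ?u) 0" ?u "zeros_ones c d" "zeros_ones c d"] by (simp add: w)
  also have "hamming_dist (replicate (length ?u) 0) ?u \<le> length ?u"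
    using hamming_dist_le_length[of "replicate (length ?u) 0" ?u] by simp
  finally show ?thesis using j False by (intro bexI[of _ "[j]"]) (auto simp: w)
qed

section \<open>Finiteness of the transition parameter\<close>

text \<open>One block per length is enough: \<open>f n\<close> ones after \<open>n - f n\<close>
  zeros, allowed because \<open>2 * f n \<le> n\<close>. As \<open>q\<close> tends to zero its
  weight tends to \<open>exp (- t) ^ f n\<close>.\<close>

lemma block_sums_bounded_imp_summable:
  assumes t: "t \<ge> 0" and le1: "\<And>q F. q > 0 \<Longrightarrow> finite F \<Longrightarrow> F \<subseteq> A \<Longrightarrow> (\<Sum>i\<in>F. wt q t (blk i)) \<le> 1"
  shows "(\<lambda>n. exp (- t) ^ f n) summable_on {1..}"
proof -
  have "(\<lambda>n. exp (- t) ^ f n) summable_on {n1..}"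
  proof (rule nonneg_bdd_above_summable_on)
    show "bdd_above (sum (\<lambda>n. exp (- t) ^ f n) ` {F. F \<subseteq> {n1..} \<and> finite F})"
    proof (rule bdd_aboveI2)
      fix F assume "F \<in> {F. F \<subseteq> {n1..} \<and> finite F}"
      then have F: "F \<subseteq> {n1..}" "finite F" by auto
      define i where "i n = (n - f n - 1, f n - 1)" for n
      have fn: "2 * f n \<le> n" "f n \<ge> 1" if "n \<in> F" for n
        using that F(1) n1 f_pos[of n] by auto
      have iA: "i n \<in> A" and blk: "blk (i n) = zeros_ones (n - f n) (f n)" and len: "length (blk (i n)) = n" if "n \<in> F" for n
      proof -
        have "n - f n - 1 + (f n - 1) + 2 = n" using fn[OF that] by linarith
        then show "i n \<in> A" using fn[OF that] unfolding i_def A_def mem_Collect_eq split_conv by simp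
        show b: "blk (i n) = zeros_ones (n - f n) (f n)"
        proof -
          have "Suc (n - f n - 1) = n - f n" "Suc (f n - 1) = f n" using fn[OF that] by linarith+
          then show ?thesis by (simp only: i_def blk_def fst_conv snd_conv)
        qed
        show "length (blk (i n)) = n" using fn[OF that] by (simp add: b)
      qed
      have inj: "inj_on i F" by (metis inj_onI len)
      have sum_le: "(\<Sum>n\<in>F. exp (- q) ^ (n - f n) * exp (- (q + t)) ^ f n) \<le> 1" if q: "q > 0" for q
      proof -
        have "(\<Sum>n\<in>F. exp (- q) ^ (n - f n) * exp (- (q + t)) ^ f n) = (\<Sum>n\<in>F. wt q t (blk (i n)))"
          by (intro sum.cong refl) (simp add: blk wt_zeros_ones)
        also have "\<dots> = (\<Sum>i\<in>i ` F. wt q t (blk i))" using inj by (simp add: sum.reindex)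
        also have "\<dots> \<le> 1" using F iA by (intro le1[OF q]) auto
        finally show ?thesis .
      qed
      \<comment> \<open>The sum is finite, so the bound passes to the limit \<open>q = 0\<close>, a
        value outside the hypothesis.\<close>
      have "((\<lambda>q. \<Sum>n\<in>F. exp (- q) ^ (n - f n) * exp (- (q + t)) ^ f n) \<longlongrightarrow>
          (\<Sum>n\<in>F. exp (- 0) ^ (n - f n) * exp (- (0 + t)) ^ f n)) (at_right 0)"
        by (intro tendsto_intros)
      then have "(\<Sum>n\<in>F. exp (- 0) ^ (n - f n) * exp (- (0 + t)) ^ f n) \<le> (1 :: real)"
      proof (rule tendsto_upperbound)
        show "\<forall>\<^sub>F q in at_right 0. (\<Sum>n\<in>F. exp (- q) ^ (n - f n) * exp (- (q + t)) ^ f n) \<le> 1"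
          by (rule eventually_mono[OF eventually_at_right_less sum_le])
      qed simp
      then show "(\<Sum>n\<in>F. exp (- t) ^ f n) \<le> 1" by simp
    qed
  qed auto
  moreover have "(\<lambda>n. exp (- t) ^ f n) summable_on {1..<n1}" by (rule summable_on_finite) simp
  ultimately have "(\<lambda>n. exp (- t) ^ f n) summable_on ({1..<n1} \<union> {n1..})"
    by (intro summable_on_Un_disjoint) auto
  moreover have "{1..<n1} \<union> {n1..} = {1..}" using n1(1) by auto
  ultimately show ?thesis by simp
qed

text \<open>A block is named by its length \<open>m\<close> and the excess \<open>r\<close> of its
  ones over \<open>f m\<close>. Since it has at least one 1, the choice
  \<open>exp (- t) = \<gamma> ^ (k + 1)\<close> gives a weight of at most
  \<open>\<gamma> ^ k * \<gamma> ^ f m * \<gamma> ^ r\<close>; the double sum is at most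
  \<open>\<gamma> ^ k * S / (1 - \<gamma>)\<close>.\<close>

lemma summable_imp_block_sums_bounded:
  fixes \<gamma> :: real
  assumes \<gamma>: "\<gamma> > 0" and sm: "(\<lambda>n. \<gamma> ^ f n) summable_on {1..}"
  shows "\<exists>t\<ge>0. \<forall>q>0. \<forall>F. finite F \<longrightarrow> F \<subseteq> A \<longrightarrow> (\<Sum>i\<in>F. wt q t (blk i)) \<le> 1"
proof -
  define S where "S = (\<Sum>\<^sub>\<infinity>n\<in>{1..}. \<gamma> ^ f n)"
  have S: "(\<Sum>n\<in>F. \<gamma> ^ f n) \<le> S" if "finite F" "F \<subseteq> {1..}" for F
    unfolding S_def using \<gamma> by (intro finite_sum_le_infsum[OF sm that]) auto
  have S0: "S \<ge> 0" using S[of "{}"] by simp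
  \<comment> \<open>With \<open>\<gamma> \<ge> 1\<close> every term would be at least one and the
    partial sums would be unbounded.\<close>
  have \<gamma>1: "\<gamma> < 1"
  proof (rule ccontr)
    assume "\<not> \<gamma> < 1"
    obtain m :: nat where m: "real m > S" using reals_Archimedean2 by blast
    have "real m = (\<Sum>n\<in>{1..m}. 1)" by simp
    also have "\<dots> \<le> (\<Sum>n\<in>{1..m}. \<gamma> ^ f n)" using \<open>\<not> \<gamma> < 1\<close> by (intro sum_mono one_le_power) auto
    also have "\<dots> \<le> S" by (rule S) auto
    finally show False using m by simp
  qed
  have "(\<lambda>k. \<gamma> ^ k * (S / (1 - \<gamma>))) \<longlonglongrightarrow> 0 * (S / (1 - \<gamma>))"
    using \<gamma> \<gamma>1 by (intro tendsto_intros LIMSEQ_power_zero) auto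
  then have "\<forall>\<^sub>F k in sequentially. \<gamma> ^ k * (S / (1 - \<gamma>)) < 1"
    by (intro order_tendstoD) auto
  \<comment> \<open>This \<open>k\<close> makes the final bound on the block sum less than
    one.\<close>
  then obtain k where k: "\<gamma> ^ k * (S / (1 - \<gamma>)) < 1" by (auto simp: eventually_sequentially)
  define t where "t = real (Suc k) * (- ln \<gamma>)"
  have t0: "t \<ge> 0" unfolding t_def using \<gamma> \<gamma>1 by (intro mult_nonneg_nonneg) auto
  have et: "exp (- t) = \<gamma> ^ Suc k"
    using \<gamma> by (simp add: t_def exp_of_nat_mult[symmetric] ln_realpow[symmetric] del: power_Suc of_nat_Suc)
  have "(\<Sum>i\<in>F. wt q t (blk i)) \<le> 1" if q: "q > 0" and F: "finite F" "F \<subseteq> A" for q F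
  proof -
    define g where "g i = (fst i + snd i + 2, Suc (snd i) - f (fst i + snd i + 2))" for i :: "nat \<times> nat"
    have inj: "inj_on g F"
    proof (rule inj_onI)
      fix i j assume ij: "i \<in> F" "j \<in> F" "g i = g j"
      have "f (fst i + snd i + 2) \<le> Suc (snd i)" "f (fst j + snd j + 2) \<le> Suc (snd j)"
        using ij F(2) by (auto simp: A_def)
      moreover have "fst i + snd i = fst j + snd j"
        "Suc (snd i) - f (fst i + snd i + 2) = Suc (snd j) - f (fst j + snd j + 2)"
        using ij(3) by (auto simp: g_def)
      ultimately show "i = j" by (auto simp: prod_eq_iff)
    qed
    have le: "wt q t (blk i) \<le> \<gamma> ^ k * (\<gamma> ^ f (fst (g i)) * \<gamma> ^ snd (g i))" if i: "i \<in> F" for i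
    proof -
      have fi: "f (fst i + snd i + 2) \<le> Suc (snd i)" using i F(2) by (auto simp: A_def)
      have "wt q t (blk i) = exp (- q) ^ (Suc (fst i) + Suc (snd i)) * exp (- t) ^ Suc (snd i)"
        unfolding blk_def wt_zeros_ones power_add
        by (simp add: power_mult_distrib[symmetric] exp_add[symmetric] del: power_Suc)
      also have "\<dots> \<le> 1 * exp (- t) ^ Suc (snd i)"
        using q by (intro mult_right_mono power_le_one) auto
      also have "\<dots> = \<gamma> ^ (Suc k * Suc (snd i))" by (simp only: et power_mult mult_1)
      also have "\<dots> \<le> \<gamma> ^ (k + f (fst (g i)) + snd (g i))"
        using \<gamma> \<gamma>1 fi by (intro power_decreasing) (auto simp: g_def)
      finally show ?thesis by (simp add: power_add)
    qed
    define n where "n = Max (fst ` g ` F \<union> snd ` g ` F)"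
    have sub: "g ` F \<subseteq> {1..n} \<times> {..n}"
    proof (rule image_subsetI)
      fix i assume "i \<in> F"
      then have "fst (g i) \<le> n" "snd (g i) \<le> n"
        using F(1) unfolding n_def by (auto intro!: Max_ge)
      then show "g i \<in> {1..n} \<times> {..n}" by (cases "g i") (auto simp: g_def)
    qed
    have geo: "(\<Sum>r\<le>n. \<gamma> ^ r) \<le> 1 / (1 - \<gamma>)"
      using sum_le_suminf[OF summable_geometric[of \<gamma>], of "{..n}"] \<gamma> \<gamma>1 by (simp add: suminf_geometric)
    have "(\<Sum>i\<in>F. wt q t (blk i)) \<le> (\<Sum>i\<in>F. \<gamma> ^ k * (\<gamma> ^ f (fst (g i)) * \<gamma> ^ snd (g i)))"
      by (intro sum_mono le)
    also have "\<dots> = \<gamma> ^ k * (\<Sum>z\<in>g ` F. \<gamma> ^ f (fst z) * \<gamma> ^ snd z)"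
      using inj by (simp add: sum.reindex sum_distrib_left)
    also have "\<dots> \<le> \<gamma> ^ k * (\<Sum>z\<in>{1..n} \<times> {..n}. \<gamma> ^ f (fst z) * \<gamma> ^ snd z)"
      using \<gamma> by (intro mult_left_mono sum_mono2 sub) auto
    also have "(\<Sum>z\<in>{1..n} \<times> {..n}. \<gamma> ^ f (fst z) * \<gamma> ^ snd z) = (\<Sum>m\<in>{1..n}. \<gamma> ^ f m) * (\<Sum>r\<le>n. \<gamma> ^ r)"
      by (simp add: sum_product sum.cartesian_product case_prod_unfold)
    also have "\<gamma> ^ k * \<dots> \<le> \<gamma> ^ k * (S * (1 / (1 - \<gamma>)))"
      using \<gamma> S0 geo by (intro mult_left_mono mult_mono S) (auto intro!: sum_nonneg)
    also have "\<dots> \<le> 1" using k by simp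
    finally show ?thesis .
  qed
  then show ?thesis using t0 by blast
qed

end

section \<open>The coded shift of the words 0^a 1^b with a, b at least f (a + b)\<close>

theorem theorem1p6:
  fixes f :: "nat \<Rightarrow> nat" and n\<^sub>1 :: nat
    and G :: "nat list set" and X :: "(nat \<Rightarrow> nat) set"
    and \<phi> :: "(nat \<Rightarrow> nat) \<Rightarrow> real" and t\<^sub>0 :: ereal
  assumes f_pos: "\<forall>n\<ge>1. f n \<ge> 1"
    and f_mono: "mono_on {1..} f"
    and n1: "n\<^sub>1 \<ge> 1" "\<forall>n\<ge>n\<^sub>1. 1 \<le> f n \<and> real (f n) \<le> real n / 2"
    and G: "G = {replicate a 0 @ replicate b 1 | a b. a \<ge> 1 \<and> b \<ge> 1 \<and> a \<ge> f (a + b) \<and> b \<ge> f (a + b)}"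
    and X: "coded_shift {0, 1} G X"
    and phi: "\<phi> = (\<lambda>x. - indicator {x \<in> X. x 0 = 1} x)"
    and t0: "t\<^sub>0 = Inf {ereal t | t. pressure X (\<lambda>x. t * \<phi> x) = 0}"
  shows "(\<forall>t. pressure X (\<lambda>x. t * \<phi> x) \<ge> 0)
    \<and> antimono (\<lambda>t. pressure X (\<lambda>x. t * \<phi> x))
    \<and> t\<^sub>0 = Sup {ereal t | t. pressure X (\<lambda>x. t * \<phi> x) > 0}
    \<and> hamming_approachable (\<lambda>n. 2 * n\<^sub>1 + 2 * max (f n) n\<^sub>1) (language X) (concatenations G)
    \<and> (\<forall>t\<ge>0. hyperbolic_potential X (\<lambda>x. t * \<phi> x) \<longleftrightarrow> ereal t < t\<^sub>0)
    \<and> (\<forall>t\<ge>0. ereal t < t\<^sub>0 \<longrightarrow>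
         (\<exists>!\<mu>. equilibrium_state X (\<lambda>x. t * \<phi> x) \<mu>) \<and>
         (\<forall>\<mu>. equilibrium_state X (\<lambda>x. t * \<phi> x) \<mu> \<longrightarrow> ks_entropy \<mu> shift_map > 0))
    \<and> (\<forall>t. ereal t > t\<^sub>0 \<longrightarrow>
         (\<forall>\<mu>. equilibrium_state X (\<lambda>x. t * \<phi> x) \<mu> \<longleftrightarrow>
              \<mu> = return (restrict_space borel X) (\<lambda>_. 0)))
    \<and> (t\<^sub>0 < \<infinity> \<longleftrightarrow> (\<exists>\<gamma>::real. \<gamma> > 0 \<and> (\<lambda>n. \<gamma> ^ f n) summable_on {1..}))"
proof -
  interpret B: block_rule f n\<^sub>1
  proof
    show "f m \<le> f n" if "1 \<le> m" "m \<le> n" for m n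
      using mono_onD[OF f_mono, of m n] that by simp
    show "2 * f n \<le> n" if "n \<ge> n\<^sub>1" for n
    proof -
      have "real (f n) \<le> real n / 2" using n1(2) that by blast
      then show ?thesis by linarith
    qed
  qed (use f_pos n1 in auto)
  \<comment> \<open>Exponents in \<open>G\<close> are positive; \<open>blk\<close> stores them
    decreased by one.\<close>
  have G': "G = blk ` B.A"
  proof (intro set_eqI iffI)
    fix w assume "w \<in> G"
    then obtain a b where w: "w = replicate a 0 @ replicate b 1" and ab: "a \<ge> 1" "b \<ge> 1" "a \<ge> f (a + b)" "b \<ge> f (a + b)"
      unfolding G by blast
    have "a - 1 + (b - 1) + 2 = a + b" using ab by linarith
    then have "(a - 1, b - 1) \<in> B.A" using ab by (auto simp: B.A_def)
    moreover have "w = blk (a - 1, b - 1)" using ab by (simp add: w blk_def zeros_ones_def)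
    ultimately show "w \<in> blk ` B.A" by blast
  next
    fix w assume "w \<in> blk ` B.A"
    then obtain a b where ab: "(a, b) \<in> B.A" "w = blk (a, b)" by auto
    then have "w = replicate (Suc a) 0 @ replicate (Suc b) 1" "f (Suc a + Suc b) \<le> Suc a" "f (Suc a + Suc b) \<le> Suc b"
      by (simp_all add: blk_def zeros_ones_def B.A_def)
    then show "w \<in> G" unfolding G by (intro CollectI exI[of _ "Suc a"] exI[of _ "Suc b"]) simp
  qed
  have conc: "concatenations G = cat ` lists B.A"
    by (simp add: concatenations_def G' lists_image image_image)
  have sh: "shift_space {0, 1} X" and L: "language X = {w. \<exists>is\<in>lists B.A. sublist w (cat is)}"
    using X by (auto simp: coded_shift_def conc)
  have X_eq: "X = {x. \<forall>i n. map x [i..<i + n] \<in> language X}"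
    by (rule shift_space_eq_language[OF sh])
  interpret S: block_shift_0 B.A X
  proof
    show "closed X" using sh by (simp add: shift_space_def)
    show "x n \<in> {0, 1}" if "x \<in> X" for x n
    proof -
      have "X \<subseteq> UNIV \<rightarrow> {0, 1}" using sh by (simp add: shift_space_def)
      then show ?thesis using that by blast
    qed
    show "shift_map x \<in> X" if "x \<in> X" for x using sh that by (auto simp: shift_space_def)
    show "X = {x. \<forall>i n. map x [i..<i + n] \<in> language X}" by (rule X_eq)
    show "language X = {w. \<exists>is\<in>lists B.A. sublist w (cat is)}" by (rule L)
    show "(\<lambda>_. 0) \<in> X"
    proof (subst X_eq, intro CollectI allI)
      fix i n :: nat
      \<comment> \<open>The block 0^(m+1) 1^(m+1) has length at least \<open>n\<^sub>1\<close>, so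
        it is in \<open>G\<close>, and it contains \<open>n\<close> zeros.\<close>
      let ?m = "n + n\<^sub>1"
      have "2 * f (?m + ?m + 2) \<le> ?m + ?m + 2" by (rule B.n1(2)) simp
      then have "[(?m, ?m)] \<in> lists B.A" by (simp add: B.A_def)
      moreover have "sublist (replicate n 0) (cat [(?m, ?m)])"
      proof -
        have "cat [(?m, ?m)] = replicate n 0 @ (replicate (Suc n\<^sub>1) 0 @ replicate (Suc ?m) 1)"
          by (simp add: blk_def zeros_ones_def replicate_add[symmetric] append_assoc[symmetric] del: append_assoc replicate_Suc)
        then show ?thesis by (metis prefix_imp_sublist prefixI)
      qed
      moreover have "map (\<lambda>_. 0) [i..<i + n] = replicate n (0 :: nat)"
        by (simp add: map_replicate_const)
      ultimately show "map (\<lambda>_. 0) [i..<i + n] \<in> language X"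
        unfolding L by (metis (mono_tags, lifting) mem_Collect_eq)
    qed
  qed
  have \<phi>: "\<phi> = S.\<phi>" by (simp add: phi S.\<phi>_def)
  have t0': "t\<^sub>0 = S.t0" by (simp add: t0 S.t0_def \<phi>)
  have ham: "hamming_approachable (\<lambda>n. 2 * n\<^sub>1 + 2 * max (f n) n\<^sub>1) (language X) (concatenations G)"
    unfolding hamming_approachable_def
  proof (intro conjI exI allI impI ballI)
    show "concatenations G \<subseteq> language X" unfolding conc L by auto
    \<comment> \<open>The threshold \<open>2 * n\<^sub>1\<close> is the length from which
      \<open>word_near_concatenation\<close> applies.\<close>
    show "1 \<le> 2 * n\<^sub>1" using n1(1) by simp
    fix n w assume n: "2 * n\<^sub>1 \<le> n" and "w \<in> words_of_length (language X) n"
    then have w: "w \<in> language X" "length w = n" by (auto simp: words_of_length_def)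
    obtain a b js c d where js: "js \<in> lists B.A" "w = zeros_ones a b @ cat js @ zeros_ones c d"
      using S.language_parse[OF w(1)] by blast
    obtain ks where ks: "ks \<in> lists B.A" "length (cat ks) = n" "hamming_dist (cat ks) w \<le> 2 * n\<^sub>1 + 2 * f n"
      using B.word_near_concatenation[OF js] n w(2) by auto
    have "cat ks \<in> words_of_length (concatenations G) n"
      using ks by (auto simp: words_of_length_def conc)
    then show "\<exists>v\<in>words_of_length (concatenations G) n. hamming_dist v w \<le> 2 * n\<^sub>1 + 2 * max (f n) n\<^sub>1"
      using ks(3) by (intro bexI[of _ "cat ks"]) auto
  qed
  have fin: "t\<^sub>0 < \<infinity> \<longleftrightarrow> (\<exists>\<gamma>::real. \<gamma> > 0 \<and> (\<lambda>n. \<gamma> ^ f n) summable_on {1..})"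
    unfolding t0' S.t0_finite_iff
  proof
    assume "\<exists>t\<ge>0. \<forall>q>0. \<forall>F. finite F \<longrightarrow> F \<subseteq> B.A \<longrightarrow> (\<Sum>i\<in>F. wt q t (blk i)) \<le> 1"
    then obtain t where "t \<ge> 0" "\<And>q F. q > 0 \<Longrightarrow> finite F \<Longrightarrow> F \<subseteq> B.A \<Longrightarrow> (\<Sum>i\<in>F. wt q t (blk i)) \<le> 1"
      by auto
    from B.block_sums_bounded_imp_summable[OF this]
    show "\<exists>\<gamma>::real. \<gamma> > 0 \<and> (\<lambda>n. \<gamma> ^ f n) summable_on {1..}"
      by (intro exI[of _ "exp (- t)"]) simp
  next
    assume "\<exists>\<gamma>::real. \<gamma> > 0 \<and> (\<lambda>n. \<gamma> ^ f n) summable_on {1..}"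
    then show "\<exists>t\<ge>0. \<forall>q>0. \<forall>F. finite F \<longrightarrow> F \<subseteq> B.A \<longrightarrow> (\<Sum>i\<in>F. wt q t (blk i)) \<le> 1"
      using B.summable_imp_block_sums_bounded by blast
  qed
  show ?thesis
    unfolding \<phi> t0'
    using S.Pr_nonneg S.antimono_Pr S.t0_eq_Sup ham S.hyperbolic_iff S.unique_equilibrium_below
      S.equilibrium_state_above fin[unfolded t0']
    by (intro conjI allI impI) simp_all
qed

end
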